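(* Let $d\geq 1$ be fixed and let $f$ denote the uniform $d$-level AND-OR tree on $N$ variables that has an OR as root. Then $Q_0(f)\in O(N^{1/2+1/d})$ and $R_2(f)\in\Omega(N)$.
   Context: A uniform $d$-level AND-OR tree on $N$ variables is a rooted tree of depth $d$ whose $N$ leaves are the input variables, every internal node has branching factor $N^{1/d}$, and the levels of internal nodes alternate between OR and AND (root OR). In the quantum query model the input $x\in\{0,1\}^N$ is accessed only via the gate $|j,b\rangle\mapsto|j,b\oplus x_j\rangle$. $Q_0(f)$ is the minimal worst-case number of queries of a zero-error quantum algorithm: on each input it outputs $f(x)$ or "don't know", never a wrong value, and "don't know" with probability $\le 1/2$. $R_2(f)$ is the minimal worst-case number of queries of a classical randomized decision tree that outputs $f(x)$ with probability $\ge 2/3$ on every input. *)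

theory Defs
  imports
    "HOL-Probability.Probability_Mass_Function"
    "HOL-Library.Landau_Symbols"
    "HOL-Library.FuncSet"
    "Jordan_Normal_Form.Schur_Decomposition"
begin

no_notation vec_nth (infixl "$" 90)

abbreviation inputs :: "nat \<Rightarrow> (nat \<Rightarrow> bool) set" where
  "inputs N \<equiv> {..<N} \<rightarrow>\<^sub>E UNIV"

text \<open>
  \<open>or_tree d n\<close> is the alternating tree of depth \<open>d\<close> with branching factor \<open>n\<close> and root OR, read as
  a function of its \<open>n ^ d\<close> leaves, which are numbered from left to right. The leaves below
  the \<open>i\<close>-th child of the root are the block of \<open>n ^ (d - 1)\<close> variables starting at
  \<open>i * n ^ (d - 1)\<close>.
\<close>

fun or_tree and_tree :: "nat \<Rightarrow> nat \<Rightarrow> (nat \<Rightarrow> bool) \<Rightarrow> bool" where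
  "or_tree 0 n x = x 0"
| "or_tree (Suc d) n x = (\<exists>i<n. and_tree d n (\<lambda>j. x (i * n ^ d + j)))"
| "and_tree 0 n x = x 0"
| "and_tree (Suc d) n x = (\<forall>i<n. or_tree d n (\<lambda>j. x (i * n ^ d + j)))"

text \<open>
  The state space has the computational basis \<open>|j, b, w\<rangle>\<close> with \<open>j < N\<close>, a bit \<open>b\<close>, and a
  workspace index \<open>w < m\<close>. The vector \<open>|j, b, w\<rangle>\<close> is the unit vector with number
  \<open>basis_index m j b w\<close>, so the state space is the complex space of dimension \<open>2 * N * m\<close>.
\<close>

definition basis_index :: "nat \<Rightarrow> nat \<Rightarrow> bool \<Rightarrow> nat \<Rightarrow> nat" where
  "basis_index m j b w = (2 * j + of_bool b) * m + w"

text \<open>The gate \<open>|j, b, w\<rangle> \<mapsto> |j, b \<oplus> x\<^sub>j, w\<rangle>\<close>; exclusive or on \<^typ>\<open>bool\<close> is \<open>\<noteq>\<close>.\<close>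

definition query_gate :: "nat \<Rightarrow> nat \<Rightarrow> (nat \<Rightarrow> bool) \<Rightarrow> complex mat" where
  "query_gate N m x = mat (2 * N * m) (2 * N * m) (\<lambda>(r, c). of_bool
     (\<exists>j<N. \<exists>b. \<exists>w<m. c = basis_index m j b w \<and> r = basis_index m j (b \<noteq> x j) w))"

definition unitary :: "nat \<Rightarrow> complex mat \<Rightarrow> bool" where
  "unitary D U \<longleftrightarrow> U \<in> carrier_mat D D \<and> mat_adjoint U * U = 1\<^sub>m D"

text \<open>
  \<open>final_state N m U x T\<close> is the state \<open>U\<^sub>T O\<^sub>x U\<^sub>T\<^sub>-\<^sub>1 O\<^sub>x \<cdots> O\<^sub>x U\<^sub>0 |0, 0, 0\<rangle>\<close> of an algorithm that makes
  \<open>T\<close> queries to \<open>x\<close>.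
\<close>

primrec final_state ::
    "nat \<Rightarrow> nat \<Rightarrow> (nat \<Rightarrow> complex mat) \<Rightarrow> (nat \<Rightarrow> bool) \<Rightarrow> nat \<Rightarrow> complex Matrix.vec" where
  "final_state N m U x 0 = U 0 *\<^sub>v unit_vec (2 * N * m) 0"
| "final_state N m U x (Suc T) = U (Suc T) *\<^sub>v (query_gate N m x *\<^sub>v final_state N m U x T)"

text \<open>
  Measuring the state \<open>\<psi>\<close> in the computational basis yields \<open>k\<close> with probability \<open>|\<psi>\<^sub>k|\<^sup>2\<close>; the
  algorithm then outputs \<open>out k\<close>, where \<^term>\<open>None\<close> stands for ``don't know''.
\<close>

definition output_prob :: "(nat \<Rightarrow> bool option) \<Rightarrow> complex Matrix.vec \<Rightarrow> bool option \<Rightarrow> real" where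
  "output_prob out \<psi> a = (\<Sum>k | k < dim_vec \<psi> \<and> out k = a. (cmod (\<psi> $ k))\<^sup>2)"

definition zero_error_quantum_computes :: "nat \<Rightarrow> ((nat \<Rightarrow> bool) \<Rightarrow> bool) \<Rightarrow> nat \<Rightarrow> bool" where
  "zero_error_quantum_computes N f T \<longleftrightarrow>
     (\<exists>m>0. \<exists>U out.
        (\<forall>t\<le>T. unitary (2 * N * m) (U t)) \<and>
        (\<forall>x\<in>inputs N.
           output_prob out (final_state N m U x T) (Some (\<not> f x)) = 0 \<and>
           output_prob out (final_state N m U x T) None \<le> 1 / 2))"

definition Q0 :: "nat \<Rightarrow> ((nat \<Rightarrow> bool) \<Rightarrow> bool) \<Rightarrow> nat" where
  "Q0 N f = (LEAST T. zero_error_quantum_computes N f T)"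

datatype (vars: 'v) decision_tree =
  Leaf bool
| Query 'v "'v decision_tree" "'v decision_tree"

primrec dt_eval :: "'v decision_tree \<Rightarrow> ('v \<Rightarrow> bool) \<Rightarrow> bool" where
  "dt_eval (Leaf b) x = b"
| "dt_eval (Query v s t) x = (if x v then dt_eval t x else dt_eval s x)"

primrec dt_queries :: "'v decision_tree \<Rightarrow> ('v \<Rightarrow> bool) \<Rightarrow> nat" where
  "dt_queries (Leaf b) x = 0"
| "dt_queries (Query v s t) x = Suc (if x v then dt_queries t x else dt_queries s x)"

text \<open>
  A randomized decision tree is a probability distribution over deterministic ones. Its worst-case
  number of queries is taken over all inputs and all trees in the support.
\<close>

definition bounded_error_randomized_computes ::
    "nat \<Rightarrow> ((nat \<Rightarrow> bool) \<Rightarrow> bool) \<Rightarrow> nat \<Rightarrow> bool" where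
  "bounded_error_randomized_computes N f T \<longleftrightarrow>
     (\<exists>p :: nat decision_tree pmf.
        (\<forall>t\<in>set_pmf p. vars t \<subseteq> {..<N} \<and> (\<forall>x\<in>inputs N. dt_queries t x \<le> T)) \<and>
        (\<forall>x\<in>inputs N. measure_pmf.prob p {t. dt_eval t x = f x} \<ge> 2 / 3))"

definition R2 :: "nat \<Rightarrow> ((nat \<Rightarrow> bool) \<Rightarrow> bool) \<Rightarrow> nat" where
  "R2 N f = (LEAST T. bounded_error_randomized_computes N f T)"

end

theory Submission
  imports Defs "HOL-Probability.Product_PMF"
begin

text \<open>
  Lower bound. Call \<open>(\<mu>, \<nu>)\<close> hidden with rate \<open>c\<close> if the advantage of every decision tree in telling \<open>\<mu>\<close>
  from \<open>\<nu>\<close> is at most \<open>c\<close> times its expected number of queries under \<open>\<mu>\<close>. If \<open>\<mu>\<close>, \<open>\<nu>\<close> are hard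
  distributions on the \<open>0\<close>- and \<open>1\<close>-inputs of the children, then \<open>n\<close> independent copies of \<open>\<mu>\<close>, against
  the same with one random copy replaced by \<open>\<nu>\<close>, are hard for the OR, with rate \<open>c / n\<close>: the
  advantage from block \<open>i\<close> is paid for by the queries to block \<open>i\<close>. Exchanging the roles of the two
  distributions, as the alternation with AND requires, costs a factor \<open>4\<close> per level.

  Upper bound. Amplitude amplification with a bounded-error subroutine finds a true child of an OR
  with about \<open>sqrt n\<close> runs of the subroutine and \<open>O(log n)\<close> repetitions, so trees of depth \<open>d\<close> are
  evaluated with \<open>n powr (d / 2)\<close> queries up to logarithms. A certificate for value \<open>1\<close> of an OR is found by
  searching for a true child and certifying only that child, for an AND by certifying all \<open>n\<close>
  children; unrolled, this costs \<open>n powr ((d + 1) / 2)\<close> up to logarithms for either output value of the tree, and the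
  remaining factor \<open>sqrt n\<close> in the claimed bound absorbs the logarithms. Zero error comes for
  free, as certificates end in exact queries of the leaves.

  All circuits are real: a step is a phase query between orthogonal maps. The number of search
  rounds is not known in advance; instead of randomizing it, the amplification from angle
  \<open>\<theta>\<close> to \<open>3 * \<theta>\<close> is iterated and the first success among all iterates is taken.
\<close>

unbundle no m_inv_syntax

section \<open>Randomized lower bound\<close>

definition acc :: "(nat \<Rightarrow> bool) pmf \<Rightarrow> nat decision_tree \<Rightarrow> real" where
  "acc \<mu> t = pmf (map_pmf (dt_eval t) \<mu>) True"

definition cost :: "(nat \<Rightarrow> bool) pmf \<Rightarrow> nat decision_tree \<Rightarrow> real" where
  "cost \<mu> t = measure_pmf.expectation \<mu> (\<lambda>x. real (dt_queries t x))"

text \<open>The cost is measured under the first distribution only. In \<open>hides_or\<close> this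
  lets the one distribution without a planted block pay for the comparison with every planted
  position.\<close>

definition hides :: "real \<Rightarrow> (nat \<Rightarrow> bool) pmf \<Rightarrow> (nat \<Rightarrow> bool) pmf \<Rightarrow> bool" where
  "hides c \<mu> \<nu> \<longleftrightarrow> (\<forall>t. \<bar>acc \<mu> t - acc \<nu> t\<bar> \<le> c * cost \<mu> t)"

lemma integrable_bounded_pmf:
  fixes f :: "'a \<Rightarrow> real"
  assumes "\<And>x. 0 \<le> f x" "\<And>x. f x \<le> B"
  shows "integrable (measure_pmf \<mu>) f"
  by (rule measure_pmf.integrable_const_bound[where B = B]) (use assms in auto)

lemma dt_queries_bounded: "\<exists>B. \<forall>x. real (dt_queries t x) \<le> B"
proof (induction t)
  case (Query v s t)
  then obtain B C where "\<And>x. real (dt_queries s x) \<le> B" "\<And>x. real (dt_queries t x) \<le> C" by blast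
  then show ?case by (intro exI[of _ "1 + max B C"]) (auto simp: le_max_iff_disj)
qed auto

lemma integrable_bounded_queries:
  fixes f :: "(nat \<Rightarrow> bool) \<Rightarrow> real"
  assumes "\<And>x. 0 \<le> f x" "\<And>x. f x \<le> real (dt_queries t x)"
  shows "integrable (measure_pmf \<mu>) f"
proof -
  obtain B where "\<And>x. real (dt_queries t x) \<le> B" using dt_queries_bounded[of t] by blast
  then show ?thesis using assms by (intro integrable_bounded_pmf[of f B]) (auto intro: order_trans)
qed

lemma cost_nonneg: "cost \<mu> t \<ge> 0"
  by (simp add: cost_def)

lemma acc_eq_prob: "acc \<mu> t = measure_pmf.prob \<mu> {x. dt_eval t x}"
  by (simp add: acc_def pmf_map vimage_def)

fun trunc :: "bool \<Rightarrow> nat \<Rightarrow> nat decision_tree \<Rightarrow> nat decision_tree" where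
  "trunc b k (Leaf a) = Leaf a"
| "trunc b 0 (Query v s t) = Leaf b"
| "trunc b (Suc k) (Query v s t) = Query v (trunc b k s) (trunc b k t)"

lemma dt_eval_trunc: "dt_eval (trunc b k t) x = (if dt_queries t x \<le> k then dt_eval t x else b)"
  by (induction b k t rule: trunc.induct) auto

lemma dt_queries_trunc: "dt_queries (trunc b k t) x = min k (dt_queries t x)"
  by (induction b k t rule: trunc.induct) auto

text \<open>All queries are kept but no leaf accepts. Cut off with answer \<open>True\<close>, such
  a tree accepts exactly when \<open>t\<close> makes more than \<open>k\<close> queries, so the
  hiding assumption applies to this event as well.\<close>

primrec silence :: "nat decision_tree \<Rightarrow> nat decision_tree" where
  "silence (Leaf a) = Leaf False"
| "silence (Query v s t) = Query v (silence s) (silence t)"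

lemma silence [simp]: "dt_eval (silence t) x = False" "dt_queries (silence t) x = dt_queries t x"
  by (induction t) auto

lemma hides_mono: "hides c \<mu> \<nu> \<Longrightarrow> c \<le> c' \<Longrightarrow> hides c' \<mu> \<nu>"
  unfolding hides_def by (auto intro: order_trans[OF _ mult_right_mono[OF _ cost_nonneg]])

text \<open>
  Cutting off after about \<open>1 / (2 * c)\<close> queries makes the expected number of queries under \<open>\<mu>\<close> and
  \<open>\<nu>\<close> comparable, since the event of exceeding \<open>k\<close> queries is itself decided by a tree.
\<close>

lemma hides_sym:
  assumes h: "hides c \<mu> \<nu>" and c: "c > 0"
  shows "hides (4 * c) \<nu> \<mu>"
  unfolding hides_def
proof
  fix t :: "nat decision_tree"
  \<comment> \<open>Both estimates below work for this value: \<open>c * K \<le> 1 / 2\<close> lets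
    an error of \<open>c\<close> per query be absorbed up to \<open>K\<close>, and
    \<open>K + 1\<close> is large enough for a tail bound with factor \<open>2 * c\<close>.\<close>
  define K where "K = nat \<lfloor>1 / (2 * c)\<rfloor>"
  have K: "c * real K \<le> 1 / 2" "1 \<le> 2 * c * (real K + 1)"
  proof -
    have "real K \<le> 1 / (2 * c)" "1 / (2 * c) \<le> real K + 1"
      using c by (auto simp: K_def intro: less_imp_le)
    then show "c * real K \<le> 1 / 2" "1 \<le> 2 * c * (real K + 1)"
      using c by (simp_all add: field_simps)
  qed
  define P where "P \<rho> k = measure_pmf.prob \<rho> {x. k < dt_queries t x}" for \<rho> k
  define F where "F \<rho> k = measure_pmf.expectation \<rho> (\<lambda>x. real (min k (dt_queries t x)))" for \<rho> k
  have F_trunc: "cost \<rho> (trunc b k t) = F \<rho> k" "cost \<rho> (trunc b k (silence t)) = F \<rho> k" for \<rho> b k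
    by (simp_all add: cost_def F_def dt_queries_trunc)
  have F_mono: "F \<rho> k \<le> F \<rho> k'" if "k \<le> k'" for \<rho> k k'
    unfolding F_def using that
    by (intro integral_mono integrable_bounded_queries[of _ t]) auto
  have F_le: "F \<rho> k \<le> cost \<rho> t" for \<rho> k
    unfolding F_def cost_def by (intro integral_mono integrable_bounded_queries[of _ t]) auto
  have F_Suc: "F \<rho> (Suc k) = F \<rho> k + P \<rho> k" for \<rho> k
  proof -
    have "F \<rho> (Suc k) = measure_pmf.expectation \<rho> (\<lambda>x. real (min k (dt_queries t x)) + indicator {x. k < dt_queries t x} x)"
      unfolding F_def by (rule arg_cong[of _ _ "measure_pmf.expectation \<rho>"]) (auto simp: fun_eq_iff indicator_def)
    also have "\<dots> = F \<rho> k + P \<rho> k"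
      unfolding F_def P_def
      by (subst Bochner_Integration.integral_add[OF integrable_bounded_queries[of _ t] integrable_bounded_pmf[of _ 1]])
        (auto simp: indicator_def)
    finally show ?thesis .
  qed
  have F_sum: "F \<rho> k = (\<Sum>j<k. P \<rho> j)" for \<rho> k
    by (induction k) (simp_all add: F_Suc, simp add: F_def)
  have PF: "P \<mu> k \<le> P \<nu> k + c * F \<mu> k" for k
  proof -
    have "acc \<rho> (trunc True k (silence t)) = P \<rho> k" for \<rho>
      by (simp add: acc_eq_prob P_def dt_eval_trunc not_le)
    then show ?thesis
      using h[unfolded hides_def, rule_format, of "trunc True k (silence t)"] by (simp add: F_trunc abs_le_iff)
  qed
  \<comment> \<open>The truncated expectation is a sum of \<open>K\<close> tail probabilities. Each
    is larger under \<open>\<mu>\<close> than under \<open>\<nu>\<close> by at most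
    \<open>c * F \<mu> K\<close>; the total error is at most half of \<open>F \<mu> K\<close> and
    moves to the left side.\<close>
  have F2: "F \<mu> K \<le> 2 * cost \<nu> t"
  proof -
    have "F \<mu> K \<le> (\<Sum>j<K. P \<nu> j + c * F \<mu> K)"
      unfolding F_sum[of \<mu> K]
    proof (rule sum_mono)
      fix j assume "j \<in> {..<K}"
      then have "c * F \<mu> j \<le> c * F \<mu> K" using F_mono[of j K \<mu>] c by simp
      then show "P \<mu> j \<le> P \<nu> j + c * sum (P \<mu>) {..<K}" using PF[of j] by (simp add: F_sum)
    qed
    also have "\<dots> = F \<nu> K + (c * real K) * F \<mu> K" by (simp add: sum.distrib F_sum)
    also have "\<dots> \<le> cost \<nu> t + 1 / 2 * F \<mu> K"
    proof -
      have "0 \<le> F \<mu> K" by (simp add: F_def)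
      then show ?thesis using mult_right_mono[OF K(1)] F_le[of \<nu> K] by (simp add: add_mono)
    qed
    finally show ?thesis by simp
  qed
  \<comment> \<open>Markov's inequality at \<open>K + 1\<close> queries.\<close>
  have PK: "P \<nu> K \<le> 2 * c * cost \<nu> t"
  proof -
    have "(real K + 1) * P \<nu> K = measure_pmf.expectation \<nu> (\<lambda>x. (real K + 1) * indicator {x. K < dt_queries t x} x)"
      by (simp add: P_def)
    also have "\<dots> \<le> cost \<nu> t"
      unfolding cost_def
      by (intro integral_mono integrable_bounded_queries[of _ t]) (auto simp: indicator_def)
    finally have *: "(real K + 1) * P \<nu> K \<le> cost \<nu> t" .
    have "P \<nu> K \<le> (2 * c * (real K + 1)) * P \<nu> K"
      using mult_right_mono[OF K(2), of "P \<nu> K"] by (simp add: P_def)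
    also have "\<dots> = 2 * c * ((real K + 1) * P \<nu> K)" by (simp add: algebra_simps)
    also have "\<dots> \<le> 2 * c * cost \<nu> t" using * c by (intro mult_left_mono) auto
    finally show ?thesis .
  qed
  have hb: "\<bar>acc \<mu> (trunc b K t) - acc \<nu> (trunc b K t)\<bar> \<le> 2 * c * cost \<nu> t" for b
  proof -
    have "c * F \<mu> K \<le> 2 * c * cost \<nu> t"
      using mult_left_mono[OF F2, of c] c by (simp add: mult.assoc mult.left_commute)
    then show ?thesis
      using h[unfolded hides_def, rule_format, of "trunc b K t"] by (simp add: F_trunc)
  qed
  \<comment> \<open>Cutting with \<open>True\<close> can only raise acceptance, cutting with
    \<open>False\<close> can only lower it. Using the former to bound \<open>acc \<mu> t\<close>
    from above and the latter from below, only the cut probability under \<open>\<nu>\<close>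
    enters. The truncated tree and the cut each contribute \<open>2 * c\<close>.\<close>
  have up: "acc \<rho> t \<le> acc \<rho> (trunc True K t)" "acc \<rho> (trunc True K t) \<le> acc \<rho> t + P \<rho> K" for \<rho>
  proof -
    show "acc \<rho> t \<le> acc \<rho> (trunc True K t)"
      unfolding acc_eq_prob by (rule measure_pmf.finite_measure_mono) (auto simp: dt_eval_trunc)
    have "acc \<rho> (trunc True K t) \<le> measure_pmf.prob \<rho> ({x. dt_eval t x} \<union> {x. K < dt_queries t x})"
      unfolding acc_eq_prob by (rule measure_pmf.finite_measure_mono) (auto simp: dt_eval_trunc)
    also have "\<dots> \<le> acc \<rho> t + P \<rho> K"
      unfolding acc_eq_prob P_def by (rule measure_Un_le) auto
    finally show "acc \<rho> (trunc True K t) \<le> acc \<rho> t + P \<rho> K" .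
  qed
  have down: "acc \<rho> (trunc False K t) \<le> acc \<rho> t" "acc \<rho> t \<le> acc \<rho> (trunc False K t) + P \<rho> K" for \<rho>
  proof -
    show "acc \<rho> (trunc False K t) \<le> acc \<rho> t"
      unfolding acc_eq_prob by (rule measure_pmf.finite_measure_mono) (auto simp: dt_eval_trunc split: if_splits)
    have "acc \<rho> t \<le> measure_pmf.prob \<rho> ({x. dt_eval (trunc False K t) x} \<union> {x. K < dt_queries t x})"
      unfolding acc_eq_prob by (rule measure_pmf.finite_measure_mono) (auto simp: dt_eval_trunc)
    also have "\<dots> \<le> acc \<rho> (trunc False K t) + P \<rho> K"
      unfolding acc_eq_prob P_def by (rule measure_Un_le) auto
    finally show "acc \<rho> t \<le> acc \<rho> (trunc False K t) + P \<rho> K" .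
  qed
  show "\<bar>acc \<nu> t - acc \<mu> t\<bar> \<le> 4 * c * cost \<nu> t"
    using up[of \<mu>] up[of \<nu>] down[of \<mu>] down[of \<nu>] hb[of True] hb[of False] PK
    unfolding abs_le_iff by linarith
qed

primrec negate_queries :: "nat decision_tree \<Rightarrow> nat decision_tree" where
  "negate_queries (Leaf b) = Leaf b"
| "negate_queries (Query v s t) = Query v (negate_queries t) (negate_queries s)"

lemma negate_queries [simp]:
  "dt_eval (negate_queries t) x = dt_eval t (\<lambda>v. \<not> x v)"
  "dt_queries (negate_queries t) x = dt_queries t (\<lambda>v. \<not> x v)"
  by (induction t) auto

lemma hides_negate:
  assumes "hides c \<mu> \<nu>"
  shows "hides c (map_pmf (\<lambda>x v. \<not> x v) \<mu>) (map_pmf (\<lambda>x v. \<not> x v) \<nu>)"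
proof -
  have "dt_eval (negate_queries t) = (\<lambda>x. dt_eval t (\<lambda>v. \<not> x v))" for t
    by (simp add: fun_eq_iff)
  then have "acc (map_pmf (\<lambda>x v. \<not> x v) \<rho>) t = acc \<rho> (negate_queries t)" for \<rho> t
    by (simp add: acc_def pmf.map_comp o_def)
  moreover have "cost (map_pmf (\<lambda>x v. \<not> x v) \<rho>) t = cost \<rho> (negate_queries t)" for \<rho> t
    by (simp add: cost_def)
  ultimately show ?thesis using assms by (simp add: hides_def)
qed

section \<open>Inputs composed of independent blocks\<close>

definition join_blocks :: "nat \<Rightarrow> (nat \<Rightarrow> nat \<Rightarrow> bool) \<Rightarrow> nat \<Rightarrow> bool" where
  "join_blocks M y v = y (v div M) (v mod M)"

text \<open>Turns a tree for the whole input into a tree for block \<open>i\<close> alone, the other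
  blocks being hard-wired from \<open>y\<close>. In this way an advantage on the whole input becomes
  one on a single block.\<close>

primrec block_tree :: "nat \<Rightarrow> nat \<Rightarrow> (nat \<Rightarrow> nat \<Rightarrow> bool) \<Rightarrow> nat decision_tree \<Rightarrow> nat decision_tree" where
  "block_tree M i y (Leaf b) = Leaf b"
| "block_tree M i y (Query v s t) =
     (if v div M = i then Query (v mod M) (block_tree M i y s) (block_tree M i y t)
      else if join_blocks M y v then block_tree M i y t else block_tree M i y s)"

primrec block_queries :: "nat \<Rightarrow> nat \<Rightarrow> nat decision_tree \<Rightarrow> (nat \<Rightarrow> bool) \<Rightarrow> nat" where
  "block_queries M i (Leaf b) x = 0"
| "block_queries M i (Query v s t) x =
     of_bool (v div M = i) + (if x v then block_queries M i t x else block_queries M i s x)"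

lemma block_tree:
  "dt_eval (block_tree M i y t) z = dt_eval t (join_blocks M (y(i := z)))"
  "dt_queries (block_tree M i y t) z = block_queries M i t (join_blocks M (y(i := z)))"
  by (induction t) (auto simp: join_blocks_def)

lemma block_queries_le: "block_queries M i t x \<le> dt_queries t x"
  by (induction t) auto

text \<open>A query belongs to at most one block; queries beyond the first \<open>n\<close> blocks
  are not counted on the left.\<close>

lemma sum_block_queries: "(\<Sum>i<n. block_queries M i t x) \<le> dt_queries t x"
proof (induction t)
  case (Query v s t)
  have "(\<Sum>i<n. of_bool (v div M = i)) \<le> (1::nat)"
    by (simp add: of_bool_def)
  then show ?case using Query by (auto simp: sum.distrib)
qed simp

text \<open>The tower rule, obtained from nonnegative integrals; the bound \<open>B\<close> gives
  integrability of both the inner and the outer function.\<close>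

lemma expectation_bounded_bind_pmf:
  fixes h :: "'c \<Rightarrow> real"
  assumes h: "\<And>x. 0 \<le> h x" "\<And>x. h x \<le> B"
  shows "measure_pmf.expectation (bind_pmf p f) h = measure_pmf.expectation p (\<lambda>y. measure_pmf.expectation (f y) h)"
proof -
  have B: "B \<ge> 0" using h order_trans by blast
  have inner: "measure_pmf.expectation (f y) h \<le> B" "0 \<le> measure_pmf.expectation (f y) h" for y
  proof -
    show "measure_pmf.expectation (f y) h \<le> B"
      using integral_mono[of "measure_pmf (f y)" h "\<lambda>_. B"] integrable_bounded_pmf[of h B "f y", OF h] h by simp
  qed (simp add: h)
  have "ennreal (measure_pmf.expectation (bind_pmf p f) h) = (\<integral>\<^sup>+y. \<integral>\<^sup>+x. ennreal (h x) \<partial>f y \<partial>p)"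
    using nn_integral_eq_integral[OF integrable_bounded_pmf[of h B "bind_pmf p f", OF h]] h by simp
  also have "\<dots> = (\<integral>\<^sup>+y. ennreal (measure_pmf.expectation (f y) h) \<partial>p)"
    using nn_integral_eq_integral[OF integrable_bounded_pmf[of h B, OF h]] h by simp
  also have "\<dots> = ennreal (measure_pmf.expectation p (\<lambda>y. measure_pmf.expectation (f y) h))"
    by (rule nn_integral_eq_integral[OF integrable_bounded_pmf[of _ B]]) (use inner in auto)
  finally show ?thesis using h inner by (subst (asm) ennreal_inj) (auto intro!: Bochner_Integration.integral_nonneg)
qed


definition planted ::
    "nat \<Rightarrow> nat \<Rightarrow> nat \<Rightarrow> (nat \<Rightarrow> bool) pmf \<Rightarrow> (nat \<Rightarrow> bool) pmf \<Rightarrow> (nat \<Rightarrow> bool) pmf" where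
  "planted M n i \<rho> \<mu> = map_pmf (join_blocks M) (Pi_pmf {..<n} (\<lambda>_. False) (\<lambda>j. if j = i then \<rho> else \<mu>))"

text \<open>Draws block \<open>i\<close> separately from the others. Given the remaining blocks
  \<open>y\<close>, the input depends on one sample of \<open>\<rho>\<close>, which is the situation
  of \<open>block_tree\<close>.\<close>

lemma planted_eq_bind:
  assumes "i < n"
  shows "planted M n i \<rho> \<mu> = bind_pmf (Pi_pmf ({..<n} - {i}) (\<lambda>_. False) (\<lambda>_. \<mu>))
    (\<lambda>y. map_pmf (\<lambda>z. join_blocks M (y(i := z))) \<rho>)"
proof -
  have "Pi_pmf {..<n} (\<lambda>_. False) (\<lambda>j. if j = i then \<rho> else \<mu>)
      = Pi_pmf (insert i ({..<n} - {i})) (\<lambda>_. False) (\<lambda>j. if j = i then \<rho> else \<mu>)"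
    using assms by (simp add: insert_absorb)
  also have "\<dots> = bind_pmf \<rho> (\<lambda>z. bind_pmf (Pi_pmf ({..<n} - {i}) (\<lambda>_. False) (\<lambda>j. if j = i then \<rho> else \<mu>))
      (\<lambda>y. return_pmf (y(i := z))))"
    by (subst Pi_pmf_insert') auto
  also have "Pi_pmf ({..<n} - {i}) (\<lambda>_. False) (\<lambda>j. if j = i then \<rho> else \<mu>)
      = Pi_pmf ({..<n} - {i}) (\<lambda>_. False) (\<lambda>_. \<mu>)"
    by (rule Pi_pmf_cong) auto
  finally show ?thesis
    unfolding planted_def
    by (simp add: bind_commute_pmf[of \<rho>] map_pmf_def bind_assoc_pmf bind_return_pmf fun_upd_def)
qed

lemma acc_planted:
  assumes "i < n"
  shows "acc (planted M n i \<rho> \<mu>) t =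
    measure_pmf.expectation (Pi_pmf ({..<n} - {i}) (\<lambda>_. False) (\<lambda>_. \<mu>)) (\<lambda>y. acc \<rho> (block_tree M i y t))"
proof -
  have "dt_eval (block_tree M i y t) = (\<lambda>z. dt_eval t (join_blocks M (y(i := z))))" for y
    by (simp add: fun_eq_iff block_tree)
  then show ?thesis
    unfolding acc_def planted_eq_bind[OF assms] by (simp add: map_bind_pmf pmf.map_comp o_def pmf_bind)
qed

lemma block_cost_planted:
  assumes "i < n"
  shows "measure_pmf.expectation (planted M n i \<rho> \<mu>) (\<lambda>x. real (block_queries M i t x)) =
    measure_pmf.expectation (Pi_pmf ({..<n} - {i}) (\<lambda>_. False) (\<lambda>_. \<mu>)) (\<lambda>y. cost \<rho> (block_tree M i y t))"
proof -
  obtain B where "\<And>x. real (dt_queries t x) \<le> B" using dt_queries_bounded[of t] by blast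
  then have "real (block_queries M i t x) \<le> B" for x
    using block_queries_le[of M i t x] order_trans[of "real (block_queries M i t x)" "real (dt_queries t x)" B] by simp
  then show ?thesis
    unfolding planted_eq_bind[OF assms] cost_def
    by (subst expectation_bounded_bind_pmf[of _ B]) (simp_all add: block_tree)
qed

lemma acc_le_1: "0 \<le> acc \<mu> t" "acc \<mu> t \<le> 1"
  by (simp_all add: acc_def pmf_le_1)

text \<open>Given the blocks other than \<open>i\<close>, the tree distinguishes
  \<open>\<mu>\<close> from \<open>\<nu>\<close> on block \<open>i\<close>, with an advantage of at
  most \<open>c\<close> times its expected queries to that block. These expectations all refer to
  the same distribution, so summed over \<open>i\<close> they are at most the total cost, and the
  random position divides by \<open>n\<close>.\<close>

lemma hides_or:
  assumes h: "hides c \<mu> \<nu>" and c: "c \<ge> 0" and n: "n > 0"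
  shows "hides (c / real n) (map_pmf (join_blocks M) (Pi_pmf {..<n} (\<lambda>_. False) (\<lambda>_. \<mu>)))
    (bind_pmf (pmf_of_set {..<n}) (\<lambda>i. planted M n i \<nu> \<mu>))" (is "hides _ ?all ?one")
  unfolding hides_def
proof
  fix t :: "nat decision_tree"
  have all: "planted M n i \<mu> \<mu> = ?all" for i
    by (simp add: planted_def)
  have diff: "\<bar>acc ?all t - acc (planted M n i \<nu> \<mu>) t\<bar>
      \<le> c * measure_pmf.expectation ?all (\<lambda>x. real (block_queries M i t x))" if "i < n" for i
  proof -
    let ?R = "Pi_pmf ({..<n} - {i}) (\<lambda>_. False) (\<lambda>_. \<mu>)"
    obtain B where B: "\<And>x. real (dt_queries t x) \<le> B" using dt_queries_bounded[of t] by blast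
    have "cost \<mu> (block_tree M i y t) \<le> B" for y
    proof -
      have "real (dt_queries (block_tree M i y t) x) \<le> B" for x
        using block_queries_le[of M i t "join_blocks M (y(i := x))"] B[of "join_blocks M (y(i := x))"]
        by (simp add: block_tree)
      then show ?thesis
        unfolding cost_def by (intro measure_pmf.integral_le_const integrable_bounded_queries) auto
    qed
    then have int_cost: "integrable ?R (\<lambda>y. c * cost \<mu> (block_tree M i y t))"
      by (intro integrable_mult_right integrable_bounded_pmf[of _ B]) (auto simp: cost_nonneg)
    have int_acc: "integrable ?R (\<lambda>y. acc \<rho> (block_tree M i y t))" for \<rho>
      by (intro integrable_bounded_pmf[of _ 1]) (auto simp: acc_le_1)
    have "\<bar>acc ?all t - acc (planted M n i \<nu> \<mu>) t\<bar>
      = \<bar>measure_pmf.expectation ?R (\<lambda>y. acc \<mu> (block_tree M i y t) - acc \<nu> (block_tree M i y t))\<bar>"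
      unfolding all[of i, symmetric] acc_planted[OF that]
      by (simp add: Bochner_Integration.integral_diff[OF int_acc int_acc])
    also have "\<dots> \<le> measure_pmf.expectation ?R (\<lambda>y. \<bar>acc \<mu> (block_tree M i y t) - acc \<nu> (block_tree M i y t)\<bar>)"
      by (rule integral_abs_bound)
    also have "\<dots> \<le> measure_pmf.expectation ?R (\<lambda>y. c * cost \<mu> (block_tree M i y t))"
      by (intro integral_mono integrable_abs Bochner_Integration.integrable_diff int_acc int_cost)
        (use h in \<open>simp add: hides_def\<close>)
    also have "\<dots> = c * measure_pmf.expectation ?all (\<lambda>x. real (block_queries M i t x))"
      unfolding all[of i, symmetric] block_cost_planted[OF that] by simp
    finally show ?thesis .
  qed
  have one: "acc ?one t = (\<Sum>i<n. acc (planted M n i \<nu> \<mu>) t) / real n"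
    using n unfolding acc_def by (simp add: map_bind_pmf pmf_bind integral_pmf_of_set lessThan_empty_iff)
  have "\<bar>acc ?all t - acc ?one t\<bar> = \<bar>\<Sum>i<n. acc ?all t - acc (planted M n i \<nu> \<mu>) t\<bar> / real n"
    using n by (simp add: one sum_subtractf field_simps abs_divide)
  also have "\<dots> \<le> (\<Sum>i<n. c * measure_pmf.expectation ?all (\<lambda>x. real (block_queries M i t x))) / real n"
    by (intro divide_right_mono order_trans[OF sum_abs] sum_mono) (rule diff, simp_all)
  also have "\<dots> = c / real n * (\<Sum>i<n. measure_pmf.expectation ?all (\<lambda>x. real (block_queries M i t x)))"
    by (simp only: sum_distrib_left[symmetric] times_divide_eq_left)
  also have "\<dots> = c / real n * measure_pmf.expectation ?all (\<lambda>x. \<Sum>i<n. real (block_queries M i t x))"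
    by (subst Bochner_Integration.integral_sum)
      (rule integrable_bounded_queries[of _ t], simp_all only: of_nat_0_le_iff of_nat_le_iff block_queries_le)
  also have "\<dots> \<le> c / real n * cost ?all t"
  proof -
    have "(\<Sum>i<n. real (block_queries M i t x)) \<le> real (dt_queries t x)" for x
      using sum_block_queries[of M t x n] by (simp flip: of_nat_sum)
    then have "measure_pmf.expectation ?all (\<lambda>x. \<Sum>i<n. real (block_queries M i t x)) \<le> cost ?all t"
      unfolding cost_def by (intro integral_mono integrable_bounded_queries[of _ t]) (auto intro: sum_nonneg)
    then show ?thesis using c by (intro mult_left_mono) auto
  qed
  finally show "\<bar>acc ?all t - acc ?one t\<bar> \<le> c / real n * cost ?all t" .
qed

lemma and_tree_negate: "and_tree d n (\<lambda>j. \<not> x j) \<longleftrightarrow> \<not> or_tree d n x"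
  and or_tree_negate: "or_tree d n (\<lambda>j. \<not> x j) \<longleftrightarrow> \<not> and_tree d n x"
  by (induction d arbitrary: x) auto

lemma or_tree_cong: "(\<And>j. j < n ^ d \<Longrightarrow> x j = y j) \<Longrightarrow> or_tree d n x = or_tree d n y"
  and and_tree_cong: "(\<And>j. j < n ^ d \<Longrightarrow> x j = y j) \<Longrightarrow> and_tree d n x = and_tree d n y"
proof (induction d arbitrary: x y)
  case (Suc d)
  have lt: "i * n ^ d + j < n ^ Suc d" if "i < n" "j < n ^ d" for i j
    using mult_le_mono1[of "Suc i" n "n ^ d"] that by simp
  {
    case 1
    have "and_tree d n (\<lambda>j. x (i * n ^ d + j)) = and_tree d n (\<lambda>j. y (i * n ^ d + j))" if "i < n" for i
      by (rule Suc.IH(2)) (rule 1[OF lt[OF that]])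
    then show ?case by auto
  next
    case 2
    have "or_tree d n (\<lambda>j. x (i * n ^ d + j)) = or_tree d n (\<lambda>j. y (i * n ^ d + j))" if "i < n" for i
      by (rule Suc.IH(1)) (rule 2[OF lt[OF that]])
    then show ?case by auto
  }
qed auto

lemma join_blocks_apply: "j < M \<Longrightarrow> join_blocks M y (i * M + j) = y i j"
  by (simp add: join_blocks_def)

text \<open>Negating the leaves turns an OR tree into the complement of an AND tree and thereby
  exchanges the roles of the two distributions. The induction therefore carries hiding in both
  directions; \<open>hides_or\<close> yields one of them, and \<open>hides_sym\<close> the other at
  the price of a factor \<open>4\<close>.\<close>

lemma hard_distributions:
  assumes n: "n > 0"
  shows "\<exists>\<mu> \<nu>. (\<forall>x\<in>set_pmf \<mu>. \<not> or_tree d n x) \<and> (\<forall>x\<in>set_pmf \<nu>. or_tree d n x) \<and>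
    hides (4 ^ d / real (n ^ d)) \<mu> \<nu> \<and> hides (4 ^ d / real (n ^ d)) \<nu> \<mu>"
proof (induction d)
  case 0
  \<comment> \<open>A tree without queries has advantage \<open>0\<close>; any other tree has cost
    at least \<open>1\<close>, which exceeds no advantage's upper bound \<open>1\<close>.\<close>
  have "hides 1 (return_pmf x) (return_pmf y)" for x y
    unfolding hides_def
  proof
    fix t :: "nat decision_tree"
    show "\<bar>acc (return_pmf x) t - acc (return_pmf y) t\<bar> \<le> 1 * cost (return_pmf x) t"
      using acc_le_1[of "return_pmf x" t] acc_le_1[of "return_pmf y" t]
      by (cases t) (simp add: acc_def cost_def, simp add: cost_def abs_le_iff)
  qed
  then show ?case
    by (intro exI[of _ "return_pmf (\<lambda>_. False)"] exI[of _ "return_pmf (\<lambda>_. True)"]) simp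
next
  case (Suc d)
  then obtain \<mu>' \<nu>' where IH: "\<forall>x\<in>set_pmf \<mu>'. \<not> or_tree d n x" "\<forall>x\<in>set_pmf \<nu>'. or_tree d n x"
    "hides (4 ^ d / real (n ^ d)) \<nu>' \<mu>'" by blast
  define \<mu> where "\<mu> = map_pmf (\<lambda>x v. \<not> x v) \<nu>'"
  define \<nu> where "\<nu> = map_pmf (\<lambda>x v. \<not> x v) \<mu>'"
  have \<mu>: "\<not> and_tree d n x" if "x \<in> set_pmf \<mu>" for x
    using that IH by (auto simp: \<mu>_def and_tree_negate)
  have \<nu>: "and_tree d n x" if "x \<in> set_pmf \<nu>" for x
    using that IH by (auto simp: \<nu>_def and_tree_negate)
  let ?c = "4 ^ d / real (n ^ d) / real n"
  let ?all = "map_pmf (join_blocks (n ^ d)) (Pi_pmf {..<n} (\<lambda>_. False) (\<lambda>_. \<mu>))"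
  let ?one = "bind_pmf (pmf_of_set {..<n}) (\<lambda>i. planted (n ^ d) n i \<nu> \<mu>)"
  have h: "hides ?c ?all ?one"
    by (rule hides_or[OF _ _ n]) (use hides_negate[OF IH(3)] in \<open>auto simp: \<mu>_def \<nu>_def\<close>)
  have h': "hides (4 * ?c) ?one ?all"
    by (rule hides_sym[OF h]) (use n in simp)
  have eq: "4 * ?c = 4 ^ Suc d / real (n ^ Suc d)"
    by (simp add: field_simps)
  have tree: "or_tree (Suc d) n (join_blocks (n ^ d) y) \<longleftrightarrow> (\<exists>i<n. and_tree d n (y i))" for y
    using and_tree_cong[of n d "\<lambda>j. join_blocks (n ^ d) y (i * n ^ d + j)" "y i" for i] by (simp add: join_blocks_apply)
  have "\<not> or_tree (Suc d) n x" if "x \<in> set_pmf ?all" for x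
    using that \<mu> by (fastforce simp: tree set_Pi_pmf PiE_dflt_def simp del: or_tree.simps)
  moreover have "or_tree (Suc d) n x" if "x \<in> set_pmf ?one" for x
  proof -
    from that n obtain i y where i: "i < n" and x: "x = join_blocks (n ^ d) y"
      and y: "y \<in> set_pmf (Pi_pmf {..<n} (\<lambda>_. False) (\<lambda>j. if j = i then \<nu> else \<mu>))"
      by (auto simp: planted_def set_pmf_of_set lessThan_empty_iff)
    have "y i \<in> set_pmf \<nu>"
      using y i by (auto simp: set_Pi_pmf PiE_dflt_def)
    then show ?thesis using i \<nu> by (auto simp: x tree simp del: or_tree.simps)
  qed
  moreover have "hides (4 * ?c) ?all ?one"
  proof (rule hides_mono[OF h])
    have "z \<le> 4 * z" if "0 \<le> z" for z :: real using that by linarith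
    from this[of ?c] show "?c \<le> 4 * ?c" by simp
  qed
  ultimately show ?case using h' unfolding eq by blast
qed

section \<open>From hard distributions to randomized query complexity\<close>

primrec query_all :: "((nat \<Rightarrow> bool) \<Rightarrow> bool) \<Rightarrow> nat \<Rightarrow> (nat \<Rightarrow> bool) \<Rightarrow> nat decision_tree" where
  "query_all f 0 y = Leaf (f y)"
| "query_all f (Suc k) y = Query k (query_all f k (y(k := False))) (query_all f k (y(k := True)))"

lemma query_all:
  "dt_eval (query_all f k y) x = f (\<lambda>j. if j < k then x j else y j)"
  "dt_queries (query_all f k y) x = k"
  "vars (query_all f k y) \<subseteq> {..<k}"
proof (induction k arbitrary: y)
  case (Suc k)
  have upd: "(\<lambda>j. if j < k then x j else (y(k := x k)) j) = (\<lambda>j. if j < Suc k then x j else y j)" for y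
    by (auto simp: less_Suc_eq)
  {
    case 1
    have "dt_eval (query_all f (Suc k) y) x = dt_eval (query_all f k (y(k := x k))) x"
      by (cases "x k") auto
    then show ?case by (simp only: Suc.IH(1) upd)
  next
    case 2
    show ?case by (simp add: Suc.IH(2))
  next
    case 3
    show ?case by (simp add: order_trans[OF Suc.IH(3)])
  }
qed simp_all

text \<open>Shows that the \<open>LEAST\<close> in \<open>R2\<close> ranges over a nonempty set, so
  that its value is attained by some randomized tree.\<close>

lemma bounded_error_randomized_computes_query_all: "bounded_error_randomized_computes N f N"
proof -
  have "dt_eval (query_all f N (\<lambda>_. undefined)) x = f x" if "x \<in> inputs N" for x
  proof -
    have "(\<lambda>j. if j < N then x j else undefined) = x" using that by (auto simp: PiE_def extensional_def)
    then show ?thesis by (simp add: query_all(1))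
  qed
  moreover have "vars (query_all f N (\<lambda>_. undefined)) \<subseteq> {..<N}"
    by (rule query_all(3))
  ultimately show ?thesis
    unfolding bounded_error_randomized_computes_def
    by (intro exI[of _ "return_pmf (query_all f N (\<lambda>_. undefined))"]) (simp add: query_all(2))
qed

lemma dt_cong:
  assumes "vars t \<subseteq> A" "\<And>v. v \<in> A \<Longrightarrow> x v = y v"
  shows "dt_eval t x = dt_eval t y" "dt_queries t x = dt_queries t y"
proof -
  have "dt_eval t x = dt_eval t y \<and> dt_queries t x = dt_queries t y"
    using assms(1)
  proof (induction t)
    case (Query v s t)
    then have "x v = y v" using assms(2) by simp
    then show ?case using Query by simp
  qed simp
  then show "dt_eval t x = dt_eval t y" "dt_queries t x = dt_queries t y" by simp_all
qed

text \<open>Yao's argument. Exchanging the averages over trees and inputs, a correct random tree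
  accepts with mean probability at least \<open>2 / 3\<close> under \<open>\<nu>\<close> and at most
  \<open>1 / 3\<close> under \<open>\<mu>\<close>; but the advantage of each tree in its support is
  at most \<open>c * T\<close>.\<close>

lemma R2_or_tree_ge:
  assumes n: "n > 0"
  shows "real (n ^ d) \<le> 3 * 4 ^ d * real (R2 (n ^ d) (or_tree d n))"
proof -
  let ?N = "n ^ d" and ?c = "4 ^ d / real (n ^ d)" and ?f = "or_tree d n"
  define T where "T = R2 ?N ?f"
  have "bounded_error_randomized_computes ?N ?f T"
    unfolding T_def R2_def by (rule LeastI[OF bounded_error_randomized_computes_query_all])
  then obtain p where p: "\<And>t. t \<in> set_pmf p \<Longrightarrow> vars t \<subseteq> {..<?N}"
      "\<And>t x. t \<in> set_pmf p \<Longrightarrow> x \<in> inputs ?N \<Longrightarrow> dt_queries t x \<le> T"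
      "\<And>x. x \<in> inputs ?N \<Longrightarrow> measure_pmf.prob p {t. dt_eval t x = ?f x} \<ge> 2 / 3"
    unfolding bounded_error_randomized_computes_def by blast
  \<comment> \<open>The hard distributions live on total functions, whereas \<open>inputs\<close>
    contains extensional ones. Restriction changes neither the tree value nor the run of a decision
    tree with variables below \<open>n ^ d\<close>.\<close>
  have restr: "restrict x {..<?N} \<in> inputs ?N" "?f (restrict x {..<?N}) = ?f x" for x
    by (simp, rule or_tree_cong, simp)
  have dt: "dt_eval t (restrict x {..<?N}) = dt_eval t x" "dt_queries t x \<le> T" if "t \<in> set_pmf p" for t x
    using dt_cong[OF p(1)[OF that], of "restrict x {..<?N}" x] p(2)[OF that restr(1), of x] by auto
  have correct: "measure_pmf.prob p {t. dt_eval t x = ?f x} \<ge> 2 / 3" for x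
  proof -
    have "measure_pmf.prob p {t. dt_eval t (restrict x {..<?N}) = ?f (restrict x {..<?N})}
        = measure_pmf.prob p {t. dt_eval t x = ?f x}"
      unfolding restr(2) by (rule measure_pmf.finite_measure_eq_AE) (auto simp: AE_measure_pmf_iff dt(1))
    then show ?thesis using p(3)[OF restr(1)] by metis
  qed
  obtain \<mu> \<nu> where hard: "\<And>x. x \<in> set_pmf \<mu> \<Longrightarrow> \<not> ?f x" "\<And>x. x \<in> set_pmf \<nu> \<Longrightarrow> ?f x" "hides ?c \<mu> \<nu>"
    using hard_distributions[OF n, of d] by blast
  define E where "E \<rho> = measure_pmf.expectation p (\<lambda>t. acc \<rho> t)" for \<rho>
  have E: "E \<rho> = measure_pmf.expectation \<rho> (\<lambda>x. measure_pmf.prob p {t. dt_eval t x})" for \<rho>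
  proof -
    have "E \<rho> = pmf (bind_pmf p (\<lambda>t. bind_pmf \<rho> (\<lambda>x. return_pmf (dt_eval t x)))) True"
      by (simp add: E_def acc_def pmf_bind map_pmf_def)
    also have "\<dots> = pmf (bind_pmf \<rho> (\<lambda>x. map_pmf (\<lambda>t. dt_eval t x) p)) True"
      by (subst bind_commute_pmf) (simp add: map_pmf_def)
    finally show ?thesis by (simp add: pmf_bind pmf_map vimage_def)
  qed
  have "2 / 3 \<le> E \<nu>"
    unfolding E
  proof (rule measure_pmf.integral_ge_const)
    show "AE x in \<nu>. 2 / 3 \<le> measure_pmf.prob p {t. dt_eval t x}"
    proof (rule AE_pmfI)
      fix x assume "x \<in> set_pmf \<nu>"
      then show "2 / 3 \<le> measure_pmf.prob p {t. dt_eval t x}"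
        using correct[of x] hard(2)[of x] by simp
    qed
  qed (auto intro!: integrable_bounded_pmf[of _ 1])
  moreover have "E \<mu> \<le> 1 / 3"
    unfolding E
  proof (rule measure_pmf.integral_le_const)
    show "AE x in \<mu>. measure_pmf.prob p {t. dt_eval t x} \<le> 1 / 3"
    proof (rule AE_pmfI)
      fix x assume "x \<in> set_pmf \<mu>"
      then have "{t. dt_eval t x = ?f x} = - {t. dt_eval t x}" using hard(1) by auto
      then show "measure_pmf.prob p {t. dt_eval t x} \<le> 1 / 3"
        using correct[of x] measure_pmf.prob_compl[of "{t. dt_eval t x}" p] by (simp add: Compl_eq_Diff_UNIV)
    qed
  qed (auto intro!: integrable_bounded_pmf[of _ 1])
  moreover have "E \<nu> - E \<mu> \<le> ?c * real T"
  proof -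
    have int: "integrable p (acc \<rho>)" for \<rho>
      by (intro integrable_bounded_pmf[of _ 1]) (auto simp: acc_le_1)
    have "E \<nu> - E \<mu> = measure_pmf.expectation p (\<lambda>t. acc \<nu> t - acc \<mu> t)"
      by (simp add: E_def Bochner_Integration.integral_diff[OF int int])
    also have "\<dots> \<le> ?c * real T"
    proof (rule measure_pmf.integral_le_const)
      show "AE t in p. acc \<nu> t - acc \<mu> t \<le> ?c * real T"
      proof (rule AE_pmfI)
        fix t assume "t \<in> set_pmf p"
        then have "cost \<mu> t \<le> real T"
          unfolding cost_def
          by (intro measure_pmf.integral_le_const integrable_bounded_queries[of _ t]) (auto simp: dt(2))
        then have "?c * cost \<mu> t \<le> ?c * real T" by (intro mult_left_mono) auto
        then show "acc \<nu> t - acc \<mu> t \<le> ?c * real T"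
          using hard(3)[unfolded hides_def, rule_format, of t] by linarith
      qed
    qed (intro Bochner_Integration.integrable_diff int)
    finally show ?thesis .
  qed
  ultimately have "1 / 3 \<le> ?c * real T" by linarith
  then show ?thesis
    using n by (simp add: T_def field_simps)
qed

section \<open>Circuits of phase queries\<close>

definition ip :: "'s set \<Rightarrow> ('s \<Rightarrow> real) \<Rightarrow> ('s \<Rightarrow> real) \<Rightarrow> real" where
  "ip S \<phi> \<psi> = (\<Sum>s\<in>S. \<phi> s * \<psi> s)"

text \<open>States are functions on the whole label type. Acting as the identity outside
  \<open>S\<close> is what allows \<open>S\<close> to be enlarged later, and \<open>bij\<close>
  makes \<open>inv U\<close> a genuine inverse, needed to run circuits backwards.\<close>

definition orthogonal_on :: "'s set \<Rightarrow> (('s \<Rightarrow> real) \<Rightarrow> 's \<Rightarrow> real) \<Rightarrow> bool" where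
  "orthogonal_on S U \<longleftrightarrow>
     (\<forall>a b \<phi> \<psi>. U (\<lambda>s. a * \<phi> s + b * \<psi> s) = (\<lambda>s. a * U \<phi> s + b * U \<psi> s)) \<and>
     (\<forall>\<phi> s. s \<notin> S \<longrightarrow> U \<phi> s = \<phi> s) \<and>
     (\<forall>\<phi> \<psi>. ip S (U \<phi>) (U \<psi>) = ip S \<phi> \<psi>) \<and>
     bij U"

lemma orthogonal_onI:
  assumes "\<And>a b \<phi> \<psi>. U (\<lambda>s. a * \<phi> s + b * \<psi> s) = (\<lambda>s. a * U \<phi> s + b * U \<psi> s)"
    and "\<And>\<phi> s. s \<notin> S \<Longrightarrow> U \<phi> s = \<phi> s"
    and "\<And>\<phi> \<psi>. ip S (U \<phi>) (U \<psi>) = ip S \<phi> \<psi>"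
    and "\<And>\<phi>. V (U \<phi>) = \<phi>" "\<And>\<phi>. U (V \<phi>) = \<phi>"
  shows "orthogonal_on S U"
  unfolding orthogonal_on_def
  using assms by (auto intro!: o_bij[of V U] ext)

lemma orthogonal_on_linear:
  "orthogonal_on S U \<Longrightarrow> U (\<lambda>s. a * \<phi> s + b * \<psi> s) = (\<lambda>s. a * U \<phi> s + b * U \<psi> s)"
  by (simp add: orthogonal_on_def)

lemma orthogonal_on_scale: "orthogonal_on S U \<Longrightarrow> U (\<lambda>s. a * \<phi> s) = (\<lambda>s. a * U \<phi> s)"
  using orthogonal_on_linear[of S U a \<phi> 0 \<phi>] by simp

lemma orthogonal_on_diff:
  "orthogonal_on S U \<Longrightarrow> U (\<lambda>s. \<phi> s - b * \<psi> s) = (\<lambda>s. U \<phi> s - b * U \<psi> s)"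
  using orthogonal_on_linear[of S U 1 \<phi> "-b" \<psi>] by simp

lemma orthogonal_on_zero: "orthogonal_on S U \<Longrightarrow> U (\<lambda>_. 0) = (\<lambda>_. 0)"
  using orthogonal_on_linear[of S U 0 _ 0] by simp

lemma orthogonal_on_outside: "orthogonal_on S U \<Longrightarrow> s \<notin> S \<Longrightarrow> U \<phi> s = \<phi> s"
  by (simp add: orthogonal_on_def)

lemma orthogonal_on_ip: "orthogonal_on S U \<Longrightarrow> ip S (U \<phi>) (U \<psi>) = ip S \<phi> \<psi>"
  by (simp add: orthogonal_on_def)

lemma orthogonal_on_bij: "orthogonal_on S U \<Longrightarrow> bij U"
  by (simp add: orthogonal_on_def)

lemma orthogonal_on_inv_left: "orthogonal_on S U \<Longrightarrow> inv U (U \<phi>) = \<phi>"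
  by (simp add: bij_is_inj orthogonal_on_bij)

lemma orthogonal_on_inv_right: "orthogonal_on S U \<Longrightarrow> U (inv U \<phi>) = \<phi>"
  by (simp add: bij_is_surj orthogonal_on_bij surj_f_inv_f)

lemma ip_self_eq_0: "finite S \<Longrightarrow> ip S \<phi> \<phi> = 0 \<Longrightarrow> s \<in> S \<Longrightarrow> \<phi> s = 0"
  unfolding ip_def by (subst (asm) sum_nonneg_eq_0_iff) auto

text \<open>If two states agree on \<open>S\<close>, their difference has norm \<open>0\<close>
  there, and so has its image.\<close>

lemma orthogonal_on_cong:
  assumes U: "orthogonal_on S U" and S: "finite S"
    and eq: "\<And>s. s \<in> S \<Longrightarrow> \<phi> s = \<psi> s" and s: "s \<in> S"
  shows "U \<phi> s = U \<psi> s"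
proof -
  have "ip S (\<lambda>s. \<phi> s - 1 * \<psi> s) (\<lambda>s. \<phi> s - 1 * \<psi> s) = 0"
    unfolding ip_def using eq by (intro sum.neutral) auto
  then have "ip S (U (\<lambda>s. \<phi> s - 1 * \<psi> s)) (U (\<lambda>s. \<phi> s - 1 * \<psi> s)) = 0"
    using orthogonal_on_ip[OF U] by metis
  then have "U (\<lambda>s. \<phi> s - 1 * \<psi> s) s = 0"
    using ip_self_eq_0 S s by metis
  then show ?thesis by (simp only: orthogonal_on_diff[OF U])
qed

lemma orthogonal_on_id: "orthogonal_on S (\<lambda>\<phi>. \<phi>)"
  by (rule orthogonal_onI[where V = "\<lambda>\<phi>. \<phi>"]) auto

lemma orthogonal_on_comp:
  assumes "orthogonal_on S U" "orthogonal_on S V"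
  shows "orthogonal_on S (\<lambda>\<phi>. V (U \<phi>))"
  by (rule orthogonal_onI[where V = "\<lambda>\<phi>. inv U (inv V \<phi>)"])
    (auto simp: orthogonal_on_linear[OF assms(1)] orthogonal_on_linear[OF assms(2)]
      orthogonal_on_outside[OF assms(1)] orthogonal_on_outside[OF assms(2)]
      orthogonal_on_ip[OF assms(1)] orthogonal_on_ip[OF assms(2)]
      orthogonal_on_inv_left[OF assms(1)] orthogonal_on_inv_left[OF assms(2)]
      orthogonal_on_inv_right[OF assms(1)] orthogonal_on_inv_right[OF assms(2)])

lemma orthogonal_on_inv:
  assumes U: "orthogonal_on S U"
  shows "orthogonal_on S (inv U)"
proof (rule orthogonal_onI[where V = U])
  note r = orthogonal_on_inv_right[OF U] and l = orthogonal_on_inv_left[OF U]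
  fix a b \<phi> \<psi>
  have "U (\<lambda>s. a * inv U \<phi> s + b * inv U \<psi> s) = (\<lambda>s. a * \<phi> s + b * \<psi> s)"
    by (simp add: orthogonal_on_linear[OF U] r)
  then show "inv U (\<lambda>s. a * \<phi> s + b * \<psi> s) = (\<lambda>s. a * inv U \<phi> s + b * inv U \<psi> s)"
    using l by metis
  show "inv U \<phi> s = \<phi> s" if "s \<notin> S" for s
    using orthogonal_on_outside[OF U that, of "inv U \<phi>"] r by simp
  show "ip S (inv U \<phi>) (inv U \<psi>) = ip S \<phi> \<psi>"
    using orthogonal_on_ip[OF U, of "inv U \<phi>" "inv U \<psi>"] r by simp
  show "U (inv U \<phi>) = \<phi>" "inv U (U \<phi>) = \<phi>" by (simp_all add: l r)
qed

lemma orthogonal_on_mono: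
  assumes U: "orthogonal_on S U" and S: "finite S'" "S \<subseteq> S'"
  shows "orthogonal_on S' U"
proof (rule orthogonal_onI[where V = "inv U"])
  fix \<phi> \<psi>
  have "ip S' \<alpha> \<beta> = ip S \<alpha> \<beta> + ip (S' - S) \<alpha> \<beta>" for \<alpha> \<beta>
    unfolding ip_def using S by (metis add.commute sum.subset_diff)
  moreover have "ip (S' - S) (U \<phi>) (U \<psi>) = ip (S' - S) \<phi> \<psi>"
    unfolding ip_def by (intro sum.cong) (auto simp: orthogonal_on_outside[OF U])
  ultimately show "ip S' (U \<phi>) (U \<psi>) = ip S' \<phi> \<psi>"
    by (simp add: orthogonal_on_ip[OF U])
  show "U \<phi> s = \<phi> s" if "s \<notin> S'" for s
    using that S orthogonal_on_outside[OF U] by blast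
qed (simp_all add: orthogonal_on_linear[OF U] orthogonal_on_inv_left[OF U]
  orthogonal_on_inv_right[OF U])

section \<open>Sign flips and reflections\<close>

definition flip :: "'s set \<Rightarrow> ('s \<Rightarrow> real) \<Rightarrow> 's \<Rightarrow> real" where
  "flip G \<phi> = (\<lambda>s. if s \<in> G then - \<phi> s else \<phi> s)"

lemma flip_flip [simp]: "flip G (flip G \<phi>) = \<phi>"
  by (auto simp: flip_def)

lemma orthogonal_on_flip: "G \<subseteq> S \<Longrightarrow> orthogonal_on S (flip G)"
  by (rule orthogonal_onI[where V = "flip G"])
    (auto simp: flip_def ip_def fun_eq_iff intro!: sum.cong)

text \<open>The reflection in the hyperplane orthogonal to \<open>v\<close>. If \<open>v\<close>
  vanishes on \<open>S\<close>, the division by zero yields \<open>0\<close> and the map is the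
  identity.\<close>

definition householder :: "'s set \<Rightarrow> ('s \<Rightarrow> real) \<Rightarrow> ('s \<Rightarrow> real) \<Rightarrow> 's \<Rightarrow> real" where
  "householder S v \<phi> = (\<lambda>s. \<phi> s - 2 * ip S v \<phi> / ip S v v * (if s \<in> S then v s else 0))"

lemma ip_linear: "ip S v (\<lambda>s. a * \<phi> s + b * \<psi> s) = a * ip S v \<phi> + b * ip S v \<psi>"
  by (simp add: ip_def sum.distrib sum_distrib_left algebra_simps)

lemma ip_commute: "ip S \<phi> \<psi> = ip S \<psi> \<phi>"
  by (simp add: ip_def mult.commute)

lemma ip_diff: "ip S v (\<lambda>s. \<phi> s - b * \<psi> s) = ip S v \<phi> - b * ip S v \<psi>"
  using ip_linear[of S v 1 \<phi> "-b" \<psi>] by simp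

lemma ip_cong: "(\<And>s. s \<in> S \<Longrightarrow> \<phi> s = \<phi>' s) \<Longrightarrow> (\<And>s. s \<in> S \<Longrightarrow> \<psi> s = \<psi>' s) \<Longrightarrow> ip S \<phi> \<psi> = ip S \<phi>' \<psi>'"
  by (simp add: ip_def)

lemma ip_householder:
  assumes "finite S"
  shows "ip S w (householder S v \<phi>) = ip S w \<phi> - 2 * ip S v \<phi> / ip S v v * ip S w v"
proof -
  have "ip S w (householder S v \<phi>) = ip S w (\<lambda>s. \<phi> s - 2 * ip S v \<phi> / ip S v v * v s)"
    by (rule ip_cong) (auto simp: householder_def)
  then show ?thesis by (simp only: ip_diff)
qed

lemma ip_householder_self:
  assumes "finite S"
  shows "ip S v (householder S v \<phi>) = - ip S v \<phi>"
proof (cases "ip S v v = 0")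
  case True
  then have "ip S v \<phi> = 0"
    unfolding ip_def[of S v \<phi>] using ip_self_eq_0[OF assms] by (intro sum.neutral) auto
  then show ?thesis by (simp add: ip_householder[OF assms])
qed (simp add: ip_householder[OF assms])

lemma householder_involutive:
  assumes "finite S"
  shows "householder S v (householder S v \<phi>) = \<phi>"
  by (rule ext) (simp add: householder_def[of S v "householder S v \<phi>"] ip_householder_self[OF assms],
      simp add: householder_def)

lemma orthogonal_on_householder:
  assumes "finite S"
  shows "orthogonal_on S (householder S v)"
proof (rule orthogonal_onI[where V = "householder S v"])
  fix \<phi> \<psi>
  have "ip S (householder S v \<phi>) (householder S v \<psi>)
      = ip S (householder S v \<phi>) \<psi> - 2 * ip S v \<psi> / ip S v v * ip S (householder S v \<phi>) v"
    by (rule ip_householder[OF assms])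
  also have "ip S (householder S v \<phi>) v = - ip S v \<phi>"
    by (subst ip_commute) (rule ip_householder_self[OF assms])
  also have "ip S (householder S v \<phi>) \<psi> = ip S \<psi> \<phi> - 2 * ip S v \<phi> / ip S v v * ip S \<psi> v"
    by (subst ip_commute) (rule ip_householder[OF assms])
  finally show "ip S (householder S v \<phi>) (householder S v \<psi>) = ip S \<phi> \<psi>"
    by (simp add: ip_commute[of S \<psi>])
  show "householder S v (\<lambda>s. a * \<phi> s + b * \<psi> s)
      = (\<lambda>s. a * householder S v \<phi> s + b * householder S v \<psi> s)" for a b
    unfolding householder_def ip_linear by (simp add: fun_eq_iff add_divide_distrib algebra_simps)
  show "householder S v (householder S v \<phi>) = \<phi>" "householder S v (householder S v \<phi>) = \<phi>"
    by (rule householder_involutive[OF assms])+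
qed (simp add: householder_def)

text \<open>The reflection along the difference of two vectors of equal length exchanges them.
  Uniform superpositions and kickback states are prepared from a basis state in this way.\<close>

lemma householder_swap:
  assumes S: "finite S" and v: "v = (\<lambda>s. \<phi> s - \<psi> s)"
    and eq: "ip S \<phi> \<phi> = ip S \<psi> \<psi>" and out: "\<And>s. s \<notin> S \<Longrightarrow> \<phi> s = \<psi> s"
  shows "householder S v \<phi> = \<psi>"
proof -
  have vv: "ip S v v = 2 * ip S v \<phi>"
  proof -
    have vw: "ip S w v = ip S w \<phi> - ip S w \<psi>" for w
      using ip_diff[of S w \<phi> 1 \<psi>] by (simp add: v)
    have "ip S v v = (ip S \<phi> \<phi> - ip S \<phi> \<psi>) - (ip S \<psi> \<phi> - ip S \<psi> \<psi>)"
      using vw[of v] vw[of \<phi>] vw[of \<psi>] ip_commute by metis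
    moreover have "ip S v \<phi> = ip S \<phi> \<phi> - ip S \<phi> \<psi>" using vw[of \<phi>] ip_commute by metis
    ultimately show ?thesis using eq by (simp add: ip_commute)
  qed
  show ?thesis
  proof (cases "ip S v v = 0")
    case True
    then have "v s = 0" if "s \<in> S" for s using ip_self_eq_0[OF S] that by blast
    then have "\<phi> s = \<psi> s" for s using out[of s] by (auto simp: v)
    then show ?thesis using True by (auto simp: householder_def fun_eq_iff)
  next
    case False
    then have "2 * ip S v \<phi> / ip S v v = 1" using vv by simp
    then show ?thesis using out by (auto simp: householder_def fun_eq_iff v)
  qed
qed

section \<open>Controlled operators and renaming of labels\<close>

definition ctrl :: "'e set \<Rightarrow> ('e \<Rightarrow> ('s \<Rightarrow> real) \<Rightarrow> 's \<Rightarrow> real) \<Rightarrow> ('e \<times> 's \<Rightarrow> real) \<Rightarrow> 'e \<times> 's \<Rightarrow> real" where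
  "ctrl E U \<phi> = (\<lambda>(e, s). if e \<in> E then U e (\<lambda>s'. \<phi> (e, s')) s else \<phi> (e, s))"

lemma orthogonal_on_ctrl:
  assumes U: "\<And>e. e \<in> E \<Longrightarrow> orthogonal_on S (U e)"
  shows "orthogonal_on (E \<times> S) (ctrl E U)"
proof (rule orthogonal_onI[where V = "ctrl E (\<lambda>e. inv (U e))"])
  fix \<phi> \<psi> :: "'a \<times> 'b \<Rightarrow> real"
  have dec: "ip (E \<times> S) \<phi> \<psi> = (\<Sum>e\<in>E. ip S (\<lambda>s. \<phi> (e, s)) (\<lambda>s. \<psi> (e, s)))" for \<phi> \<psi> :: "'a \<times> 'b \<Rightarrow> real"
    by (simp add: ip_def sum.cartesian_product split_def)
  show "ip (E \<times> S) (ctrl E U \<phi>) (ctrl E U \<psi>) = ip (E \<times> S) \<phi> \<psi>"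
    unfolding dec by (intro sum.cong refl) (simp add: ctrl_def orthogonal_on_ip[OF U])
  show "ctrl E U \<phi> s = \<phi> s" if "s \<notin> E \<times> S" for s
    using that by (cases s) (auto simp: ctrl_def orthogonal_on_outside[OF U])
  show "ctrl E (\<lambda>e. inv (U e)) (ctrl E U \<phi>) = \<phi>" "ctrl E U (ctrl E (\<lambda>e. inv (U e)) \<phi>) = \<phi>"
    by (auto simp: ctrl_def fun_eq_iff orthogonal_on_inv_left[OF U] orthogonal_on_inv_right[OF U])
qed (auto simp: ctrl_def fun_eq_iff orthogonal_on_linear[OF U])

text \<open>Conjugation by an injective renaming. It moves labels of arbitrary type into the natural
  numbers, exchanges registers, and packs pairs into basis indices.\<close>

definition relabel :: "'s set \<Rightarrow> ('s \<Rightarrow> 't) \<Rightarrow> (('s \<Rightarrow> real) \<Rightarrow> 's \<Rightarrow> real) \<Rightarrow> ('t \<Rightarrow> real) \<Rightarrow> 't \<Rightarrow> real" where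
  "relabel S f U \<phi> = (\<lambda>t. if t \<in> f ` S then U (\<phi> \<circ> f) (inv_into S f t) else \<phi> t)"

lemma relabel_apply: "inj_on f S \<Longrightarrow> s \<in> S \<Longrightarrow> relabel S f U \<phi> (f s) = U (\<phi> \<circ> f) s"
  by (simp add: relabel_def)

lemma relabel_relabel:
  assumes "finite S" "inj_on f S" "orthogonal_on S V"
  shows "relabel S f V (relabel S f U \<phi>) = relabel S f (\<lambda>\<phi>. V (U \<phi>)) \<phi>"
proof (rule ext)
  fix t
  show "relabel S f V (relabel S f U \<phi>) t = relabel S f (\<lambda>\<phi>. V (U \<phi>)) \<phi> t"
  proof (cases "t \<in> f ` S")
    case True
    then obtain s where s: "s \<in> S" "t = f s" by auto
    show ?thesis
      by (simp add: s relabel_apply[OF assms(2)])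
        (rule orthogonal_on_cong[OF assms(3,1)], auto simp: relabel_apply[OF assms(2)] s)
  qed (simp add: relabel_def)
qed

lemma orthogonal_on_relabel:
  assumes S: "finite S" and f: "inj_on f S" and U: "orthogonal_on S U"
  shows "orthogonal_on (f ` S) (relabel S f U)"
proof (rule orthogonal_onI[where V = "relabel S f (inv U)"])
  fix \<phi> \<psi> :: "'b \<Rightarrow> real"
  have red: "ip (f ` S) \<phi> \<psi> = ip S (\<phi> \<circ> f) (\<psi> \<circ> f)" for \<phi> \<psi>
    by (simp add: ip_def sum.reindex[OF f])
  have "ip (f ` S) (relabel S f U \<phi>) (relabel S f U \<psi>) = ip S (U (\<phi> \<circ> f)) (U (\<psi> \<circ> f))"
    unfolding red by (rule ip_cong) (simp_all add: relabel_apply[OF f])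
  then show "ip (f ` S) (relabel S f U \<phi>) (relabel S f U \<psi>) = ip (f ` S) \<phi> \<psi>"
    by (simp add: orthogonal_on_ip[OF U] red)
  have id: "relabel S f (\<lambda>\<phi>. \<phi>) \<phi> = \<phi>"
    using f by (auto simp: relabel_def fun_eq_iff)
  show "relabel S f (inv U) (relabel S f U \<phi>) = \<phi>" "relabel S f U (relabel S f (inv U) \<phi>) = \<phi>"
    by (simp_all add: relabel_relabel S f U orthogonal_on_inv orthogonal_on_inv_left[OF U]
        orthogonal_on_inv_right[OF U] id)
  fix a b
  have "(\<lambda>s. a * \<phi> s + b * \<psi> s) \<circ> f = (\<lambda>s. a * (\<phi> \<circ> f) s + b * (\<psi> \<circ> f) s)"
    by (rule ext) (simp only: comp_apply)
  then have "U ((\<lambda>s. a * \<phi> s + b * \<psi> s) \<circ> f) = (\<lambda>s. a * U (\<phi> \<circ> f) s + b * U (\<psi> \<circ> f) s)"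
    by (simp only: orthogonal_on_linear[OF U])
  then show "relabel S f U (\<lambda>s. a * \<phi> s + b * \<psi> s)
      = (\<lambda>s. a * relabel S f U \<phi> s + b * relabel S f U \<psi> s)"
    by (auto simp: relabel_def)
qed (simp add: relabel_def)

definition phase :: "nat \<Rightarrow> ('s \<Rightarrow> nat) \<Rightarrow> (nat \<Rightarrow> bool) \<Rightarrow> ('s \<Rightarrow> real) \<Rightarrow> 's \<Rightarrow> real" where
  "phase N q x = flip {s. q s < N \<and> x (q s)}"

text \<open>A value \<open>q s \<ge> N\<close> means that the basis state \<open>s\<close> makes no query.\<close>

text \<open>
  Steps are specified pointwise, so that \<open>U\<close>, \<open>q\<close> and \<open>A\<close> need not be found by higher-order
  unification against a composition.
\<close>

inductive circuit ::
    "nat \<Rightarrow> 's set \<Rightarrow> nat \<Rightarrow> ((nat \<Rightarrow> bool) \<Rightarrow> ('s \<Rightarrow> real) \<Rightarrow> 's \<Rightarrow> real) \<Rightarrow> bool"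
  for N S where
  circuit_0: "orthogonal_on S U \<Longrightarrow> (\<And>x. A x = U) \<Longrightarrow> circuit N S 0 A"
| circuit_Suc: "circuit N S T A \<Longrightarrow> orthogonal_on S U \<Longrightarrow> (\<And>s. s \<notin> S \<Longrightarrow> N \<le> q s) \<Longrightarrow>
    (\<And>x \<phi>. B x \<phi> = U (phase N q x (A x \<phi>))) \<Longrightarrow> circuit N S (Suc T) B"

section \<open>Composition, inversion and control of circuits\<close>

lemma orthogonal_on_phase:
  assumes "\<And>s. s \<notin> S \<Longrightarrow> N \<le> q s"
  shows "orthogonal_on S (phase N q x)"
  unfolding phase_def by (rule orthogonal_on_flip) (use assms leD in blast)

lemma orthogonal_on_circuit: "circuit N S T A \<Longrightarrow> orthogonal_on S (A x)"
proof (induction rule: circuit.induct)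
  case (circuit_Suc T A U q B)
  have B: "B x = (\<lambda>\<phi>. U (phase N q x (A x \<phi>)))"
    using circuit_Suc.hyps(4) by auto
  show ?case
    unfolding B by (rule orthogonal_on_comp[OF orthogonal_on_comp[OF circuit_Suc.IH
      orthogonal_on_phase[OF circuit_Suc.hyps(3)]] circuit_Suc.hyps(2)])
qed simp

lemma circuit_const: "orthogonal_on S U \<Longrightarrow> circuit N S 0 (\<lambda>_. U)"
  by (rule circuit_0) auto

lemma circuit_append:
  assumes A: "circuit N S T A" and U: "orthogonal_on S U" and B: "\<And>x \<phi>. B x \<phi> = U (A x \<phi>)"
  shows "circuit N S T B"
  using A
proof cases
  case (circuit_0 V)
  show ?thesis
    unfolding circuit_0(1) by (rule circuit.circuit_0[OF orthogonal_on_comp[OF circuit_0(2) U]])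
      (auto simp: B circuit_0(3))
next
  case (circuit_Suc T' A' V q)
  show ?thesis
    unfolding circuit_Suc(1)
    by (rule circuit.circuit_Suc[OF circuit_Suc(2) orthogonal_on_comp[OF circuit_Suc(3) U] circuit_Suc(4)])
      (auto simp: B circuit_Suc(5))
qed

lemma circuit_comp:
  assumes "circuit N S T' B" "circuit N S T A" "\<And>x \<phi>. C x \<phi> = B x (A x \<phi>)"
  shows "circuit N S (T + T') C"
  using assms(1,3)
proof (induction arbitrary: C rule: circuit.induct)
  case (circuit_0 U B C)
  have "circuit N S T C"
    by (rule circuit_append[OF assms(2) circuit_0(1)]) (simp add: circuit_0)
  then show ?case by simp
next
  case (circuit_Suc T' B U q B' C)
  have "circuit N S (T + T') (\<lambda>x \<phi>. B x (A x \<phi>))"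
    by (rule circuit_Suc.IH) simp
  then have "circuit N S (Suc (T + T')) C"
    by (rule circuit.circuit_Suc[OF _ circuit_Suc.hyps(2), where q = q])
      (simp_all add: circuit_Suc.hyps(3,4) circuit_Suc.prems)
  then show ?case by simp
qed

lemma circuit_query: "(\<And>s. s \<notin> S \<Longrightarrow> N \<le> q s) \<Longrightarrow> circuit N S 1 (phase N q)"
  unfolding One_nat_def
  by (rule circuit_Suc[OF circuit_const[OF orthogonal_on_id] orthogonal_on_id, where q = q]) auto

text \<open>The steps are undone in reverse order; a phase query is its own inverse, so the number
  of queries stays the same.\<close>

lemma circuit_inv:
  assumes "circuit N S T A"
  shows "circuit N S T (\<lambda>x. inv (A x))"
  using assms
proof (induction rule: circuit.induct)
  case (circuit_0 U A)
  show ?case by (rule circuit.circuit_0[OF orthogonal_on_inv[OF circuit_0(1)]]) (simp add: circuit_0(2))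
next
  case (circuit_Suc T A U q B)
  have Q: "circuit N S 1 (\<lambda>x \<phi>. phase N q x (inv U \<phi>))"
    using circuit_comp[OF circuit_query[OF circuit_Suc.hyps(3)] circuit_const[OF orthogonal_on_inv[OF circuit_Suc.hyps(2)]],
        where C = "\<lambda>x \<phi>. phase N q x (inv U \<phi>)"]
    by simp
  have B: "B x = (\<lambda>\<phi>. U (phase N q x (A x \<phi>)))" for x
    using circuit_Suc.hyps(4) by auto
  have "inv (B x) = (\<lambda>\<phi>. inv (A x) (phase N q x (inv U \<phi>)))" for x
      unfolding B using orthogonal_on_circuit[OF circuit_Suc.hyps(1), of x] circuit_Suc.hyps(2)
      by (intro inv_equality) (auto simp: phase_def orthogonal_on_inv_left orthogonal_on_inv_right)
  then have "circuit N S (1 + T) (\<lambda>x. inv (B x))"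
    by (intro circuit_comp[OF circuit_Suc.IH Q]) simp
  then show ?case by simp
qed

lemma circuit_mono_queries: "T \<le> T' \<Longrightarrow> circuit N S T A \<Longrightarrow> circuit N S T' A"
proof (induction rule: dec_induct)
  case (step T')
  show ?case
    \<comment> \<open>With \<open>q = N\<close> for every label the additional query is
      idle.\<close>
    by (rule circuit_Suc[OF step.IH[OF step.prems] orthogonal_on_id, where q = "\<lambda>_. N"])
      (auto simp: phase_def flip_def)
qed

lemma circuit_mono_labels:
  assumes "circuit N S T A" "finite S'" "S \<subseteq> S'"
  shows "circuit N S' T A"
  using assms(1)
proof (induction rule: circuit.induct)
  case (circuit_0 U A)
  show ?case by (rule circuit.circuit_0[OF orthogonal_on_mono[OF circuit_0(1) assms(2,3)] circuit_0(2)])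
next
  case (circuit_Suc T A U q B)
  show ?case
    by (rule circuit.circuit_Suc[OF circuit_Suc.IH orthogonal_on_mono[OF circuit_Suc.hyps(2) assms(2,3)] _ circuit_Suc.hyps(4)])
      (use circuit_Suc.hyps(3) assms(3) in blast)
qed

text \<open>All branches make the same number of queries, so their \<open>t\<close>-th queries merge
  into a single one whose index depends on the control label.\<close>

lemma circuit_ctrl:
  assumes "\<And>e. e \<in> E \<Longrightarrow> circuit N S T (A e)"
  shows "circuit N (E \<times> S) T (\<lambda>x. ctrl E (\<lambda>e. A e x))"
  using assms
proof (induction T arbitrary: A)
  case 0
  have "\<exists>U. orthogonal_on S U \<and> (\<forall>x. A e x = U)" if "e \<in> E" for e
    using 0[OF that] by cases auto
  then obtain U where U: "\<And>e. e \<in> E \<Longrightarrow> orthogonal_on S (U e)" "\<And>e x. e \<in> E \<Longrightarrow> A e x = U e"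
    by metis
  show ?case
    by (rule circuit_0[OF orthogonal_on_ctrl[of E S U, OF U(1)]]) (auto simp: ctrl_def fun_eq_iff U(2))
next
  case (Suc T)
  have "\<exists>B U q. circuit N S T B \<and> orthogonal_on S U \<and> (\<forall>s. s \<notin> S \<longrightarrow> N \<le> q s) \<and>
      (\<forall>x \<phi>. A e x \<phi> = U (phase N q x (B x \<phi>)))" if "e \<in> E" for e
    using Suc.prems[OF that] by cases blast
  then obtain B U q where *: "\<And>e. e \<in> E \<Longrightarrow> circuit N S T (B e)" "\<And>e. e \<in> E \<Longrightarrow> orthogonal_on S (U e)"
      "\<And>e s. e \<in> E \<Longrightarrow> s \<notin> S \<Longrightarrow> N \<le> q e s"
      "\<And>e x \<phi>. e \<in> E \<Longrightarrow> A e x \<phi> = U e (phase N (q e) x (B e x \<phi>))"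
    by metis
  define q' where "q' = (\<lambda>(e, s). if e \<in> E then q e s else N)"
  show ?case
  proof (rule circuit_Suc[OF Suc.IH[of B, OF *(1)] orthogonal_on_ctrl[of E S U, OF *(2)], where q = q'])
    show "N \<le> q' s" if "s \<notin> E \<times> S" for s
      using that *(3) by (cases s) (auto simp: q'_def)
  qed (auto simp: fun_eq_iff ctrl_def *(4) phase_def flip_def q'_def intro!: arg_cong[of _ _ "\<lambda>\<phi>. U _ \<phi> _"])
qed

lemma circuit_relabel:
  assumes "circuit N S T A" and S: "finite S" and f: "inj_on f S"
  shows "circuit N (f ` S) T (\<lambda>x. relabel S f (A x))"
  using assms(1)
proof (induction rule: circuit.induct)
  case (circuit_0 U A)
  show ?case by (rule circuit.circuit_0[OF orthogonal_on_relabel[OF S f circuit_0(1)]]) (simp add: circuit_0(2))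
next
  case (circuit_Suc T A U q B)
  define q' where "q' t = (if t \<in> f ` S then q (inv_into S f t) else N)" for t
  have q': "phase N q' x = relabel S f (phase N q x)" for x
    using f by (auto simp: phase_def flip_def q'_def relabel_def fun_eq_iff)
  show ?case
  proof (rule circuit.circuit_Suc[OF circuit_Suc.IH orthogonal_on_relabel[OF S f circuit_Suc.hyps(2)], where q = q'])
    fix x \<phi>
    have "orthogonal_on S (\<lambda>\<phi>. U (phase N q x \<phi>))"
      by (rule orthogonal_on_comp[OF orthogonal_on_phase[OF circuit_Suc.hyps(3)] circuit_Suc.hyps(2)])
    from relabel_relabel[OF S f this, of "A x" \<phi>]
    have "relabel S f (\<lambda>\<phi>. U (phase N q x \<phi>)) (relabel S f (A x) \<phi>) = relabel S f (B x) \<phi>"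
      by (simp add: circuit_Suc.hyps(4)[symmetric])
    then show "relabel S f (B x) \<phi> = relabel S f U (phase N q' x (relabel S f (A x) \<phi>))"
      unfolding q' by (subst relabel_relabel[OF S f circuit_Suc.hyps(2)]) simp
  qed (simp add: q'_def)
qed

text \<open>A phase query to the negated input is one to \<open>x\<close> followed by a sign flip of
  all labels that make a query. This flip does not depend on \<open>x\<close> and joins the next
  orthogonal map.\<close>

lemma circuit_negate:
  assumes "circuit N S T A"
  shows "circuit N S T (\<lambda>x. A (\<lambda>j. \<not> x j))"
  using assms
proof (induction rule: circuit.induct)
  case (circuit_0 U A)
  show ?case by (rule circuit.circuit_0[OF circuit_0(1)]) (simp add: circuit_0(2))
next
  case (circuit_Suc T A U q B)
  have "orthogonal_on S (\<lambda>\<phi>. U (flip {s. q s < N} \<phi>))"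
    by (rule orthogonal_on_comp[OF orthogonal_on_flip circuit_Suc.hyps(2)])
      (use circuit_Suc.hyps(3) leD in blast)
  then show ?case
    by (rule circuit.circuit_Suc[OF circuit_Suc.IH _ circuit_Suc.hyps(3)])
      (auto simp: circuit_Suc.hyps(4) phase_def flip_def intro!: arg_cong[of _ _ U])
qed

lemma circuit_shift:
  assumes "circuit M S T A" "k + M \<le> N"
  shows "circuit N S T (\<lambda>x. A (\<lambda>j. x (k + j)))"
  using assms(1)
proof (induction rule: circuit.induct)
  case (circuit_0 U A)
  show ?case by (rule circuit.circuit_0[OF circuit_0(1)]) (simp add: circuit_0(2))
next
  case (circuit_Suc T A U q B)
  define q' where "q' s = (if q s < M then k + q s else N)" for s
  have q': "phase N q' x = phase M q (\<lambda>j. x (k + j))" for x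
    using assms(2) by (auto simp: phase_def q'_def intro!: arg_cong[of _ _ flip])
  show ?case
    by (rule circuit.circuit_Suc[OF circuit_Suc.IH circuit_Suc.hyps(2), where q = q'])
      (use circuit_Suc.hyps(3) leD in \<open>auto simp: q' circuit_Suc.hyps(4) q'_def\<close>)
qed

section \<open>Sampling by measuring a circuit\<close>

definition basis :: "'s \<Rightarrow> 's \<Rightarrow> real" where
  "basis z = (\<lambda>s. of_bool (s = z))"

text \<open>The Born rule. \<open>embed_pmf\<close> gives these probabilities only if
  \<open>\<psi>\<close> has norm \<open>1\<close> on \<open>S\<close>, which holds for every state
  that a circuit reaches from a basis state in \<open>S\<close>.\<close>

definition measured :: "'s set \<Rightarrow> ('s \<Rightarrow> real) \<Rightarrow> 's pmf" where
  "measured S \<psi> = embed_pmf (\<lambda>s. if s \<in> S then (\<psi> s)\<^sup>2 else 0)"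

lemma pmf_measured:
  assumes "finite S" "ip S \<psi> \<psi> = 1"
  shows "pmf (measured S \<psi>) s = (if s \<in> S then (\<psi> s)\<^sup>2 else 0)"
  unfolding measured_def
proof (rule pmf_embed_pmf)
  have "(\<integral>\<^sup>+ s. ennreal (if s \<in> S then (\<psi> s)\<^sup>2 else 0) \<partial>count_space UNIV)
      = (\<Sum>s\<in>S. ennreal (if s \<in> S then (\<psi> s)\<^sup>2 else 0))"
    by (rule nn_integral_count_space') (auto simp: assms(1))
  also have "\<dots> = ennreal (ip S \<psi> \<psi>)"
    by (simp add: ip_def power2_eq_square)
  finally show "(\<integral>\<^sup>+ s. ennreal (if s \<in> S then (\<psi> s)\<^sup>2 else 0) \<partial>count_space UNIV) = 1"
    by (simp add: assms(2))
qed auto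

lemma prob_measured:
  assumes "finite S" "ip S \<psi> \<psi> = 1"
  shows "measure (measure_pmf (measured S \<psi>)) X = (\<Sum>s\<in>S \<inter> X. (\<psi> s)\<^sup>2)"
proof -
  have sub: "set_pmf (measured S \<psi>) \<subseteq> S"
    by (auto simp: set_pmf_eq pmf_measured[OF assms])
  have "X \<inter> set_pmf (measured S \<psi>) = (S \<inter> X) \<inter> set_pmf (measured S \<psi>)"
    using sub by auto
  then have "measure (measured S \<psi>) X = measure (measured S \<psi>) (S \<inter> X)"
    using measure_Int_set_pmf[of "measured S \<psi>" X] measure_Int_set_pmf[of "measured S \<psi>" "S \<inter> X"]
    by simp
  also have "\<dots> = (\<Sum>s\<in>S \<inter> X. (\<psi> s)\<^sup>2)"
    using assms by (simp add: measure_measure_pmf_finite pmf_measured[OF assms])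
  finally show ?thesis .
qed

lemma ip_basis: "finite S \<Longrightarrow> z \<in> S \<Longrightarrow> ip S (basis z) \<psi> = \<psi> z"
  by (simp add: ip_def basis_def)

lemma circuit_state:
  assumes "circuit N S T A" "finite S" "z \<in> S"
  shows "ip S (A x (basis z)) (A x (basis z)) = 1" and "s \<notin> S \<Longrightarrow> A x (basis z) s = 0"
  using orthogonal_on_ip[OF orthogonal_on_circuit[OF assms(1)]]
    orthogonal_on_outside[OF orthogonal_on_circuit[OF assms(1)]] assms(3)
  by (auto simp: ip_basis[OF assms(2,3)]) (auto simp: basis_def)

text \<open>The existential quantifier cannot range over types, so labels are natural numbers and
  the run starts at \<open>0\<close>. \<open>samplerI\<close> admits any label type and any start
  label.\<close>

definition sampler :: "nat \<Rightarrow> nat \<Rightarrow> ((nat \<Rightarrow> bool) \<Rightarrow> 'o pmf) \<Rightarrow> bool" where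
  "sampler N T D \<longleftrightarrow> (\<exists>(S :: nat set) A out. finite S \<and> 0 \<in> S \<and> circuit N S T A \<and>
     (\<forall>x. D x = map_pmf out (measured S (A x (basis 0)))))"

lemma samplerI:
  fixes S :: "'s set"
  assumes S: "finite S" "z \<in> S" and A: "circuit N S T A"
    and D: "\<And>x. D x = map_pmf out (measured S (A x (basis z)))"
  shows "sampler N T D"
proof -
  obtain g :: "'s \<Rightarrow> nat" where g: "inj_on g S"
    using finite_imp_inj_to_nat_seg[OF S(1)] by blast
  define f where "f s = (if s = z then 0 else Suc (g s))" for s
  have f: "inj_on f S" using g by (auto simp: f_def inj_on_def)
  have f0: "f z = 0" by (simp add: f_def)
  have z0: "0 \<in> f ` S" using imageI[OF S(2), of f] by (simp only: f0)
  have "D x = map_pmf (out \<circ> inv_into S f) (measured (f ` S) (relabel S f (A x) (basis 0)))" for x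
  proof -
    let ?\<psi> = "A x (basis z)" and ?\<psi>' = "relabel S f (A x) (basis 0)"
    have st: "ip (f ` S) ?\<psi>' ?\<psi>' = 1"
      by (rule circuit_state(1)[OF circuit_relabel[OF A S(1) f] finite_imageI[OF S(1)] z0])
    have val: "?\<psi>' (f s) = ?\<psi> s" if "s \<in> S" for s
      unfolding relabel_apply[OF f that]
      by (rule orthogonal_on_cong[OF orthogonal_on_circuit[OF A] S(1) _ that])
        (simp add: basis_def f_def)
    have "measured S ?\<psi> = map_pmf (inv_into S f) (measured (f ` S) ?\<psi>')"
    proof (rule pmf_eqI)
      fix s
      have "pmf (map_pmf (inv_into S f) (measured (f ` S) ?\<psi>')) s
          = (\<Sum>t\<in>f ` S \<inter> inv_into S f -` {s}. (?\<psi>' t)\<^sup>2)"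
        by (simp add: pmf_map prob_measured[OF _ st] S(1))
      also have "f ` S \<inter> inv_into S f -` {s} = (if s \<in> S then {f s} else {})"
        by (auto simp: inv_into_f_f[OF f])
      also have "(\<Sum>t\<in>(if s \<in> S then {f s} else {}). (?\<psi>' t)\<^sup>2) = (if s \<in> S then (?\<psi> s)\<^sup>2 else 0)"
        by (simp add: val)
      finally show "pmf (measured S ?\<psi>) s = pmf (map_pmf (inv_into S f) (measured (f ` S) ?\<psi>')) s"
        by (simp add: pmf_measured[OF S(1) circuit_state(1)[OF A S]])
    qed
    then show ?thesis by (simp add: D pmf.map_comp)
  qed
  moreover have "circuit N (f ` S) T (\<lambda>x. relabel S f (A x))"
    by (rule circuit_relabel[OF A S(1) f])
  moreover note z0
  moreover have "finite (f ` S)" using S(1) by simp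
  ultimately show ?thesis
    unfolding sampler_def by (intro exI conjI allI)
qed

lemma sampler_const: "sampler N 0 (\<lambda>_. return_pmf c)"
  by (rule samplerI[OF _ _ circuit_const[OF orthogonal_on_id], where S = "{0::nat}" and z = 0 and out = "\<lambda>_. c"])
    auto

lemma sampler_map:
  assumes "sampler N T D"
  shows "sampler N T (\<lambda>x. map_pmf g (D x))"
proof -
  from assms obtain S :: "nat set" and A out where *: "finite S" "0 \<in> S" "circuit N S T A"
      "\<And>x. D x = map_pmf out (measured S (A x (basis 0)))"
    unfolding sampler_def by blast
  show ?thesis
    by (rule samplerI[OF *(1-3), where out = "g \<circ> out"]) (simp add: *(4) pmf.map_comp)
qed

lemma sampler_mono:
  assumes "sampler N T D" "T \<le> T'"
  shows "sampler N T' D"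
  using assms circuit_mono_queries[OF assms(2)] unfolding sampler_def by blast

lemma sampler_negate:
  assumes "sampler N T D"
  shows "sampler N T (\<lambda>x. D (\<lambda>j. \<not> x j))"
proof -
  from assms obtain S :: "nat set" and A out where *: "finite S" "0 \<in> S" "circuit N S T A"
      "\<And>x. D x = map_pmf out (measured S (A x (basis 0)))"
    unfolding sampler_def by blast
  show ?thesis by (rule samplerI[OF *(1,2) circuit_negate[OF *(3)]]) (simp add: *(4))
qed

lemma sampler_shift:
  assumes "sampler M T D" "k + M \<le> N"
  shows "sampler N T (\<lambda>x. D (\<lambda>j. x (k + j)))"
proof -
  from assms obtain S :: "nat set" and A out where *: "finite S" "0 \<in> S" "circuit M S T A"
      "\<And>x. D x = map_pmf out (measured S (A x (basis 0)))"
    unfolding sampler_def by blast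
  show ?thesis by (rule samplerI[OF *(1,2) circuit_shift[OF *(3) assms(2)]]) (simp add: *(4))
qed

lemma pmf_map_Pair: "pmf (map_pmf (Pair a) q) (a', b) = indicator {a'} a * pmf q b"
proof (cases "a = a'")
  case True
  then show ?thesis using pmf_map_inj'[of "Pair a" q b] by (simp add: inj_on_def)
qed (auto intro: pmf_map_outside)

text \<open>Deferred measurement: the first register keeps the outcome of the first circuit and
  controls the second circuit, and both registers are measured only at the end.\<close>

lemma sampler_bind:
  fixes D :: "(nat \<Rightarrow> bool) \<Rightarrow> 'o pmf" and E :: "'o \<Rightarrow> (nat \<Rightarrow> bool) \<Rightarrow> 'p pmf"
  assumes "sampler N T D" and E: "\<And>a. sampler N T' (E a)"
  shows "sampler N (T + T') (\<lambda>x. bind_pmf (D x) (\<lambda>a. E a x))"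
proof -
  from assms(1) obtain S1 :: "nat set" and A out1 where D: "finite S1" "0 \<in> S1" "circuit N S1 T A"
      "\<And>x. D x = map_pmf out1 (measured S1 (A x (basis 0)))"
    unfolding sampler_def by blast
  define P where "P a S B out \<longleftrightarrow> finite S \<and> 0 \<in> S \<and> circuit N S T' B \<and>
      (\<forall>x. E a x = map_pmf out (measured S (B x (basis 0))))" for a and S :: "nat set" and B out
  have "\<exists>S B out. P a S B out" for a
    using E[of a] unfolding sampler_def P_def .
  then obtain S B out2 where "\<And>a. P a (S a) (B a) (out2 a)"
    by metis
  then have E: "\<And>a. finite (S a)" "\<And>a. 0 \<in> S a" "\<And>a. circuit N (S a) T' (B a)"
      "\<And>a x. E a x = map_pmf (out2 a) (measured (S a) (B a x (basis 0)))"
    unfolding P_def by simp_all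
  \<comment> \<open>The second register needs one label set for all branches. Collecting only over
    the outcomes of labels in \<open>S1\<close> keeps it finite.\<close>
  define S2 where "S2 = insert 0 (\<Union>s\<in>S1. S (out1 s))"
  have S2: "finite S2" "0 \<in> S2" "\<And>s. s \<in> S1 \<Longrightarrow> S (out1 s) \<subseteq> S2"
    by (auto simp: S2_def D(1) E(1))
  define A' where "A' x = relabel (S2 \<times> S1) prod.swap (ctrl S2 (\<lambda>_. A x))" for x
  define B' where "B' x = ctrl S1 (\<lambda>s. B (out1 s) x)" for x
  have Bc: "circuit N S2 T' (B (out1 s))" if "s \<in> S1" for s
    by (rule circuit_mono_labels[OF E(3) S2(1) S2(3)[OF that]])
  have swap: "inj_on prod.swap (S2 \<times> S1)" "prod.swap ` (S2 \<times> S1) = S1 \<times> S2"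
    by (auto simp: image_def)
  have "circuit N (S1 \<times> S2) T A'"
    using circuit_relabel[OF circuit_ctrl[of S2 N S1 T "\<lambda>_. A", OF D(3)] _ swap(1)] D(1) S2(1)
    by (simp add: swap(2) A'_def[abs_def])
  from circuit_comp[OF circuit_ctrl[of S1 N S2 T' "\<lambda>s. B (out1 s)", OF Bc] this,
      where C = "\<lambda>x \<phi>. B' x (A' x \<phi>)"]
  have C: "circuit N (S1 \<times> S2) (T + T') (\<lambda>x \<phi>. B' x (A' x \<phi>))"
    by (simp add: B'_def)
  show ?thesis
  proof (rule samplerI[OF _ _ C, where z = "(0, 0)" and out = "\<lambda>(s1, s2). out2 (out1 s1) s2"])
    fix x
    let ?\<psi>1 = "A x (basis 0)" and ?\<psi>2 = "\<lambda>s1. B (out1 s1) x (basis 0)"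
    let ?\<Psi> = "B' x (A' x (basis (0, 0)))"
    have A': "A' x (basis (0, 0)) (s1, s2) = of_bool (s2 = 0) * ?\<psi>1 s1" if "s1 \<in> S1" "s2 \<in> S2" for s1 s2
    proof -
      have "A' x (basis (0, 0)) (s1, s2) = A x (\<lambda>s. of_bool (s2 = 0) * basis 0 s) s1"
        unfolding A'_def using relabel_apply[OF swap(1), of "(s2, s1)" "ctrl S2 (\<lambda>_. A x)"] that
        by (auto simp: ctrl_def basis_def intro!: arg_cong[of _ _ "\<lambda>\<phi>. A x \<phi> s1"])
      then show ?thesis
        by (simp only: orthogonal_on_scale[OF orthogonal_on_circuit[OF D(3)]])
    qed
    have \<Psi>: "?\<Psi> (s1, s2) = ?\<psi>1 s1 * ?\<psi>2 s1 s2" if "s1 \<in> S1" "s2 \<in> S2" for s1 s2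
    proof -
      have "?\<Psi> (s1, s2) = B (out1 s1) x (\<lambda>s. A' x (basis (0, 0)) (s1, s)) s2"
        using that by (simp add: B'_def ctrl_def)
      also have "\<dots> = B (out1 s1) x (\<lambda>s. ?\<psi>1 s1 * basis 0 s) s2"
        by (rule orthogonal_on_cong[OF orthogonal_on_circuit[OF Bc[OF that(1)]] S2(1) _ that(2)])
          (simp add: A' that(1), simp add: basis_def)
      finally show ?thesis
        by (simp only: orthogonal_on_scale[OF orthogonal_on_circuit[OF Bc[OF that(1)]]])
    qed
    \<comment> \<open>Enlarging the label set does not change the distribution, since the state of
      each branch vanishes outside its own set.\<close>
    have m2: "measured (S (out1 s1)) (?\<psi>2 s1) = measured S2 (?\<psi>2 s1)" if "s1 \<in> S1" for s1
      unfolding measured_def using circuit_state(2)[OF E(3,1,2)] S2(3)[OF that]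
      by (intro arg_cong[of _ _ embed_pmf] ext) auto
    have joint: "measured (S1 \<times> S2) ?\<Psi>
        = bind_pmf (measured S1 ?\<psi>1) (\<lambda>s1. map_pmf (Pair s1) (measured (S (out1 s1)) (?\<psi>2 s1)))"
    proof (rule pmf_eqI, clarify)
      fix s1 s2
      have "pmf (bind_pmf (measured S1 ?\<psi>1) (\<lambda>s1. map_pmf (Pair s1) (measured (S (out1 s1)) (?\<psi>2 s1)))) (s1, s2)
         = measure_pmf.expectation (measured S1 ?\<psi>1)
             (\<lambda>s. pmf (measured (S (out1 s1)) (?\<psi>2 s1)) s2 * indicator {s1} s)"
        unfolding pmf_bind pmf_map_Pair
        by (rule arg_cong[of _ _ "measure_pmf.expectation _"]) (auto simp: fun_eq_iff indicator_def)
      also have "\<dots> = pmf (measured S1 ?\<psi>1) s1 * pmf (measured (S (out1 s1)) (?\<psi>2 s1)) s2"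
        by (simp add: measure_pmf_single mult.commute)
      also have "\<dots> = pmf (measured (S1 \<times> S2) ?\<Psi>) (s1, s2)"
        using circuit_state(1)[OF Bc, of s1 0 x] circuit_state(1)[OF C, of "(0, 0)" x] S2(1,2) D(1,2)
          circuit_state(1)[OF D(3,1,2)]
        by (auto simp: pmf_measured m2 \<Psi> power_mult_distrib)
      finally show "pmf (measured (S1 \<times> S2) ?\<Psi>) (s1, s2) = pmf (bind_pmf (measured S1 ?\<psi>1)
          (\<lambda>s1. map_pmf (Pair s1) (measured (S (out1 s1)) (?\<psi>2 s1)))) (s1, s2)" by simp
    qed
    show "bind_pmf (D x) (\<lambda>a. E a x) = map_pmf (\<lambda>(s1, s2). out2 (out1 s1) s2) (measured (S1 \<times> S2) ?\<Psi>)"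
      by (simp add: joint D(4) E(4) map_bind_pmf bind_map_pmf pmf.map_comp o_def)
  qed (use D S2 in auto)
qed

lemma sampler_uniform:
  fixes n :: nat
  assumes "n > 0"
  shows "sampler N 0 (\<lambda>_. pmf_of_set {..<n})"
proof -
  let ?S = "{..<n}"
  define u where "u = (\<lambda>s. if s < n then 1 / sqrt (real n) else 0)"
  define U where "U = householder ?S (\<lambda>s. basis 0 s - u s)"
  have uu: "ip ?S u u = 1"
    using assms by (simp add: ip_def u_def)
  have U: "U (basis 0) = u"
    unfolding U_def using assms
    by (intro householder_swap) (auto simp: uu ip_basis, auto simp: basis_def u_def)
  have "pmf_of_set ?S = measured ?S u"
    using assms by (intro pmf_eqI, subst pmf_measured[OF _ uu]) (simp_all add: u_def power_divide indicator_def lessThan_empty_iff)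
  then show ?thesis
    using assms
    by (intro samplerI[OF _ _ circuit_const[OF orthogonal_on_householder[of ?S "\<lambda>s. basis 0 s - u s"]], where z = 0 and out = id])
      (auto simp: U[unfolded U_def])
qed

text \<open>The Deutsch trick on two labels: \<open>H\<close> takes label \<open>0\<close> to the
  uniform state, the query changes the sign of label \<open>1\<close> exactly if \<open>x j\<close>,
  and \<open>H\<close> leads back to label \<open>0\<close> or to a state orthogonal to it. The
  answer is therefore free of error.\<close>

lemma sampler_query:
  assumes "j < N"
  shows "sampler N 1 (\<lambda>x. return_pmf (x j))"
proof -
  let ?S = "{0, 1 :: nat}"
  define h where "h = (\<lambda>s. if s \<in> ?S then 1 / sqrt 2 else 0)"
  define H where "H = householder ?S (\<lambda>s. basis 0 s - h s)"
  define q where "q s = (if s = Suc 0 then j else N)" for s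
  define A where "A x \<phi> = H (phase N q x (H \<phi>))" for x \<phi>
  have H: "orthogonal_on ?S H" unfolding H_def by (rule orthogonal_on_householder) simp
  have HH: "H (H \<phi>) = \<phi>" for \<phi> unfolding H_def by (rule householder_involutive) simp
  have H0: "H (basis 0) = h"
    unfolding H_def by (rule householder_swap) (auto simp: ip_def h_def basis_def)
  have A: "circuit N ?S (Suc 0) A"
    by (rule circuit_Suc[OF circuit_const[OF H] H, where q = q]) (auto simp: q_def A_def)
  have st: "ip ?S (A x (basis 0)) (A x (basis 0)) = 1" for x
    by (rule circuit_state(1)[OF A]) auto
  have A1: "A x (basis 0) = basis 0" if "\<not> x j" for x
  proof -
    have "phase N q x h = h" using that by (auto simp: phase_def flip_def q_def)
    then show ?thesis using HH by (simp add: A_def H0[symmetric])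
  qed
  have A2: "A x (basis 0) 0 = 0" if "x j" for x
  proof -
    have "ip ?S h (phase N q x h) = 0"
      using that assms by (simp add: ip_def phase_def flip_def q_def h_def)
    then have "ip ?S (H (basis (0::nat))) (H (A x (basis 0))) = 0"
      by (simp add: A_def HH H0)
    then show ?thesis unfolding orthogonal_on_ip[OF H] by (simp add: ip_basis)
  qed
  have "return_pmf (x j) = map_pmf (\<lambda>s. s = Suc 0) (measured ?S (A x (basis 0)))" for x
  proof -
    have "map_pmf (\<lambda>s. s = Suc 0) (measured ?S (A x (basis 0))) = map_pmf (\<lambda>_. x j) (measured ?S (A x (basis 0)))"
    proof (rule map_pmf_cong[OF refl])
      fix s
      assume "s \<in> set_pmf (measured ?S (A x (basis 0)))"
      then have "s \<in> ?S" and *: "A x (basis 0) s \<noteq> 0"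
        using pmf_measured[OF _ st, of x s] by (auto simp: set_pmf_iff split: if_splits)
      show "(s = Suc 0) = x j"
      proof (cases "x j")
        case True
        then show ?thesis using A2 * \<open>s \<in> ?S\<close> by auto
      next
        case False
        then show ?thesis using A1 * \<open>s \<in> ?S\<close> by (auto simp: basis_def)
      qed
    qed
    then show ?thesis by simp
  qed
  then show ?thesis
    unfolding One_nat_def by (intro samplerI[OF _ _ A]) auto
qed

text \<open>One round of amplitude amplification: run \<open>A\<close>, flip the good labels, and
  reflect along the state \<open>A x (basis 0)\<close> by conjugating a flip of label
  \<open>0\<close>. All amplitudes inside \<open>G\<close> are multiplied by the same number, so
  relative probabilities within \<open>G\<close> are preserved; three runs of \<open>A\<close> or
  its inverse are used.\<close>

lemma sampler_amplify:
  assumes "sampler N T D"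
  obtains D' where "sampler N (3 * T) D'"
    and "\<And>x X. X \<subseteq> G \<Longrightarrow> measure (measure_pmf (D' x)) X
           = (3 - 4 * measure (measure_pmf (D x)) G)\<^sup>2 * measure (measure_pmf (D x)) X"
proof -
  from assms obtain S :: "nat set" and A out where *: "finite S" "0 \<in> S" "circuit N S T A"
      "\<And>x. D x = map_pmf out (measured S (A x (basis 0)))"
    unfolding sampler_def by blast
  define F where "F = S \<inter> out -` G"
  define C where "C x \<phi> = A x (flip {0} (inv (A x) (flip F (A x \<phi>))))" for x \<phi>
  have "circuit N S T (\<lambda>x \<phi>. flip F (A x \<phi>))"
    by (rule circuit_append[OF *(3) orthogonal_on_flip]) (auto simp: F_def)
  moreover have "circuit N S T (\<lambda>x \<phi>. flip {0} (inv (A x) \<phi>))"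
    by (rule circuit_append[OF circuit_inv[OF *(3)] orthogonal_on_flip]) (auto simp: *(2))
  ultimately have "circuit N S (T + T) (\<lambda>x \<phi>. flip {0} (inv (A x) (flip F (A x \<phi>))))"
    by (simp add: circuit_comp[where A = "\<lambda>x \<phi>. flip F (A x \<phi>)" and B = "\<lambda>x \<phi>. flip {0} (inv (A x) \<phi>)"])
  then have "circuit N S (T + T + T) C"
    by (rule circuit_comp[OF *(3)]) (simp add: C_def)
  moreover have "T + T + T = 3 * T" by simp
  ultimately have C: "circuit N S (3 * T) C" by metis
  show ?thesis
  proof (rule that)
    show "sampler N (3 * T) (\<lambda>x. map_pmf out (measured S (C x (basis 0))))"
      by (rule samplerI[OF *(1,2) C]) simp
    fix x X
    assume X: "X \<subseteq> G"
    let ?\<psi> = "A x (basis 0)"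
    define p where "p = measure (D x) G"
    note st = circuit_state(1)[OF *(3,1,2)] and st' = circuit_state(1)[OF C *(1,2)]
    note O = orthogonal_on_circuit[OF *(3), of x]
    have p: "p = (\<Sum>s\<in>F. (?\<psi> s)\<^sup>2)"
      by (simp add: p_def *(4) prob_measured[OF *(1) st] F_def)
    have "ip S ?\<psi> (flip F ?\<psi>) = (\<Sum>s\<in>S. (?\<psi> s)\<^sup>2 - (if s \<in> F then 2 * (?\<psi> s)\<^sup>2 else 0))"
      unfolding ip_def by (intro sum.cong) (auto simp: flip_def power2_eq_square)
    also have "\<dots> = ip S ?\<psi> ?\<psi> - (\<Sum>s\<in>S \<inter> F. 2 * (?\<psi> s)\<^sup>2)"
      by (simp add: sum_subtractf ip_def sum.inter_restrict[OF *(1)] flip: power2_eq_square)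
    also have "S \<inter> F = F" by (auto simp: F_def)
    finally have ipF: "ip S ?\<psi> (flip F ?\<psi>) = 1 - 2 * p"
      by (simp add: st p sum_distrib_left)
    define w where "w = inv (A x) (flip F ?\<psi>)"
    have w0: "w 0 = 1 - 2 * p"
    proof -
      have "w 0 = ip S (basis 0) w" by (simp add: ip_basis *(1,2))
      also have "\<dots> = ip S ?\<psi> (A x w)" by (simp add: orthogonal_on_ip[OF O])
      finally show ?thesis by (simp add: w_def orthogonal_on_inv_right[OF O] ipF)
    qed
    \<comment> \<open>Flipping label \<open>0\<close> subtracts twice its component;
      \<open>A x\<close> carries this to a subtraction along \<open>?\<psi>\<close>. On good labels
      the amplitude becomes \<open>- (3 - 4 * p)\<close> times the old one.\<close>
    have "flip {0} w = (\<lambda>s. w s - (2 * w 0) * basis 0 s)"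
      by (auto simp: flip_def basis_def)
    then have "C x (basis 0) = (\<lambda>s. flip F ?\<psi> s - 2 * (1 - 2 * p) * ?\<psi> s)"
      by (simp only: C_def w_def[symmetric] orthogonal_on_diff[OF O])
        (simp only: w_def orthogonal_on_inv_right[OF O] w0[unfolded w_def])
    then have val: "(C x (basis 0) s)\<^sup>2 = (3 - 4 * p)\<^sup>2 * (?\<psi> s)\<^sup>2" if "s \<in> F" for s
      using that by (simp add: flip_def power2_eq_square algebra_simps)
    have "measure (map_pmf out (measured S (C x (basis 0)))) X = (\<Sum>s\<in>S \<inter> out -` X. (C x (basis 0) s)\<^sup>2)"
      by (simp add: prob_measured[OF *(1) st'])
    also have "\<dots> = (\<Sum>s\<in>S \<inter> out -` X. (3 - 4 * p)\<^sup>2 * (?\<psi> s)\<^sup>2)"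
      using X by (intro sum.cong val) (auto simp: F_def)
    also have "\<dots> = (3 - 4 * p)\<^sup>2 * measure (D x) X"
      by (simp add: *(4) prob_measured[OF *(1) st] sum_distrib_left)
    finally show "measure (map_pmf out (measured S (C x (basis 0)))) X
        = (3 - 4 * measure (D x) G)\<^sup>2 * measure (D x) X"
      by (simp add: p_def)
  qed
qed

section \<open>Realization with the query gate\<close>

lemma orthogonal_on_expand:
  assumes U: "orthogonal_on S U" and S: "finite S" "s \<in> S"
  shows "U \<phi> s = (\<Sum>c\<in>S. \<phi> c * U (basis c) s)"
proof -
  have "U (\<lambda>s. \<Sum>c\<in>F. \<phi> c * basis c s) = (\<lambda>s. \<Sum>c\<in>F. \<phi> c * U (basis c) s)" if "finite F" for F
    using that
  proof induction
    case (insert c F)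
    then show ?case
      using orthogonal_on_linear[OF U, of "\<phi> c" "basis c" 1 "\<lambda>s. \<Sum>c\<in>F. \<phi> c * basis c s"] by simp
  qed (simp add: orthogonal_on_zero[OF U])
  from fun_cong[OF this[OF S(1)], of s]
  have "U (\<lambda>s. \<Sum>c\<in>S. \<phi> c * basis c s) s = (\<Sum>c\<in>S. \<phi> c * U (basis c) s)" .
  moreover have "U \<phi> s = U (\<lambda>s. \<Sum>c\<in>S. \<phi> c * basis c s) s"
    by (rule orthogonal_on_cong[OF U S(1) _ S(2)]) (simp add: basis_def S(1) if_distrib cong: if_cong)
  ultimately show ?thesis by simp
qed

definition opmat :: "nat \<Rightarrow> ((nat \<Rightarrow> real) \<Rightarrow> nat \<Rightarrow> real) \<Rightarrow> complex mat" where
  "opmat D U = mat D D (\<lambda>(r, c). complex_of_real (U (basis c) r))"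

definition cvec :: "nat \<Rightarrow> (nat \<Rightarrow> real) \<Rightarrow> complex Matrix.vec" where
  "cvec D \<phi> = Matrix.vec D (\<lambda>k. complex_of_real (\<phi> k))"

lemma opmat_carrier [simp]: "opmat D U \<in> carrier_mat D D"
  by (simp add: opmat_def)

lemma opmat_mult_cvec:
  assumes "orthogonal_on {..<D} U"
  shows "opmat D U *\<^sub>v cvec D \<phi> = cvec D (U \<phi>)"
proof (rule eq_vecI)
  fix r assume "r < dim_vec (cvec D (U \<phi>))"
  then have r: "r < D" by (simp add: cvec_def)
  have "(opmat D U *\<^sub>v cvec D \<phi>) $ r = (\<Sum>c = 0..<D. complex_of_real (U (basis c) r * \<phi> c))"
    using r by (simp add: opmat_def cvec_def scalar_prod_def)
  also have "\<dots> = complex_of_real (U \<phi> r)"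
    using r by (subst orthogonal_on_expand[OF assms, of r \<phi>]) (auto simp: atLeast0LessThan mult.commute)
  finally show "(opmat D U *\<^sub>v cvec D \<phi>) $ r = cvec D (U \<phi>) $ r"
    using r by (simp add: cvec_def)
qed (simp add: opmat_def cvec_def)

lemma unitary_opmat:
  assumes U: "orthogonal_on {..<D} U"
  shows "unitary D (opmat D U)"
  unfolding unitary_def
proof (intro conjI eq_matI)
  fix i j assume "i < dim_row (1\<^sub>m D :: complex mat)" "j < dim_col (1\<^sub>m D :: complex mat)"
  then have ij: "i < D" "j < D" by simp_all
  have "(mat_adjoint (opmat D U) * opmat D U) $$ (i, j)
      = (\<Sum>r = 0..<D. complex_of_real (U (basis i) r * U (basis j) r))"
    using ij by (simp add: mat_adjoint_def opmat_def scalar_prod_def mat_of_rows_def)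
  also have "\<dots> = complex_of_real (ip {..<D} (U (basis i)) (U (basis j)))"
    by (simp add: ip_def atLeast0LessThan)
  also have "\<dots> = 1\<^sub>m D $$ (i, j)"
    using ij by (simp add: orthogonal_on_ip[OF U] ip_basis) (simp add: basis_def)
  finally show "(mat_adjoint (opmat D U) * opmat D U) $$ (i, j) = 1\<^sub>m D $$ (i, j)" .
qed (simp_all add: mat_adjoint_def opmat_def)

lemma unitary_mult:
  assumes "unitary D A" "unitary D B"
  shows "unitary D (A * B)"
proof -
  have A: "A \<in> carrier_mat D D" "mat_adjoint A * A = 1\<^sub>m D" and B: "B \<in> carrier_mat D D" "mat_adjoint B * B = 1\<^sub>m D"
    using assms by (auto simp: unitary_def)
  have A': "mat_adjoint A \<in> carrier_mat D D" and B': "mat_adjoint B \<in> carrier_mat D D"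
    using A(1) B(1) by (auto simp: mat_adjoint_def)
  have "mat_adjoint (A * B) = mat_adjoint B * mat_adjoint A"
  proof (rule eq_matI)
    fix i j assume "i < dim_row (mat_adjoint B * mat_adjoint A)" "j < dim_col (mat_adjoint B * mat_adjoint A)"
    then have "i < D" "j < D" using A' B' by simp_all
    then show "mat_adjoint (A * B) $$ (i, j) = (mat_adjoint B * mat_adjoint A) $$ (i, j)"
      using A(1) B(1) by (auto simp: mat_adjoint_def mat_of_rows_def scalar_prod_def mult.commute intro!: sum.cong)
  qed (use A A' B B' in \<open>auto simp: mat_adjoint_def\<close>)
  then have "mat_adjoint (A * B) * (A * B) = mat_adjoint B * (mat_adjoint A * A * B)"
    using A(1) B(1) A' B' by (simp add: assoc_mult_mat[of _ D D _ D _ D])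
  then show ?thesis
    using A B by (simp add: unitary_def)
qed

definition embed :: "nat \<Rightarrow> (nat \<Rightarrow> real) \<Rightarrow> nat \<Rightarrow> real" where
  "embed m \<phi> k = (if k < m then \<phi> k else 0)"

text \<open>
  The phase query on \<open>|w\<rangle>\<close> is the standard query on \<open>|q w, -, w\<rangle>\<close>; a state that makes no query
  is sent to \<open>|0, +, w\<rangle>\<close>, which the query gate fixes.
\<close>

definition kickback :: "nat \<Rightarrow> (nat \<Rightarrow> nat) \<Rightarrow> nat \<Rightarrow> nat \<Rightarrow> real" where
  "kickback N q w a = (if q w < N then (if a = 2 * q w then 1 / sqrt 2 else if a = Suc (2 * q w) then - 1 / sqrt 2 else 0)
     else if a < 2 then 1 / sqrt 2 else 0)"

text \<open>Here \<open>a\<close> stands for \<open>2 * j + b\<close>, so \<open>a * m + w\<close>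
  is \<open>basis_index m j b w\<close>. For \<open>N > 0\<close> the reflection at each
  \<open>w\<close> exchanges query register \<open>0\<close> with the kickback state; the same map
  thus creates and removes that state.\<close>

definition prepare :: "nat \<Rightarrow> nat \<Rightarrow> (nat \<Rightarrow> nat) \<Rightarrow> (nat \<Rightarrow> real) \<Rightarrow> nat \<Rightarrow> real" where
  "prepare N m q = relabel ({..<m} \<times> {..<2 * N}) (\<lambda>(w, a). a * m + w)
     (ctrl {..<m} (\<lambda>w. householder {..<2 * N} (\<lambda>a. basis 0 a - kickback N q w a)))"

definition lift_op :: "nat \<Rightarrow> nat \<Rightarrow> ((nat \<Rightarrow> real) \<Rightarrow> nat \<Rightarrow> real) \<Rightarrow> (nat \<Rightarrow> real) \<Rightarrow> nat \<Rightarrow> real" where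
  "lift_op N m U = relabel ({..<2 * N} \<times> {..<m}) (\<lambda>(a, w). a * m + w) (ctrl {..<2 * N} (\<lambda>_. U))"

lemma inj_on_pair_index: "inj_on (\<lambda>(a, w). a * m + w) (A \<times> {..<m :: nat})"
proof (rule inj_onI, clarify)
  fix a w a' w' assume w: "w < m" "w' < m" and eq: "a * m + w = a' * m + w'"
  have "m > 0" using w by linarith
  then have "(a * m + w) div m = a" "(a' * m + w') div m = a'" using w by simp_all
  then have "a = a'" by (simp only: eq)
  with eq show "a = a' \<and> w = w'" by simp
qed

lemma inj_on_pair_index_swap: "inj_on (\<lambda>(w, a). a * m + w) ({..<m :: nat} \<times> A)"
  using inj_on_pair_index[of m A] by (auto simp: inj_on_def)

lemma pair_index_less: "a < M \<Longrightarrow> w < m \<Longrightarrow> a * m + w < M * (m::nat)"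
  using mult_le_mono1[of "Suc a" M m] by simp

lemma pair_index_image: "(\<lambda>(a, w). a * m + w) ` ({..<M} \<times> {..<m :: nat}) = {..<M * m}"
proof (intro equalityI subsetI)
  fix k assume "k \<in> {..<M * m}"
  then have k: "k < M * m" by simp
  then have "m > 0" by (cases m) auto
  then show "k \<in> (\<lambda>(a, w). a * m + w) ` ({..<M} \<times> {..<m})"
    using k by (intro image_eqI[of _ _ "(k div m, k mod m)"]) (auto simp: less_mult_imp_div_less)
qed (auto simp: pair_index_less)

lemma pair_index_image_swap: "(\<lambda>(w, a). a * m + w) ` ({..<m :: nat} \<times> {..<M}) = {..<M * m}"
proof -
  have "(\<lambda>(w, a). a * m + w) ` ({..<m} \<times> {..<M}) = (\<lambda>(a, w). a * m + w) ` ({..<M} \<times> {..<m})"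
    by force
  then show ?thesis by (simp add: pair_index_image)
qed

lemma orthogonal_on_prepare: "orthogonal_on {..<2 * N * m} (prepare N m q)"
  unfolding prepare_def pair_index_image_swap[of m "2 * N", symmetric]
  by (rule orthogonal_on_relabel[OF _ inj_on_pair_index_swap orthogonal_on_ctrl[OF orthogonal_on_householder]]) auto

lemma orthogonal_on_lift_op: "orthogonal_on {..<m} U \<Longrightarrow> orthogonal_on {..<2 * N * m} (lift_op N m U)"
  unfolding lift_op_def pair_index_image[of m "2 * N", symmetric]
  by (rule orthogonal_on_relabel[OF _ inj_on_pair_index orthogonal_on_ctrl]) auto

lemma householder_kickback:
  assumes "N > 0"
  shows "householder {..<2 * N} (\<lambda>a. basis 0 a - kickback N q w a) (basis 0) = kickback N q w"
proof (rule householder_swap)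
  have eq: "kickback N q w a * kickback N q w a = (if q w < N then (if a = 2 * q w then 1 / 2 else 0)
      + (if a = Suc (2 * q w) then 1 / 2 else 0) else (if a = 0 then 1 / 2 else 0) + (if a = Suc 0 then 1 / 2 else 0))" for a
    by (auto simp: kickback_def)
  have "ip {..<2 * N} (kickback N q w) (kickback N q w) = 1"
    unfolding ip_def eq using assms by (cases "q w < N") (auto simp: sum.distrib)
  then show "ip {..<2 * N} (basis 0) (basis 0) = ip {..<2 * N} (kickback N q w) (kickback N q w)"
    using assms by (simp add: ip_basis) (simp add: basis_def)
qed (use assms in \<open>auto simp: basis_def kickback_def\<close>)

lemma householder_scale: "householder S v (\<lambda>s. c * \<phi> s) = (\<lambda>s. c * householder S v \<phi> s)"
proof -
  have "ip S v (\<lambda>s. c * \<phi> s) = c * ip S v \<phi>" by (simp add: ip_def sum_distrib_left algebra_simps)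
  then show ?thesis by (simp add: householder_def algebra_simps)
qed

lemma prepare_apply:
  assumes "w < m" "a < 2 * N"
  shows "prepare N m q \<phi> (a * m + w)
    = householder {..<2 * N} (\<lambda>a. basis 0 a - kickback N q w a) (\<lambda>a. \<phi> (a * m + w)) a"
  using relabel_apply[OF inj_on_pair_index_swap, of "(w, a)" m "{..<2 * N}"] assms
  by (simp add: prepare_def ctrl_def o_def)

lemma embed_index: "w < m \<Longrightarrow> embed m \<phi> (a * m + w) = \<phi> w * basis 0 a"
  by (cases a) (auto simp: embed_def basis_def)

lemma prepare_embed:
  assumes "N > 0" "w < m" "a < 2 * N"
  shows "prepare N m q (embed m \<phi>) (a * m + w) = \<phi> w * kickback N q w a"
  by (simp only: prepare_apply[OF assms(2,3)] embed_index[OF assms(2)] householder_scale householder_kickback[OF assms(1)])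

lemma prepare_kickback:
  assumes N: "N > 0" and "w < m" "a < 2 * N"
    and \<psi>: "\<And>w a. w < m \<Longrightarrow> a < 2 * N \<Longrightarrow> \<psi> (a * m + w) = \<phi> w * kickback N q w a"
  shows "prepare N m q \<psi> (a * m + w) = embed m \<phi> (a * m + w)"
proof -
  let ?h = "householder {..<2 * N} (\<lambda>a. basis 0 a - kickback N q w a)"
  have "prepare N m q \<psi> (a * m + w) = ?h (\<lambda>a. \<psi> (a * m + w)) a"
    by (rule prepare_apply[OF assms(2,3)])
  also have "\<dots> = ?h (\<lambda>a. \<phi> w * kickback N q w a) a"
    by (rule orthogonal_on_cong[OF orthogonal_on_householder]) (use assms in auto)
  also have "\<dots> = \<phi> w * ?h (kickback N q w) a"
    by (simp only: householder_scale)
  also have "?h (kickback N q w) = basis 0"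
    using householder_involutive[of "{..<2 * N}" _ "basis 0"] householder_kickback[OF N] by (metis finite_lessThan)
  finally show ?thesis by (simp add: embed_index[OF assms(2)])
qed

lemma lift_op_embed:
  assumes U: "orthogonal_on {..<m} U" and "w < m" "a < 2 * N"
  shows "lift_op N m U (embed m \<phi>) (a * m + w) = embed m (U \<phi>) (a * m + w)"
proof -
  have "lift_op N m U (embed m \<phi>) (a * m + w) = U (\<lambda>w. embed m \<phi> (a * m + w)) w"
    using relabel_apply[OF inj_on_pair_index, of "(a, w)" "{..<2 * N}" m] assms
    by (simp add: lift_op_def ctrl_def o_def)
  also have "\<dots> = U (\<lambda>w. basis 0 a * \<phi> w) w"
    by (rule orthogonal_on_cong[OF U]) (auto simp: embed_index assms)
  also have "\<dots> = basis 0 a * U \<phi> w"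
    by (simp only: orthogonal_on_scale[OF U])
  finally show ?thesis by (simp add: embed_index assms)
qed

lemma cvec_cong:
  assumes "\<And>a w. a < M \<Longrightarrow> w < m \<Longrightarrow> \<phi> (a * m + w) = \<psi> (a * m + w)"
  shows "cvec (M * m) \<phi> = cvec (M * m) \<psi>"
proof -
  have "\<phi> k = \<psi> k" if "k < M * m" for k
    using assms[of "k div m" "k mod m"] that by (cases "m = 0") (auto simp: less_mult_imp_div_less)
  then show ?thesis by (auto simp: cvec_def)
qed

lemma query_gate_mult:
  assumes "a < 2 * N" "w < m"
  shows "(query_gate N m x *\<^sub>v cvec (2 * N * m) \<phi>) $ (a * m + w)
    = complex_of_real (\<phi> ((2 * (a div 2) + of_bool (odd a \<noteq> x (a div 2))) * m + w))"
proof -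
  \<comment> \<open>The only column with a nonzero entry in this row: the gate is an involution, so
    adding \<open>x j\<close> to the bit once more gives the preimage.\<close>
  define c0 where "c0 = (2 * (a div 2) + of_bool (odd a \<noteq> x (a div 2))) * m + w"
  have c0: "c0 < 2 * N * m"
    unfolding c0_def using assms by (intro pair_index_less) (auto simp: less_mult_imp_div_less)
  have a: "2 * (a div 2) + of_bool ((odd a \<noteq> x (a div 2)) \<noteq> x (a div 2)) = a"
    by (cases "even a"; cases "x (a div 2)") auto
  have r: "a * m + w < 2 * N * m" using assms by (intro pair_index_less)
  have iff: "(\<exists>j<N. \<exists>b. \<exists>w'<m. c = basis_index m j b w' \<and> a * m + w = basis_index m j (b \<noteq> x j) w') \<longleftrightarrow> c = c0" for c
  proof
    assume "\<exists>j<N. \<exists>b. \<exists>w'<m. c = basis_index m j b w' \<and> a * m + w = basis_index m j (b \<noteq> x j) w'"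
    then obtain j b w' where *: "w' < m" "c = basis_index m j b w'" "a * m + w = basis_index m j (b \<noteq> x j) w'"
      by blast
    then have "a = 2 * j + of_bool (b \<noteq> x j)" "w = w'"
      using assms(2) inj_onD[OF inj_on_pair_index[of m UNIV], of "(a, w)" "(2 * j + of_bool (b \<noteq> x j), w')"]
      by (auto simp: basis_index_def)
    then show "c = c0"
      using * by (auto simp: c0_def basis_index_def)
  next
    assume "c = c0"
    then show "\<exists>j<N. \<exists>b. \<exists>w'<m. c = basis_index m j b w' \<and> a * m + w = basis_index m j (b \<noteq> x j) w'"
      using assms a by (intro exI[of _ "a div 2"] exI[of _ "odd a \<noteq> x (a div 2)"] exI[of _ w] conjI)
        (simp_all add: c0_def basis_index_def less_mult_imp_div_less)
  qed
  have entry: "query_gate N m x $$ (a * m + w, c) = of_bool (c = c0)" if "c < 2 * N * m" for c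
    unfolding query_gate_def using r that by (simp only: index_mat(1) prod.case iff)
  have dim: "dim_row (query_gate N m x) = 2 * N * m" "dim_col (query_gate N m x) = 2 * N * m"
    by (simp_all add: query_gate_def)
  have "(query_gate N m x *\<^sub>v cvec (2 * N * m) \<phi>) $ (a * m + w)
      = (\<Sum>c = 0..<2 * N * m. of_bool (c = c0) * complex_of_real (\<phi> c))"
    using r by (simp add: cvec_def scalar_prod_def dim entry)
  also have "\<dots> = (\<Sum>c = 0..<2 * N * m. if c = c0 then complex_of_real (\<phi> c) else 0)"
    by (intro sum.cong) auto
  also have "\<dots> = complex_of_real (\<phi> c0)" using c0 by simp
  finally show ?thesis by (simp add: c0_def)
qed

text \<open>For \<open>q w < N\<close> the gate swaps two opposite amplitudes exactly if
  \<open>x (q w)\<close>, which is a change of sign. Otherwise it permutes two equal amplitudes at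
  index \<open>0\<close> and changes nothing.\<close>

lemma query_gate_kickback:
  assumes "N > 0"
    and \<psi>: "\<And>w a. w < m \<Longrightarrow> a < 2 * N \<Longrightarrow> \<psi> (a * m + w) = \<phi> w * kickback N q w a"
    and \<psi>': "\<And>w a. w < m \<Longrightarrow> a < 2 * N \<Longrightarrow> \<psi>' (a * m + w) = phase N q x \<phi> w * kickback N q w a"
  shows "query_gate N m x *\<^sub>v cvec (2 * N * m) \<psi> = cvec (2 * N * m) \<psi>'"
proof (rule eq_vecI)
  fix k assume "k < dim_vec (cvec (2 * N * m) \<psi>')"
  then have k: "k < 2 * N * m" by (simp add: cvec_def)
  define a w where "a = k div m" and "w = k mod m"
  have aw: "k = a * m + w" "a < 2 * N" "w < m"
    using k by (cases "m = 0"; auto simp: a_def w_def less_mult_imp_div_less)+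
  define a' where "a' = 2 * (a div 2) + of_bool (odd a \<noteq> x (a div 2))"
  have a': "a' < 2 * N" using aw(2) by (auto simp: a'_def less_mult_imp_div_less)
  have "kickback N q w a' * \<phi> w = phase N q x \<phi> w * kickback N q w a"
  proof (cases "odd a")
    case True
    then obtain j where "a = 2 * j + 1" by (elim oddE)
    then show ?thesis by (auto simp: a'_def kickback_def phase_def flip_def; presburger)
  next
    case False
    then have "even a" by simp
    then obtain j where "a = 2 * j" by (elim evenE)
    then show ?thesis by (auto simp: a'_def kickback_def phase_def flip_def; presburger)
  qed
  then show "(query_gate N m x *\<^sub>v cvec (2 * N * m) \<psi>) $ k = cvec (2 * N * m) \<psi>' $ k"
    using k unfolding aw(1) query_gate_mult[OF aw(2,3)] a'_def[symmetric] \<psi>[OF aw(3) a']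
    by (simp add: cvec_def \<psi>'[OF aw(3,2)] mult.commute flip: of_real_mult)
qed (simp add: query_gate_def cvec_def)

lemma final_state_cong: "(\<And>t. t \<le> T \<Longrightarrow> U t = V t) \<Longrightarrow> final_state N m U x T = final_state N m V x T"
  by (induction T) auto

text \<open>Lets a further unitary be applied to the final state by merging it into the last step,
  without an additional query.\<close>

lemma final_state_update:
  assumes "unitary (2 * N * m) V" "unitary (2 * N * m) (U T)"
  shows "final_state N m (U(T := V * U T)) x T = V *\<^sub>v final_state N m U x T"
proof -
  have c: "V \<in> carrier_mat (2 * N * m) (2 * N * m)" "U T \<in> carrier_mat (2 * N * m) (2 * N * m)"
    using assms by (simp_all add: unitary_def)
  show ?thesis
  proof (cases T)
    case 0
    then show ?thesis
      using assoc_mult_mat_vec[OF c unit_vec_carrier] by simp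
  next
    case (Suc t)
    have "final_state N m (U(T := V * U T)) x t = final_state N m U x t"
      by (rule final_state_cong) (simp add: Suc)
    moreover have "query_gate N m x *\<^sub>v final_state N m U x t \<in> carrier_vec (2 * N * m)"
      by (rule carrier_vecI) (simp add: query_gate_def)
    ultimately show ?thesis
      using assoc_mult_mat_vec[OF c] by (simp only: Suc final_state.simps fun_upd_same)
  qed
qed

lemma circuit_realize:
  assumes "circuit N S T A" and S: "S \<subseteq> {..<m}" and N: "N > 0" and m: "m > 0"
  shows "\<exists>U. (\<forall>t\<le>T. unitary (2 * N * m) (U t)) \<and>
    (\<forall>x. final_state N m U x T = cvec (2 * N * m) (embed m (A x (basis 0))))"
  using assms(1)
proof (induction rule: circuit.induct)
  case (circuit_0 U A)
  let ?L = "lift_op N m U"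
  have U: "orthogonal_on {..<m} U"
    by (rule orthogonal_on_mono[OF circuit_0(1) _ S]) simp
  note L = orthogonal_on_lift_op[OF U, of N]
  have "unit_vec (2 * N * m) 0 = cvec (2 * N * m) (embed m (basis 0))"
    using m N by (intro eq_vecI) (auto simp: cvec_def embed_def basis_def unit_vec_def)
  moreover have "cvec (2 * N * m) (?L (embed m (basis 0))) = cvec (2 * N * m) (embed m (U (basis 0)))"
    by (intro cvec_cong lift_op_embed[OF U])
  ultimately show ?case
    by (intro exI[of _ "\<lambda>_. opmat (2 * N * m) ?L"])
      (simp add: unitary_opmat[OF L] opmat_mult_cvec[OF L] circuit_0(2))
next
  case (circuit_Suc T A U q B)
  let ?D = "2 * N * m"
  from circuit_Suc.IH obtain W where W: "\<And>t. t \<le> T \<Longrightarrow> unitary ?D (W t)"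
    "\<And>x. final_state N m W x T = cvec ?D (embed m (A x (basis 0)))" by blast
  have U: "orthogonal_on {..<m} U"
    by (rule orthogonal_on_mono[OF circuit_Suc.hyps(2) _ S]) simp
  note L = orthogonal_on_lift_op[OF U, of N]
  note P = orthogonal_on_prepare[of N m q]
  \<comment> \<open>\<open>prepare\<close> is needed on both sides of the new query; it is merged
    into the unitary before and the unitary after it. One phase query thus costs one query
    gate.\<close>
  define W' where "W' = (W(T := opmat ?D (prepare N m q) * W T))
    (Suc T := opmat ?D (lift_op N m U) * opmat ?D (prepare N m q))"
  have "unitary ?D (W' t)" if "t \<le> Suc T" for t
    using that W(1) by (auto simp: W'_def intro!: unitary_mult unitary_opmat P L)
  moreover have "final_state N m W' x (Suc T) = cvec ?D (embed m (B x (basis 0)))" for x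
  proof -
    let ?\<phi> = "A x (basis 0)"
    let ?\<psi> = "prepare N m q (embed m ?\<phi>)" and ?\<psi>' = "prepare N m q (embed m (phase N q x ?\<phi>))"
    have "final_state N m W' x T = final_state N m (W(T := opmat ?D (prepare N m q) * W T)) x T"
      by (rule final_state_cong) (simp add: W'_def)
    also have "\<dots> = opmat ?D (prepare N m q) *\<^sub>v final_state N m W x T"
      by (rule final_state_update[OF unitary_opmat[OF P] W(1)]) simp
    also have "\<dots> = cvec ?D ?\<psi>"
      by (simp only: W(2) opmat_mult_cvec[OF P])
    finally have W'T: "final_state N m W' x T = cvec ?D ?\<psi>" .
    have "query_gate N m x *\<^sub>v cvec ?D ?\<psi> = cvec ?D ?\<psi>'"
      by (rule query_gate_kickback[OF N, where \<phi> = ?\<phi> and q = q]) (simp_all only: prepare_embed[OF N])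
    then have "final_state N m W' x (Suc T) = W' (Suc T) *\<^sub>v cvec ?D ?\<psi>'"
      by (simp only: final_state.simps W'T)
    also have "\<dots> = opmat ?D (lift_op N m U) *\<^sub>v (opmat ?D (prepare N m q) *\<^sub>v cvec ?D ?\<psi>')"
      unfolding W'_def fun_upd_same
      by (rule assoc_mult_mat_vec[OF opmat_carrier opmat_carrier]) (simp add: cvec_def)
    also have "opmat ?D (prepare N m q) *\<^sub>v cvec ?D ?\<psi>' = cvec ?D (embed m (phase N q x ?\<phi>))"
      unfolding opmat_mult_cvec[OF P]
      by (intro cvec_cong prepare_kickback[OF N] prepare_embed[OF N])
    also have "opmat ?D (lift_op N m U) *\<^sub>v \<dots> = cvec ?D (embed m (B x (basis 0)))"
      unfolding opmat_mult_cvec[OF L] circuit_Suc.hyps(4)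
      by (intro cvec_cong lift_op_embed[OF U])
    finally show ?thesis .
  qed
  ultimately show ?case by blast
qed

lemma sampler_realize:
  assumes "sampler N T D" "N > 0"
  obtains m U out where "m > 0" "\<And>t. t \<le> T \<Longrightarrow> unitary (2 * N * m) (U t)"
    "\<And>x a. output_prob out (final_state N m U x T) a = pmf (D x) a"
proof -
  from assms(1) obtain S :: "nat set" and A out where *: "finite S" "0 \<in> S" "circuit N S T A"
      "\<And>x. D x = map_pmf out (measured S (A x (basis 0)))"
    unfolding sampler_def by blast
  define m where "m = Suc (Max S)"
  have m: "m > 0" "S \<subseteq> {..<m}" using *(1) by (auto simp: m_def less_Suc_eq_le)
  from circuit_realize[OF *(3) m(2) assms(2) m(1)] obtain U where
    U: "\<And>t. t \<le> T \<Longrightarrow> unitary (2 * N * m) (U t)"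
      "\<And>x. final_state N m U x T = cvec (2 * N * m) (embed m (A x (basis 0)))" by blast
  have "output_prob out (final_state N m U x T) a = pmf (D x) a" for x a
  proof -
    let ?\<psi> = "A x (basis 0)"
    have le: "m \<le> 2 * N * m" using assms(2) by simp
    have "output_prob out (final_state N m U x T) a = (\<Sum>k | k < 2 * N * m \<and> out k = a. (embed m ?\<psi> k)\<^sup>2)"
      unfolding output_prob_def U(2) by (rule sum.cong) (auto simp: cvec_def)
    also have "\<dots> = (\<Sum>k\<in>S \<inter> out -` {a}. (?\<psi> k)\<^sup>2)"
      by (rule sum.mono_neutral_cong_right)
        (use m le less_le_trans[OF _ le] circuit_state(2)[OF *(3,1,2)] in \<open>auto simp: embed_def\<close>)
    also have "\<dots> = pmf (D x) a"
      by (simp add: *(4) pmf_map prob_measured[OF *(1) circuit_state(1)[OF *(3,1,2)]])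
    finally show ?thesis .
  qed
  then show ?thesis using that m(1) U(1) by blast
qed

section \<open>Search by amplitude amplification\<close>

lemma prob_bind_pmf:
  "measure_pmf.prob (bind_pmf p f) X = measure_pmf.expectation p (\<lambda>y. measure_pmf.prob (f y) X)"
  using expectation_bounded_bind_pmf[of "indicator X" 1 p f] by (simp add: indicator_def)

text \<open>Writing the success probability as the squared sine of an angle, one amplification round
  triples the angle.\<close>

lemma sin_triple: "(sin (3 * y))\<^sup>2 = (3 - 4 * (sin y)\<^sup>2)\<^sup>2 * (sin y)\<^sup>2" for y :: real
proof -
  have "sin (3 * y) = sin (y + 2 * y)" by simp
  also have "\<dots> = sin y * (1 - 2 * (sin y)\<^sup>2) + cos y * (2 * sin y * cos y)"
    by (simp only: sin_add sin_double cos_double_sin)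
  also have "\<dots> = sin y * (1 - 2 * (sin y)\<^sup>2) + 2 * sin y * (cos y)\<^sup>2"
    by (simp add: power2_eq_square)
  also have "\<dots> = (3 - 4 * (sin y)\<^sup>2) * sin y"
    by (simp only: cos_squared_eq) (simp add: algebra_simps power2_eq_square)
  finally show ?thesis by (simp add: power_mult_distrib)
qed

lemma arcsin_sqrt:
  assumes "0 \<le> p" "p \<le> (1::real)"
  shows "0 \<le> arcsin (sqrt p)" "arcsin (sqrt p) \<le> pi / 2" "sin (arcsin (sqrt p)) = sqrt p"
proof -
  have b: "- 1 \<le> sqrt p" "sqrt p \<le> 1"
    using assms order_trans[of "- 1" 0 "sqrt p"] by simp_all
  show "0 \<le> arcsin (sqrt p)" using assms by (intro arcsin_nonneg) simp
  show "arcsin (sqrt p) \<le> pi / 2" using arcsin_bounded[OF b] by blast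
  show "sin (arcsin (sqrt p)) = sqrt p" by (rule sin_arcsin[OF b])
qed

text \<open>Tripling an angle below \<open>pi / 6\<close> does not lead beyond
  \<open>pi / 2\<close>. The first multiple \<open>3 ^ j * \<theta>\<close> that reaches
  \<open>pi / 6\<close> therefore lies where the sine is at least \<open>1 / 2\<close>.\<close>

lemma amplified_angle:
  fixes p :: real
  assumes p: "0 \<le> p" "p \<le> 1" and n: "n > 0" "1 / (2 * real n) \<le> p" "n \<le> 9 ^ K"
  shows "\<exists>j\<le>K. 1 / 4 \<le> (sin (3 ^ j * arcsin (sqrt p)))\<^sup>2"
proof -
  define \<theta> where "\<theta> = arcsin (sqrt p)"
  have \<theta>: "0 \<le> \<theta>" "\<theta> \<le> pi / 2" "sin \<theta> = sqrt p"
    using arcsin_sqrt[OF p] by (auto simp: \<theta>_def)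
  \<comment> \<open>By \<open>sin y \<le> y\<close> the angle is at least \<open>sqrt p\<close>.
    With \<open>sqrt 2 \<le> 3 / 2\<close> the product is at least \<open>2 / 3\<close>, which
    exceeds \<open>pi / 6\<close> because \<open>pi < 4\<close>.\<close>
  have "pi / 6 \<le> 3 ^ K * \<theta>"
  proof -
    have "1 \<le> sqrt (2 * (9 ^ K * p))"
    proof -
      have "1 \<le> 2 * (real n * p)" using n by (simp add: field_simps)
      also have "\<dots> \<le> 2 * (9 ^ K * p)"
        using n(3) p by (intro mult_left_mono mult_right_mono) (auto simp flip: of_nat_le_iff)
      finally show ?thesis by simp
    qed
    also have "\<dots> = sqrt 2 * (3 ^ K * sqrt p)"
    proof -
      have "sqrt ((9::real) ^ K) = 3 ^ K"
        using real_sqrt_power[of 9 K] by (simp add: real_sqrt_eq_iff)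
      then show ?thesis by (simp add: real_sqrt_mult)
    qed
    also have "\<dots> \<le> 3 / 2 * (3 ^ K * \<theta>)"
    proof (intro mult_mono)
      show "sqrt 2 \<le> 3 / 2" by (rule real_le_lsqrt) (simp_all add: power2_eq_square)
    qed (use sin_x_le_x[OF \<theta>(1)] \<theta>(3) p in auto)
    finally show ?thesis using pi_less_4 by linarith
  qed
  then have ex: "\<exists>j. pi / 6 \<le> 3 ^ j * \<theta>" by blast
  define j where "j = (LEAST j. pi / 6 \<le> 3 ^ j * \<theta>)"
  have j: "pi / 6 \<le> 3 ^ j * \<theta>" unfolding j_def by (rule LeastI_ex[OF ex])
  have "j \<le> K" unfolding j_def by (rule Least_le) fact
  moreover have "3 ^ j * \<theta> \<le> pi / 2"
  proof (cases j)
    case (Suc i)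
    then have "\<not> pi / 6 \<le> 3 ^ i * \<theta>" using not_less_Least[of i "\<lambda>j. pi / 6 \<le> 3 ^ j * \<theta>"] by (simp add: j_def)
    then show ?thesis by (simp add: Suc)
  qed (use \<theta> in simp)
  then have "1 / 2 \<le> sin (3 ^ j * \<theta>)"
    using sin_monotone_2pi_le[of "pi / 6" "3 ^ j * \<theta>"] j pi_gt_zero by (simp add: sin_30)
  then have "(1 / 2)\<^sup>2 \<le> (sin (3 ^ j * \<theta>))\<^sup>2" by (intro power_mono) auto
  ultimately show ?thesis by (auto simp: \<theta>_def power2_eq_square)
qed

abbreviation hits :: "('a \<times> bool) set" where
  "hits \<equiv> {r. snd r}"

text \<open>The exact angle is followed for the set of all hits. For subsets, such as the false
  hits, it suffices that a round multiplies by \<open>(3 - 4 * p)^2\<close>, which is at most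
  \<open>9\<close>.\<close>

lemma sampler_amplify_iter:
  fixes D :: "(nat \<Rightarrow> bool) \<Rightarrow> ('a \<times> bool) pmf"
  assumes "sampler N T D"
  shows "\<exists>D'. sampler N (3 ^ j * T) D' \<and>
    (\<forall>x X. X \<subseteq> hits \<longrightarrow> measure_pmf.prob (D' x) X \<le> 9 ^ j * measure_pmf.prob (D x) X) \<and>
    (\<forall>x. measure_pmf.prob (D' x) hits = (sin (3 ^ j * arcsin (sqrt (measure_pmf.prob (D x) hits))))\<^sup>2)"
proof (induction j)
  case 0
  have "sin (arcsin (sqrt (measure_pmf.prob (D x) hits))) = sqrt (measure_pmf.prob (D x) hits)" for x
    by (rule arcsin_sqrt(3)) simp_all
  then show ?case using assms by (intro exI[of _ D]) simp
next
  case (Suc j)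
  then obtain D1 where D1: "sampler N (3 ^ j * T) D1"
    "\<And>x X. X \<subseteq> hits \<Longrightarrow> measure_pmf.prob (D1 x) X \<le> 9 ^ j * measure_pmf.prob (D x) X"
    "\<And>x. measure_pmf.prob (D1 x) hits = (sin (3 ^ j * arcsin (sqrt (measure_pmf.prob (D x) hits))))\<^sup>2"
    by blast
  obtain D2 where D2: "sampler N (3 * (3 ^ j * T)) D2"
    "\<And>x X. X \<subseteq> hits \<Longrightarrow> measure_pmf.prob (D2 x) X
       = (3 - 4 * measure_pmf.prob (D1 x) hits)\<^sup>2 * measure_pmf.prob (D1 x) X"
    using sampler_amplify[OF D1(1)] by blast
  have "measure_pmf.prob (D2 x) X \<le> 9 ^ Suc j * measure_pmf.prob (D x) X" if "X \<subseteq> hits" for x X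
  proof -
    have "\<bar>3 - 4 * measure_pmf.prob (D1 x) hits\<bar> \<le> 3"
      using measure_pmf.prob_le_1[of "D1 x" hits] measure_nonneg[of "D1 x" hits]
      unfolding abs_le_iff by linarith
    then have "(3 - 4 * measure_pmf.prob (D1 x) hits)\<^sup>2 \<le> 3\<^sup>2"
      by (metis abs_le_square_iff abs_numeral)
    then have "measure_pmf.prob (D2 x) X \<le> 9 * (9 ^ j * measure_pmf.prob (D x) X)"
      unfolding D2(2)[OF that] using D1(2)[OF that, of x] by (intro mult_mono) auto
    then show ?thesis by simp
  qed
  moreover have "measure_pmf.prob (D2 x) hits
      = (sin (3 ^ Suc j * arcsin (sqrt (measure_pmf.prob (D x) hits))))\<^sup>2" for x
    using D2(2)[of hits x] by (simp add: D1(3) mult.assoc sin_triple)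
  ultimately show ?case using D2(1) by (intro exI[of _ D2]) (simp add: mult.assoc)
qed

section \<open>Combining search attempts\<close>

definition retry :: "('a \<times> bool) pmf \<Rightarrow> ('a \<times> bool) pmf \<Rightarrow> ('a \<times> bool) pmf" where
  "retry p q = bind_pmf p (\<lambda>r. if snd r then return_pmf r else q)"

lemma sampler_retry:
  assumes "sampler N T D" "sampler N T' D'"
  shows "sampler N (T + T') (\<lambda>x. retry (D x) (D' x))"
proof -
  have "sampler N (T + T') (\<lambda>x. bind_pmf (D x) (\<lambda>r. (if snd r then (\<lambda>_. return_pmf r) else D') x))"
    by (rule sampler_bind[OF assms(1)]) (simp add: assms(2) sampler_mono[OF sampler_const])
  then show ?thesis by (simp add: retry_def if_distribR)
qed

lemma prob_retry:
  assumes "X \<subseteq> hits"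
  shows "measure_pmf.prob (retry p q) X
    = measure_pmf.prob p X + (1 - measure_pmf.prob p hits) * measure_pmf.prob q X"
proof -
  have "measure_pmf.prob (retry p q) X
      = measure_pmf.expectation p (\<lambda>r. indicator X r + measure_pmf.prob q X * indicator (- hits) r)"
    unfolding retry_def prob_bind_pmf
    by (rule arg_cong[of _ _ "measure_pmf.expectation p"]) (use assms in \<open>auto simp: fun_eq_iff indicator_def\<close>)
  also have "\<dots> = measure_pmf.prob p X + measure_pmf.prob q X * measure_pmf.prob p (- hits)"
  proof -
    have "integrable p (indicator X :: _ \<Rightarrow> real)" "integrable p (\<lambda>r. measure_pmf.prob q X * indicator (- hits) r)"
      by (auto intro!: integrable_bounded_pmf[of _ 1] simp: indicator_def)
    then show ?thesis by (simp add: Bochner_Integration.integral_add)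
  qed
  also have "measure_pmf.prob p (- hits) = 1 - measure_pmf.prob p hits"
    using measure_pmf.prob_compl[of hits p] by (simp add: Compl_eq_Diff_UNIV)
  finally show ?thesis by (simp add: mult.commute)
qed

lemma prob_retry_le:
  assumes "X \<subseteq> hits"
  shows "measure_pmf.prob (retry p q) X \<le> measure_pmf.prob p X + measure_pmf.prob q X"
  unfolding prob_retry[OF assms] by (simp add: mult_left_le_one_le)

lemma prob_retry_miss:
  "1 - measure_pmf.prob (retry p q) hits = (1 - measure_pmf.prob p hits) * (1 - measure_pmf.prob q hits)"
  by (simp add: prob_retry algebra_simps)

text \<open>Keeping the first hit among all iterates misses no more often than the best iterate,
  whichever it is. The probabilities of false hits add up, hence the sum of the factors
  \<open>9 ^ j\<close>.\<close>

lemma sampler_amplify_all: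
  fixes D :: "(nat \<Rightarrow> bool) \<Rightarrow> ('a \<times> bool) pmf"
  assumes D: "sampler N T D"
  shows "\<exists>D'. sampler N ((\<Sum>j<k. 3 ^ j) * T) D' \<and>
    (\<forall>x X. X \<subseteq> hits \<longrightarrow> measure_pmf.prob (D' x) X \<le> (\<Sum>j<k. 9 ^ j) * measure_pmf.prob (D x) X) \<and>
    (\<forall>x. \<forall>j<k. 1 - measure_pmf.prob (D' x) hits
       \<le> 1 - (sin (3 ^ j * arcsin (sqrt (measure_pmf.prob (D x) hits))))\<^sup>2)"
proof (induction k)
  case 0
  \<comment> \<open>Without any attempt the result is a miss; only the flag \<open>False\<close> of
    the pair matters.\<close>
  have "X \<subseteq> hits \<Longrightarrow> measure_pmf.prob (return_pmf (undefined :: 'a, False)) X \<le> 0" for X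
    by (auto simp: indicator_def)
  then show ?case
    using sampler_const by (intro exI[of _ "\<lambda>_. return_pmf (undefined, False)"]) auto
next
  case (Suc k)
  then obtain D1 where D1: "sampler N ((\<Sum>j<k. 3 ^ j) * T) D1"
    "\<And>x X. X \<subseteq> hits \<Longrightarrow> measure_pmf.prob (D1 x) X \<le> (\<Sum>j<k. 9 ^ j) * measure_pmf.prob (D x) X"
    "\<And>x j. j < k \<Longrightarrow> 1 - measure_pmf.prob (D1 x) hits
       \<le> 1 - (sin (3 ^ j * arcsin (sqrt (measure_pmf.prob (D x) hits))))\<^sup>2" by blast
  obtain D2 where D2: "sampler N (3 ^ k * T) D2"
    "\<And>x X. X \<subseteq> hits \<Longrightarrow> measure_pmf.prob (D2 x) X \<le> 9 ^ k * measure_pmf.prob (D x) X"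
    "\<And>x. measure_pmf.prob (D2 x) hits = (sin (3 ^ k * arcsin (sqrt (measure_pmf.prob (D x) hits))))\<^sup>2"
    using sampler_amplify_iter[OF D, of k] by blast
  let ?R = "\<lambda>x. retry (D1 x) (D2 x)"
  have "sampler N ((\<Sum>j<Suc k. 3 ^ j) * T) ?R"
    using sampler_retry[OF D1(1) D2(1)] by (simp add: algebra_simps)
  moreover have "measure_pmf.prob (?R x) X \<le> (\<Sum>j<Suc k. 9 ^ j) * measure_pmf.prob (D x) X"
    if "X \<subseteq> hits" for x X
    using order_trans[OF prob_retry_le[OF that] add_mono[OF D1(2)[OF that] D2(2)[OF that]]]
    by (simp add: algebra_simps)
  moreover have "1 - measure_pmf.prob (?R x) hits
      \<le> 1 - (sin (3 ^ j * arcsin (sqrt (measure_pmf.prob (D x) hits))))\<^sup>2" if "j < Suc k" for x j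
  proof (cases "j = k")
    case True
    have "1 - measure_pmf.prob (?R x) hits \<le> 1 - measure_pmf.prob (D2 x) hits"
      unfolding prob_retry_miss by (simp add: mult_left_le_one_le)
    then show ?thesis by (simp add: D2(3) True)
  next
    case False
    have "1 - measure_pmf.prob (?R x) hits \<le> 1 - measure_pmf.prob (D1 x) hits"
      unfolding prob_retry_miss by (simp add: mult_right_le_one_le)
    also have "\<dots> \<le> 1 - (sin (3 ^ j * arcsin (sqrt (measure_pmf.prob (D x) hits))))\<^sup>2"
      using False that by (intro D1(3)) simp
    finally show ?thesis .
  qed
  ultimately show ?case by (intro exI[of _ ?R] conjI allI impI) simp_all
qed

lemma sampler_repeat:
  fixes D :: "(nat \<Rightarrow> bool) \<Rightarrow> ('a \<times> bool) pmf"
  assumes D: "sampler N T D"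
  shows "\<exists>D'. sampler N (r * T) D' \<and>
    (\<forall>x X. X \<subseteq> hits \<longrightarrow> measure_pmf.prob (D' x) X \<le> real r * measure_pmf.prob (D x) X) \<and>
    (\<forall>x. 1 - measure_pmf.prob (D' x) hits = (1 - measure_pmf.prob (D x) hits) ^ r)"
proof (induction r)
  case 0
  have "X \<subseteq> hits \<Longrightarrow> measure_pmf.prob (return_pmf (undefined :: 'a, False)) X = 0" for X
    by (auto simp: indicator_def)
  then show ?case
    using sampler_const by (intro exI[of _ "\<lambda>_. return_pmf (undefined, False)"]) auto
next
  case (Suc r)
  then obtain D1 where D1: "sampler N (r * T) D1"
    "\<And>x X. X \<subseteq> hits \<Longrightarrow> measure_pmf.prob (D1 x) X \<le> real r * measure_pmf.prob (D x) X"
    "\<And>x. 1 - measure_pmf.prob (D1 x) hits = (1 - measure_pmf.prob (D x) hits) ^ r" by blast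
  let ?R = "\<lambda>x. retry (D x) (D1 x)"
  have "sampler N (Suc r * T) ?R"
    using sampler_retry[OF D D1(1)] by simp
  moreover have "measure_pmf.prob (?R x) X \<le> real (Suc r) * measure_pmf.prob (D x) X"
    if "X \<subseteq> hits" for x X
    using order_trans[OF prob_retry_le[OF that] add_left_mono[OF D1(2)[OF that]]]
    by (simp add: algebra_simps)
  moreover have "1 - measure_pmf.prob (?R x) hits = (1 - measure_pmf.prob (D x) hits) ^ Suc r" for x
    unfolding prob_retry_miss by (simp add: D1(3))
  ultimately show ?case by (intro exI[of _ ?R] conjI allI impI) simp_all
qed

definition block :: "nat \<Rightarrow> nat \<Rightarrow> (nat \<Rightarrow> bool) \<Rightarrow> nat \<Rightarrow> bool" where
  "block M i x = (\<lambda>j. x (i * M + j))"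

lemma or_tree_Suc: "or_tree (Suc d) n x \<longleftrightarrow> (\<exists>i<n. and_tree d n (block (n ^ d) i x))"
  and and_tree_Suc: "and_tree (Suc d) n x \<longleftrightarrow> (\<forall>i<n. or_tree d n (block (n ^ d) i x))"
  by (simp_all add: block_def)

lemma sampler_block:
  assumes "sampler M T D" "i < n"
  shows "sampler (n * M) T (\<lambda>x. D (block M i x))"
  unfolding block_def
  by (rule sampler_shift[OF assms(1)]) (use mult_le_mono1[of "Suc i" n M] assms(2) in simp)

definition random_block ::
    "nat \<Rightarrow> nat \<Rightarrow> ((nat \<Rightarrow> bool) \<Rightarrow> bool pmf) \<Rightarrow> (nat \<Rightarrow> bool) \<Rightarrow> (nat \<times> bool) pmf" where
  "random_block n M D x = bind_pmf (pmf_of_set {..<n}) (\<lambda>i. map_pmf (Pair i) (D (block M i x)))"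

lemma sampler_random_block:
  assumes D: "sampler M T D" and n: "n > 0"
  shows "sampler (n * M) T (random_block n M D)"
proof -
  \<comment> \<open>\<open>sampler_bind\<close> asks for a continuation after every value; indices
    \<open>i \<ge> n\<close> are never drawn and get a dummy.\<close>
  let ?E = "\<lambda>i. if i < n then (\<lambda>x. map_pmf (Pair i) (D (block M i x))) else (\<lambda>_. return_pmf (i, False))"
  have "sampler (n * M) (0 + T) (\<lambda>x. bind_pmf (pmf_of_set {..<n}) (\<lambda>i. ?E i x))"
    by (rule sampler_bind[OF sampler_uniform[OF n]])
      (simp add: sampler_map[OF sampler_block[OF D]] sampler_mono[OF sampler_const])
  moreover have "bind_pmf (pmf_of_set {..<n}) (\<lambda>i. ?E i x) = random_block n M D x" for x
    unfolding random_block_def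
    by (rule bind_pmf_cong) (use n in \<open>auto simp: set_pmf_of_set lessThan_empty_iff\<close>)
  ultimately show ?thesis by simp
qed

lemma prob_random_block:
  assumes "n > 0"
  shows "measure_pmf.prob (random_block n M D x) X
    = (\<Sum>i<n. measure_pmf.prob (D (block M i x)) (Pair i -` X)) / real n"
  unfolding random_block_def prob_bind_pmf
  using assms by (simp add: integral_pmf_of_set lessThan_empty_iff)

text \<open>If some child is true, testing a random child hits with probability at least
  \<open>1 / (2 * n)\<close>. Among the depths up to \<open>K\<close> one amplifies this to at least
  \<open>1 / 4\<close>, and \<open>r\<close> repetitions all miss with probability at most
  \<open>(3 / 4) ^ r\<close>.\<close>

lemma sampler_search:
  fixes f :: "(nat \<Rightarrow> bool) \<Rightarrow> bool"
  assumes D: "sampler M T D" and n: "n > 0" and \<epsilon>: "0 \<le> \<epsilon>"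
    and f_False: "\<And>y. \<not> f y \<Longrightarrow> pmf (D y) True \<le> \<epsilon>" and f_True: "\<And>y. f y \<Longrightarrow> 1 / 2 \<le> pmf (D y) True"
  shows "\<exists>T' R. real T' \<le> 5 * sqrt (real n) * real r * real T \<and> sampler (n * M) T' R \<and>
    (\<forall>x. measure_pmf.prob (R x) {(i, b). b \<and> \<not> (i < n \<and> f (block M i x))} \<le> 11 * real r * real n * \<epsilon>) \<and>
    (\<forall>x. (\<exists>i<n. f (block M i x)) \<longrightarrow> measure_pmf.prob (R x) (- hits) \<le> (3 / 4) ^ r)"
proof -
  let ?S = "random_block n M D"
  have ex: "\<exists>K. n \<le> 9 ^ K"
    using less_exp[of n] power_mono[of 2 "9::nat" n] by (intro exI[of _ n]) linarith
  \<comment> \<open>The least sufficient depth also satisfies \<open>9 ^ K \<le> 9 * n\<close>. The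
    geometric sums of \<open>3 ^ j\<close> and \<open>9 ^ j\<close> are then at most
    \<open>5 * sqrt n\<close> and \<open>11 * n\<close>.\<close>
  define K where "K = (LEAST K. n \<le> 9 ^ K)"
  have K: "n \<le> 9 ^ K" unfolding K_def by (rule LeastI_ex[OF ex])
  have K': "9 ^ K \<le> 9 * n"
  proof (cases K)
    case (Suc k)
    then have "\<not> n \<le> 9 ^ k" using not_less_Least[of k "\<lambda>K. n \<le> 9 ^ K"] by (simp add: K_def)
    then show ?thesis by (simp add: Suc)
  qed (use n in simp)
  obtain R1 where R1: "sampler (n * M) ((\<Sum>j<Suc K. 3 ^ j) * T) R1"
    "\<And>x X. X \<subseteq> hits \<Longrightarrow> measure_pmf.prob (R1 x) X \<le> (\<Sum>j<Suc K. 9 ^ j) * measure_pmf.prob (?S x) X"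
    "\<And>x j. j < Suc K \<Longrightarrow> 1 - measure_pmf.prob (R1 x) hits
       \<le> 1 - (sin (3 ^ j * arcsin (sqrt (measure_pmf.prob (?S x) hits))))\<^sup>2"
    using sampler_amplify_all[OF sampler_random_block[OF D n], of "Suc K"] by blast
  obtain R where R: "sampler (n * M) (r * ((\<Sum>j<Suc K. 3 ^ j) * T)) R"
    "\<And>x X. X \<subseteq> hits \<Longrightarrow> measure_pmf.prob (R x) X \<le> real r * measure_pmf.prob (R1 x) X"
    "\<And>x. 1 - measure_pmf.prob (R x) hits = (1 - measure_pmf.prob (R1 x) hits) ^ r"
    using sampler_repeat[OF R1(1), of r] by blast
  have "real (r * ((\<Sum>j<Suc K. 3 ^ j) * T)) \<le> 5 * sqrt (real n) * real r * real T"
  proof -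
    have "(3::real) ^ K = sqrt (9 ^ K)"
      using real_sqrt_power[of 9 K] by (simp add: real_sqrt_eq_iff)
    also have "\<dots> \<le> sqrt (9 * real n)"
      using K' by (simp flip: of_nat_le_iff[where 'a = real])
    also have "\<dots> = 3 * sqrt (real n)" by (simp add: real_sqrt_mult)
    finally have K3: "(3::real) ^ K \<le> 3 * sqrt (real n)" .
    have le: "(3 * a - 1) / 2 \<le> 5 * s" if "a \<le> 3 * s" "0 \<le> s" for a s :: real
      using that by (simp add: field_simps)
    have "(\<Sum>j<Suc K. (3::real) ^ j) = (3 * 3 ^ K - 1) / 2"
      by (subst geometric_sum) simp_all
    also have "\<dots> \<le> 5 * sqrt (real n)"
      by (rule le[OF K3]) simp
    finally have "(\<Sum>j<Suc K. (3::real) ^ j) \<le> 5 * sqrt (real n)" .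
    from mult_right_mono[OF this, of "real r * real T"] show ?thesis
      by (simp add: algebra_simps)
  qed
  moreover have "measure_pmf.prob (R x) {(i, b). b \<and> \<not> (i < n \<and> f (block M i x))} \<le> 11 * real r * real n * \<epsilon>" for x
  proof -
    let ?X = "{(i, b). b \<and> \<not> (i < n \<and> f (block M i x))}"
    have X: "?X \<subseteq> hits" by auto
    have "measure_pmf.prob (D (block M i x)) (Pair i -` ?X) \<le> \<epsilon>" if "i < n" for i
    proof (cases "f (block M i x)")
      case True
      then have "Pair i -` ?X = {}" using that by auto
      show ?thesis unfolding \<open>Pair i -` ?X = {}\<close> using \<epsilon> by simp
    next
      case False
      then have "Pair i -` ?X = {True}" using that by auto
      show ?thesis unfolding \<open>Pair i -` ?X = {True}\<close> using f_False[OF False] by (simp add: measure_pmf_single)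
    qed
    then have "measure_pmf.prob (?S x) ?X \<le> \<epsilon>"
      using n sum_mono[of "{..<n}" "\<lambda>i. measure_pmf.prob (D (block M i x)) (Pair i -` ?X)" "\<lambda>_. \<epsilon>"]
      unfolding prob_random_block[OF n] by (simp add: field_simps)
    moreover have "(\<Sum>j<Suc K. (9::real) ^ j) \<le> 11 * real n"
      using geometric_sum[of "9::real" "Suc K"] K' by (simp flip: of_nat_le_iff[where 'a = real])
    ultimately have "(\<Sum>j<Suc K. 9 ^ j) * measure_pmf.prob (?S x) ?X \<le> 11 * real n * \<epsilon>"
      by (intro mult_mono) auto
    then have "real r * measure_pmf.prob (R1 x) ?X \<le> real r * (11 * real n * \<epsilon>)"
      using R1(2)[OF X, of x] by (intro mult_left_mono) auto
    then show ?thesis using R(2)[OF X, of x] by (simp add: algebra_simps)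
  qed
  moreover have "measure_pmf.prob (R x) (- hits) \<le> (3 / 4) ^ r" if "\<exists>i<n. f (block M i x)" for x
  proof -
    from that obtain i where i: "i < n" "f (block M i x)" by blast
    have hits: "Pair i -` hits = {True}" for i :: nat by auto
    have "1 / 2 \<le> measure_pmf.prob (D (block M i x)) (Pair i -` hits)"
      unfolding hits using f_True[OF i(2)] by (simp add: measure_pmf_single)
    also have "\<dots> \<le> (\<Sum>i<n. measure_pmf.prob (D (block M i x)) (Pair i -` hits))"
      using i(1) by (intro member_le_sum) auto
    finally have "1 / (2 * real n) \<le> measure_pmf.prob (?S x) hits"
      using n unfolding prob_random_block[OF n] by (simp add: field_simps)
    from amplified_angle[OF _ _ n this K] obtain j where
      "j \<le> K" "1 / 4 \<le> (sin (3 ^ j * arcsin (sqrt (measure_pmf.prob (?S x) hits))))\<^sup>2" by auto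
    then have "1 - measure_pmf.prob (R1 x) hits \<le> 3 / 4"
      using R1(3)[of j x] by simp
    then have "(1 - measure_pmf.prob (R1 x) hits) ^ r \<le> (3 / 4) ^ r"
      by (intro power_mono) auto
    moreover have "measure_pmf.prob (R x) (- hits) = 1 - measure_pmf.prob (R x) hits"
      using measure_pmf.prob_compl[of hits "R x"] by (simp add: Compl_eq_Diff_UNIV)
    ultimately show ?thesis by (simp add: R(3))
  qed
  ultimately show ?thesis using R(1) by blast
qed

section \<open>Evaluating and certifying AND-OR trees\<close>

definition lg :: "nat \<Rightarrow> nat" where
  "lg n = nat \<lceil>log 2 (real n)\<rceil>"

lemma lg_ge_1: "n \<ge> 2 \<Longrightarrow> 1 \<le> lg n"
  unfolding lg_def One_nat_def Suc_le_eq by simp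

lemma le_two_power_lg:
  assumes "n > 0"
  shows "n \<le> 2 ^ lg n"
proof -
  have "real n = 2 powr log 2 (real n)" using assms by simp
  also have "\<dots> \<le> 2 powr real (lg n)"
    unfolding lg_def by (intro powr_mono) (simp_all add: real_nat_ceiling_ge)
  also have "\<dots> = real (2 ^ lg n)" by (simp add: powr_realpow)
  finally show ?thesis by (simp only: of_nat_le_iff)
qed

lemma lg_le:
  assumes "n > 0"
  shows "lg n \<le> n"
proof -
  have "log 2 (real n) \<le> real n"
    using less_exp[of n] assms by (intro log_le_iff[THEN iffD2]) (auto simp: powr_realpow of_nat_less_iff[symmetric] simp del: of_nat_less_iff intro: less_imp_le)
  then show ?thesis unfolding lg_def by (simp add: ceiling_le_iff)
qed

text \<open>The error is an arbitrary inverse power of \<open>n\<close>, because a search over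
  \<open>n\<close> children inflates the error of its test by a factor of order
  \<open>n * lg n\<close>.\<close>

definition evaluates :: "(nat \<Rightarrow> (nat \<Rightarrow> bool) \<Rightarrow> bool) \<Rightarrow> nat \<Rightarrow> nat \<Rightarrow> real \<Rightarrow> nat \<Rightarrow> bool" where
  "evaluates f d a C n \<longleftrightarrow> (\<exists>T D. real T \<le> C * real (lg n) ^ d * sqrt (real n) ^ d \<and> sampler (n ^ d) T D \<and>
     (\<forall>x. pmf (D x) (\<not> f n x) \<le> 1 / real n ^ a))"

lemma pmf_bool: "pmf p True = 1 - pmf p False" "pmf p False = 1 - pmf p True"
  using pmf_True_conv_False[of p] pmf_False_conv_True[of p] by simp_all

lemma pmf_map_Not: "pmf (map_pmf Not p) b = pmf p (\<not> b)"
proof -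
  have "pmf (map_pmf Not p) (Not (\<not> b)) = pmf p (\<not> b)"
    by (rule pmf_map_inj') (simp add: inj_on_def)
  then show ?thesis by simp
qed

lemma evaluates_and_tree:
  assumes "evaluates (or_tree d) d a C n"
  shows "evaluates (and_tree d) d a C n"
proof -
  from assms obtain T D where *: "real T \<le> C * real (lg n) ^ d * sqrt (real n) ^ d" "sampler (n ^ d) T D"
    "\<And>x. pmf (D x) (\<not> or_tree d n x) \<le> 1 / real n ^ a" unfolding evaluates_def by blast
  show ?thesis
    unfolding evaluates_def
  proof (intro exI conjI allI)
    show "sampler (n ^ d) T (\<lambda>x. map_pmf Not (D (\<lambda>j. \<not> x j)))"
      by (rule sampler_map[OF sampler_negate[OF *(2)]])
    show "pmf (map_pmf Not (D (\<lambda>j. \<not> x j))) (\<not> and_tree d n x) \<le> 1 / real n ^ a" for x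
      using *(3)[of "\<lambda>j. \<not> x j"] by (simp add: pmf_map_Not or_tree_negate)
  qed (rule *(1))
qed

text \<open>The evaluator of the children serves as the test of the search. Evaluation of the OR
  uses only the flag of the result; certification also uses the index found.\<close>

lemma find_child:
  assumes C: "\<And>n. n \<ge> 2 \<Longrightarrow> evaluates (and_tree d) d (a + 2 + 33 * a) C n" "C \<ge> 0" and n: "n \<ge> 2"
  shows "\<exists>T R. real T \<le> 15 * real a * C * real (lg n) ^ Suc d * sqrt (real n) ^ Suc d \<and> sampler (n ^ Suc d) T R \<and>
    (\<forall>x. measure_pmf.prob (R x) {(i, b). b \<and> \<not> (i < n \<and> and_tree d n (block (n ^ d) i x))} \<le> 1 / real n ^ a) \<and>
    (\<forall>x. or_tree (Suc d) n x \<longrightarrow> measure_pmf.prob (R x) (- hits) \<le> 1 / real n ^ a)"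
proof -
  \<comment> \<open>False hits have probability at most \<open>33 * a * lg n * n / n ^ ?e\<close>:
    \<open>n ^ 2\<close> absorbs \<open>n * lg n\<close>, \<open>n ^ (33 * a)\<close> absorbs
    \<open>33 * a\<close>, and \<open>n ^ a\<close> remains. As
    \<open>(3 / 4) ^ 3 \<le> 1 / 2\<close>, the choice of \<open>?r\<close> makes a miss as unlikely
    as \<open>1 / 2 ^ (a * lg n)\<close>.\<close>
  let ?e = "a + 2 + 33 * a" and ?r = "3 * a * lg n"
  from C(1)[OF n] obtain T D where D: "real T \<le> C * real (lg n) ^ d * sqrt (real n) ^ d" "sampler (n ^ d) T D"
    "\<And>x. pmf (D x) (\<not> and_tree d n x) \<le> 1 / real n ^ ?e" unfolding evaluates_def by blast
  have half: "1 / real n ^ ?e \<le> 1 / 2"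
  proof -
    have "(2::real) ^ 1 \<le> 2 ^ ?e" by (rule power_increasing) auto
    also have "\<dots> \<le> real n ^ ?e" using n by (intro power_mono) auto
    finally show ?thesis using n by (simp add: field_simps)
  qed
  have "\<exists>T' R. real T' \<le> 5 * sqrt (real n) * real ?r * real T \<and> sampler (n * n ^ d) T' R \<and>
    (\<forall>x. measure_pmf.prob (R x) {(i, b). b \<and> \<not> (i < n \<and> and_tree d n (block (n ^ d) i x))}
       \<le> 11 * real ?r * real n * (1 / real n ^ ?e)) \<and>
    (\<forall>x. (\<exists>i<n. and_tree d n (block (n ^ d) i x)) \<longrightarrow> measure_pmf.prob (R x) (- hits) \<le> (3 / 4) ^ ?r)"
  proof (rule sampler_search[OF D(2)])
    show "pmf (D y) True \<le> 1 / real n ^ ?e" if "\<not> and_tree d n y" for y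
      using D(3)[of y] that by simp
    show "1 / 2 \<le> pmf (D y) True" if "and_tree d n y" for y
      using D(3)[of y] that half pmf_bool(1)[of "D y"] by simp
  qed (use n in auto)
  then obtain T' R where R: "real T' \<le> 5 * sqrt (real n) * real ?r * real T" "sampler (n ^ Suc d) T' R"
    "\<And>x. measure_pmf.prob (R x) {(i, b). b \<and> \<not> (i < n \<and> and_tree d n (block (n ^ d) i x))}
       \<le> 11 * real ?r * real n * (1 / real n ^ ?e)"
    "\<And>x. or_tree (Suc d) n x \<Longrightarrow> measure_pmf.prob (R x) (- hits) \<le> (3 / 4) ^ ?r"
    unfolding or_tree_Suc power_Suc by blast
  have "real T' \<le> 15 * real a * C * real (lg n) ^ Suc d * sqrt (real n) ^ Suc d"
  proof -
    have "real T' \<le> 5 * sqrt (real n) * real ?r * (C * real (lg n) ^ d * sqrt (real n) ^ d)"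
      using R(1) mult_left_mono[OF D(1), of "5 * sqrt (real n) * real ?r"] by simp
    then show ?thesis by (simp add: algebra_simps)
  qed
  moreover have "11 * real ?r * real n * (1 / real n ^ ?e) \<le> 1 / real n ^ a"
  proof -
    have "real (33 * a) \<le> 2 ^ (33 * a)"
      using less_exp[of "33 * a"] by (simp del: less_exp flip: of_nat_less_iff[where 'a = real])
    also have "\<dots> \<le> real n ^ (33 * a)" using n by (intro power_mono) auto
    finally have "real (33 * a) * real n * real n \<le> real n ^ (33 * a) * real n * real n"
      by (intro mult_right_mono) auto
    moreover have "real (33 * a) * real (lg n) * real n \<le> real (33 * a) * real n * real n"
      using lg_le[of n] n by (intro mult_right_mono mult_left_mono) auto
    ultimately have "11 * real ?r * real n \<le> real n ^ (2 + 33 * a)"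
      by (simp add: power_add power2_eq_square algebra_simps)
    then have "11 * real ?r * real n * (1 / real n ^ ?e) \<le> real n ^ (2 + 33 * a) * (1 / real n ^ ?e)"
      by (intro mult_right_mono) auto
    also have "\<dots> = 1 / real n ^ a"
    proof -
      have "?e = (2 + 33 * a) + a" by simp
      then have "real n ^ ?e = real n ^ (2 + 33 * a) * real n ^ a" by (simp only: power_add)
      then show ?thesis using n by simp
    qed
    finally show ?thesis .
  qed
  moreover have "(3 / 4) ^ ?r \<le> 1 / real n ^ a"
  proof -
    have "(3 / 4 :: real) ^ ?r = ((3 / 4) ^ 3) ^ (lg n * a)"
      by (simp add: power_mult[symmetric] mult_ac)
    also have "\<dots> \<le> (1 / 2) ^ (lg n * a)"
      by (intro power_mono) (simp_all add: power3_eq_cube)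
    also have "\<dots> = 1 / real (2 ^ lg n) ^ a"
      by (simp add: power_mult power_divide)
    also have "\<dots> \<le> 1 / real n ^ a"
      using n le_two_power_lg[of n] by (intro divide_left_mono power_mono) (simp_all only: of_nat_le_iff, auto)
    finally show ?thesis .
  qed
  ultimately show ?thesis using R(2-4) order_trans by blast
qed

text \<open>The exponent \<open>a\<close> varies in the induction, since each level asks a smaller
  error of the level below. The constant depends on \<open>d\<close> and \<open>a\<close>, but not
  on \<open>n\<close>.\<close>

lemma evaluates_or_tree: "\<exists>C\<ge>0. \<forall>n\<ge>2. evaluates (or_tree d) d a C n"
proof (induction d arbitrary: a)
  case 0
  have "evaluates (or_tree 0) 0 a 1 n" for n
    unfolding evaluates_def
    by (intro exI[of _ 1] exI[of _ "\<lambda>x. return_pmf (x 0)"]) (use sampler_query[of 0 1] in simp)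
  then show ?case by (intro exI[of _ 1]) (simp del: or_tree.simps)
next
  case (Suc d)
  obtain C where C': "C \<ge> 0" "\<forall>n\<ge>2. evaluates (or_tree d) d (a + 2 + 33 * a) C n"
    using Suc.IH[of "a + 2 + 33 * a"] by (elim exE conjE)
  have C: "C \<ge> 0" "\<And>n. n \<ge> 2 \<Longrightarrow> evaluates (and_tree d) d (a + 2 + 33 * a) C n"
    using C' by (simp_all add: evaluates_and_tree)
  have "evaluates (or_tree (Suc d)) (Suc d) a (15 * real a * C) n" if n: "n \<ge> 2" for n
  proof -
    from find_child[OF C(2,1) n] obtain T R where R:
      "real T \<le> 15 * real a * C * real (lg n) ^ Suc d * sqrt (real n) ^ Suc d" "sampler (n ^ Suc d) T R"
      "\<And>x. measure_pmf.prob (R x) {(i, b). b \<and> \<not> (i < n \<and> and_tree d n (block (n ^ d) i x))} \<le> 1 / real n ^ a"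
      "\<And>x. or_tree (Suc d) n x \<Longrightarrow> measure_pmf.prob (R x) (- hits) \<le> 1 / real n ^ a" by blast
    have "pmf (map_pmf snd (R x)) (\<not> or_tree (Suc d) n x) \<le> 1 / real n ^ a" for x
    proof (cases "or_tree (Suc d) n x")
      case True
      have "snd -` {False} = (- hits :: (nat \<times> bool) set)" by auto
      with R(4)[OF True] True show ?thesis by (simp only: pmf_map not_True_eq_False)
    next
      case False
      then have "\<not> (i < n \<and> and_tree d n (block (n ^ d) i x))" for i
        unfolding or_tree_Suc by blast
      then have "snd -` {True} = {(i, b). b \<and> \<not> (i < n \<and> and_tree d n (block (n ^ d) i x))}"
        by (simp only: set_eq_iff) auto
      with R(3)[of x] False show ?thesis by (simp only: pmf_map not_False_eq_True)
    qed
    note correct = this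
    show ?thesis
      unfolding evaluates_def
    proof (intro exI conjI allI)
      show "sampler (n ^ Suc d) T (\<lambda>x. map_pmf snd (R x))" by (rule sampler_map[OF R(2)])
    qed (rule R(1), rule correct)
  qed
  then show ?case using C(1) by (intro exI[of _ "15 * real a * C"]) (simp del: or_tree.simps)
qed

text \<open>
  The exponent \<open>k\<close> of \<open>sqrt n\<close> will be \<open>d\<close> for a root OR and \<open>d + 1\<close> for a root AND: an AND needs all
  \<open>n\<close> children certified, an OR only the one found by the search.
\<close>

definition certifies :: "(nat \<Rightarrow> (nat \<Rightarrow> bool) \<Rightarrow> bool) \<Rightarrow> nat \<Rightarrow> nat \<Rightarrow> nat \<Rightarrow> real \<Rightarrow> nat \<Rightarrow> bool" where
  "certifies f d k a C n \<longleftrightarrow> (\<exists>T D. real T \<le> C * real (lg n) ^ d * sqrt (real n) ^ k \<and> sampler (n ^ d) T D \<and>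
     (\<forall>x. \<not> f n x \<longrightarrow> pmf (D x) True = 0) \<and> (\<forall>x. f n x \<longrightarrow> pmf (D x) False \<le> 1 / real n ^ a))"

text \<open>\<open>False\<close> means here that no certificate was found. The conjunction answers
  \<open>True\<close> only if all runs do, so one child that is never certified excludes
  \<open>True\<close> exactly; failures add up by the union bound.\<close>

lemma sampler_all:
  assumes D: "sampler M T D" and "k \<le> n"
  shows "\<exists>D'. sampler (n * M) (k * T) D' \<and> (\<forall>x. (\<exists>i<k. pmf (D (block M i x)) True = 0) \<longrightarrow> pmf (D' x) True = 0) \<and>
    (\<forall>x. pmf (D' x) False \<le> (\<Sum>i<k. pmf (D (block M i x)) False))"
  using assms(2)
proof (induction k)
  case 0
  show ?case using sampler_const[of "n * M" True] by (intro exI[of _ "\<lambda>_. return_pmf True"]) simp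
next
  case (Suc k)
  then obtain D1 where D1: "sampler (n * M) (k * T) D1"
    "\<And>x i. i < k \<Longrightarrow> pmf (D (block M i x)) True = 0 \<Longrightarrow> pmf (D1 x) True = 0"
    "\<And>x. pmf (D1 x) False \<le> (\<Sum>i<k. pmf (D (block M i x)) False)" by auto
  let ?D2 = "\<lambda>x. D (block M k x)"
  let ?D = "\<lambda>x. bind_pmf (D1 x) (\<lambda>b. (if b then ?D2 else (\<lambda>_. return_pmf False)) x)"
  have "sampler (n * M) (k * T + T) ?D"
    by (rule sampler_bind[OF D1(1)])
      (use sampler_block[OF D] sampler_mono[OF sampler_const] Suc.prems in auto)
  moreover have prod: "pmf (?D x) True = pmf (D1 x) True * pmf (?D2 x) True" for x
    by (simp add: pmf_bind integral_measure_pmf[of UNIV] UNIV_bool if_distribR)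
  have "pmf (?D x) True = 0" if "i < Suc k" "pmf (D (block M i x)) True = 0" for x i
    unfolding prod using D1(2)[of i x] that by (cases "i = k") auto
  moreover have "pmf (?D x) False \<le> (\<Sum>i<Suc k. pmf (D (block M i x)) False)" for x
  proof -
    have "pmf (?D x) False = 1 - (1 - pmf (D1 x) False) * (1 - pmf (?D2 x) False)"
      using prod[of x] pmf_bool(1)[of "D1 x"] pmf_bool(1)[of "?D2 x"] pmf_bool(2)[of "?D x"] by simp
    also have "\<dots> \<le> pmf (D1 x) False + pmf (?D2 x) False"
      by (simp add: algebra_simps)
    finally show ?thesis using D1(3)[of x] by simp
  qed
  ultimately show ?case by (intro exI[of _ ?D]) (auto simp: add.commute)
qed

lemma certifies_trees:
  "(\<exists>C\<ge>0. \<forall>n\<ge>2. certifies (or_tree d) d d a C n) \<and> (\<exists>C\<ge>0. \<forall>n\<ge>2. certifies (and_tree d) d (Suc d) a C n)"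
proof (induction d arbitrary: a)
  case 0
  have "certifies (or_tree 0) 0 0 a 1 n \<and> certifies (and_tree 0) 0 (Suc 0) a 1 n" if n: "n \<ge> 2" for n
  proof -
    have "1 \<le> sqrt (real n)" using n by simp
    then show ?thesis
      unfolding certifies_def
      by (intro conjI exI[of _ 1] exI[of _ "\<lambda>x. return_pmf (x 0)"]) (use sampler_query[of 0 1] in simp_all)
  qed
  then show ?case by (auto intro!: exI[of _ 1] simp del: or_tree.simps and_tree.simps)
next
  case (Suc d)
  \<comment> \<open>The union bound over \<open>n\<close> children loses one factor
    \<open>n\<close>, hence the exponent \<open>Suc a\<close>.\<close>
  obtain Cv where Cv: "Cv \<ge> 0" "\<And>n. n \<ge> 2 \<Longrightarrow> certifies (or_tree d) d d (Suc a) Cv n"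
    using Suc.IH[of "Suc a"] by blast
  have "certifies (and_tree (Suc d)) (Suc d) (Suc (Suc d)) a Cv n" if n: "n \<ge> 2" for n
  proof -
    from Cv(2)[OF n] obtain T D where D: "real T \<le> Cv * real (lg n) ^ d * sqrt (real n) ^ d" "sampler (n ^ d) T D"
      "\<And>x. \<not> or_tree d n x \<Longrightarrow> pmf (D x) True = 0" "\<And>x. or_tree d n x \<Longrightarrow> pmf (D x) False \<le> 1 / real n ^ Suc a"
      unfolding certifies_def by blast
    from sampler_all[OF D(2) order_refl[of n]] obtain D' where D': "sampler (n * n ^ d) (n * T) D'"
      "\<And>x i. i < n \<Longrightarrow> pmf (D (block (n ^ d) i x)) True = 0 \<Longrightarrow> pmf (D' x) True = 0"
      "\<And>x. pmf (D' x) False \<le> (\<Sum>i<n. pmf (D (block (n ^ d) i x)) False)" by blast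
    have "pmf (D' x) False \<le> 1 / real n ^ a" if "and_tree (Suc d) n x" for x
    proof -
      have "pmf (D' x) False \<le> (\<Sum>i<n. 1 / real n ^ Suc a)"
        using that D(4) by (intro order_trans[OF D'(3)] sum_mono) (auto simp: and_tree_Suc simp del: and_tree.simps)
      then show ?thesis using n by simp
    qed
    moreover have "pmf (D' x) True = 0" if "\<not> and_tree (Suc d) n x" for x
      using that D(3) D'(2) unfolding and_tree_Suc by blast
    moreover have "real (n * T) \<le> Cv * real (lg n) ^ Suc d * sqrt (real n) ^ Suc (Suc d)"
    proof -
      have "real (n * T) \<le> real n * (1 * (Cv * real (lg n) ^ d * sqrt (real n) ^ d))"
        using D(1) by (simp add: mult_left_mono)
      also have "\<dots> \<le> real n * (real (lg n) * (Cv * real (lg n) ^ d * sqrt (real n) ^ d))"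
        using lg_ge_1[OF n] Cv(1) by (intro mult_left_mono mult_right_mono) auto
      also have "\<dots> = Cv * real (lg n) ^ Suc d * sqrt (real n) ^ Suc (Suc d)"
        by (simp add: algebra_simps)
      finally show ?thesis .
    qed
    ultimately show ?thesis
      unfolding certifies_def power_Suc[of n d] using D'(1)
      by (intro exI[of _ "n * T"] exI[of _ D'] conjI allI impI) simp_all
  qed
  moreover
  obtain Cw where Cw: "Cw \<ge> 0" "\<And>n. n \<ge> 2 \<Longrightarrow> certifies (and_tree d) d (Suc d) (a + 2) Cw n"
    using Suc.IH[of "a + 2"] by blast
  obtain Ce where Ce': "Ce \<ge> 0" "\<forall>n\<ge>2. evaluates (or_tree d) d ((a + 2) + 2 + 33 * (a + 2)) Ce n"
    using evaluates_or_tree[of d "(a + 2) + 2 + 33 * (a + 2)"] by (elim exE conjE)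
  have Ce: "Ce \<ge> 0" "\<And>n. n \<ge> 2 \<Longrightarrow> evaluates (and_tree d) d ((a + 2) + 2 + 33 * (a + 2)) Ce n"
    using Ce' by (simp_all only: evaluates_and_tree)
  have "certifies (or_tree (Suc d)) (Suc d) (Suc d) a (15 * real (a + 2) * Ce + Cw) n" if n: "n \<ge> 2" for n
  proof -
    from Cw(2)[OF n] obtain T W where W: "real T \<le> Cw * real (lg n) ^ d * sqrt (real n) ^ Suc d" "sampler (n ^ d) T W"
      "\<And>x. \<not> and_tree d n x \<Longrightarrow> pmf (W x) True = 0" "\<And>x. and_tree d n x \<Longrightarrow> pmf (W x) False \<le> 1 / real n ^ (a + 2)"
      unfolding certifies_def by blast
    from find_child[OF Ce(2,1) n] obtain T' R where R:
      "real T' \<le> 15 * real (a + 2) * Ce * real (lg n) ^ Suc d * sqrt (real n) ^ Suc d" "sampler (n ^ Suc d) T' R"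
      "\<And>x. measure_pmf.prob (R x) {(i, b). b \<and> \<not> (i < n \<and> and_tree d n (block (n ^ d) i x))} \<le> 1 / real n ^ (a + 2)"
      "\<And>x. or_tree (Suc d) n x \<Longrightarrow> measure_pmf.prob (R x) (- hits) \<le> 1 / real n ^ (a + 2)" by blast
    \<comment> \<open>Only the reported child is certified. A miss or an index out of range yields
      \<open>False\<close>, and a false hit is caught by the error-free certificate, so
      \<open>True\<close> never appears wrongly.\<close>
    define g where "g = (\<lambda>(i, b) x. if b \<and> i < n then W (block (n ^ d) i x) else return_pmf False)"
    let ?D = "\<lambda>x. bind_pmf (R x) (\<lambda>r. g r x)"
    have "sampler (n ^ Suc d) T (g r)" for r
    proof (cases r)
      case (Pair i b)
      show ?thesis
      proof (cases "b \<and> i < n")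
        case True
        then show ?thesis using sampler_block[OF W(2), of i n] by (simp add: g_def Pair)
      next
        case False
        then have "g r = (\<lambda>_. return_pmf False)" by (auto simp: g_def Pair fun_eq_iff)
        then show ?thesis using sampler_mono[OF sampler_const] by simp
      qed
    qed
    then have sampler: "sampler (n ^ Suc d) (T' + T) ?D"
      by (rule sampler_bind[OF R(2)])
    have "pmf (?D x) True = 0" if "\<not> or_tree (Suc d) n x" for x
    proof -
      have "pmf (g r x) True = 0" for r
        using that W(3) by (cases r) (auto simp: g_def or_tree_Suc simp del: or_tree.simps)
      then show ?thesis by (simp add: pmf_bind)
    qed
    moreover have "pmf (?D x) False \<le> 1 / real n ^ a" if f: "or_tree (Suc d) n x" for x
    proof -
      let ?X = "{(i, b). b \<and> \<not> (i < n \<and> and_tree d n (block (n ^ d) i x))}" and ?\<delta> = "1 / real n ^ (a + 2)"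
      have int: "integrable (R x) (indicator X :: _ \<Rightarrow> real)" for X
        by (intro integrable_bounded_pmf[of _ 1]) (auto simp: indicator_def)
      \<comment> \<open>Three ways to fail on a true OR: a false hit, no hit, or a true child whose
        certificate is not found.\<close>
      have "pmf (g r x) False \<le> indicator ?X r + indicator (- hits) r + ?\<delta>" for r
      proof (cases r)
        case (Pair i b)
        show ?thesis
        proof (cases "b \<and> i < n \<and> and_tree d n (block (n ^ d) i x)")
          case True
          then show ?thesis using W(4) by (simp add: g_def Pair)
        next
          case False
          then have "1 \<le> indicator ?X r + (indicator (- hits) r :: real)"
            by (auto simp: Pair indicator_def)
          then show ?thesis using pmf_le_1[of "g r x" False] add_increasing2[of ?\<delta> "pmf (g r x) False"] by simp
        qed
      qed
      then have "pmf (?D x) False \<le> measure_pmf.expectation (R x) (\<lambda>r. indicator ?X r + indicator (- hits) r + ?\<delta>)"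
        unfolding pmf_bind
      proof (intro integral_mono)
        show "integrable (R x) (\<lambda>r. pmf (g r x) False)"
          by (rule integrable_bounded_pmf[of _ 1]) (simp_all add: pmf_le_1)
        show "integrable (R x) (\<lambda>r. indicator ?X r + indicator (- hits) r + ?\<delta>)"
          by (intro Bochner_Integration.integrable_add int) simp
      qed
      also have "\<dots> = measure_pmf.prob (R x) ?X + measure_pmf.prob (R x) (- hits) + ?\<delta>"
        using int by (simp add: Bochner_Integration.integral_add)
      \<comment> \<open>Three errors are rounded up to four, since \<open>4 \<le> n ^ 2\<close>;
        this is the reason for the exponent \<open>a + 2\<close>.\<close>
      also have "\<dots> \<le> 4 * ?\<delta>"
      proof -
        have "p + q + e \<le> 4 * e" if "p \<le> e" "q \<le> e" "0 \<le> e" for p q e :: real using that by simp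
        from this[OF R(3) R(4)[OF f]] show ?thesis by simp
      qed
      also have "\<dots> \<le> real n ^ 2 * ?\<delta>"
        using n power_mono[of 2 "real n" 2] by (intro mult_right_mono) auto
      also have "\<dots> = 1 / real n ^ a"
        using n by (simp add: power2_eq_square field_simps)
      finally show ?thesis .
    qed
    moreover have "real (T' + T) \<le> (15 * real (a + 2) * Ce + Cw) * real (lg n) ^ Suc d * sqrt (real n) ^ Suc d"
    proof -
      have "real T \<le> 1 * (Cw * real (lg n) ^ d * sqrt (real n) ^ Suc d)" using W(1) by simp
      also have "\<dots> \<le> real (lg n) * (Cw * real (lg n) ^ d * sqrt (real n) ^ Suc d)"
        using lg_ge_1[OF n] Cw(1) by (intro mult_right_mono) auto
      finally show ?thesis using R(1) by (simp add: algebra_simps)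
    qed
    ultimately show ?thesis
      unfolding certifies_def using sampler by (intro exI[of _ "T' + T"] exI[of _ ?D] conjI allI impI) blast+
  qed
  then have "\<exists>C\<ge>0. \<forall>n\<ge>2. certifies (or_tree (Suc d)) (Suc d) (Suc d) a C n"
    using Cw(1) Ce(1) by (intro exI[of _ "15 * real (a + 2) * Ce + Cw"]) auto
  ultimately show ?case using Cv(1) by blast
qed

text \<open>A certificate for value \<open>1\<close> is tried first, then one for value
  \<open>0\<close>, which is an AND certificate on the negated leaves. Neither is ever wrong. The
  second one dominates with its additional factor \<open>sqrt n\<close>.\<close>

lemma Q0_or_tree_le: "\<exists>C\<ge>0. \<forall>n\<ge>2. real (Q0 (n ^ d) (or_tree d n)) \<le> C * real (lg n) ^ d * sqrt (real n) ^ Suc d"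
proof -
  obtain Cv where Cv: "Cv \<ge> 0" "\<And>n. n \<ge> 2 \<Longrightarrow> certifies (or_tree d) d d 1 Cv n"
    using certifies_trees[of d 1] by blast
  obtain Cw where Cw: "Cw \<ge> 0" "\<And>n. n \<ge> 2 \<Longrightarrow> certifies (and_tree d) d (Suc d) 1 Cw n"
    using certifies_trees[of d 1] by blast
  have "real (Q0 (n ^ d) (or_tree d n)) \<le> (Cv + Cw) * real (lg n) ^ d * sqrt (real n) ^ Suc d" if n: "n \<ge> 2" for n
  proof -
    let ?f = "or_tree d n"
    from Cv(2)[OF n] obtain T V where V: "real T \<le> Cv * real (lg n) ^ d * sqrt (real n) ^ d" "sampler (n ^ d) T V"
      "\<And>x. \<not> ?f x \<Longrightarrow> pmf (V x) True = 0" "\<And>x. ?f x \<Longrightarrow> pmf (V x) False \<le> 1 / real n ^ 1"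
      unfolding certifies_def by blast
    from Cw(2)[OF n] obtain T' W where W: "real T' \<le> Cw * real (lg n) ^ d * sqrt (real n) ^ Suc d" "sampler (n ^ d) T' W"
      "\<And>x. \<not> and_tree d n x \<Longrightarrow> pmf (W x) True = 0" "\<And>x. and_tree d n x \<Longrightarrow> pmf (W x) False \<le> 1 / real n ^ 1"
      unfolding certifies_def by blast
    define h where "h c = (if c then Some False else None)" for c
    define g where "g b = (if b then (\<lambda>_. return_pmf (Some True)) else (\<lambda>x. map_pmf h (W (\<lambda>j. \<not> x j))))" for b
    let ?D = "\<lambda>x. bind_pmf (V x) (\<lambda>b. g b x)"
    have "sampler (n ^ d) T' (g b)" for b
      using sampler_map[OF sampler_negate[OF W(2)], of h] sampler_mono[OF sampler_const le0, of "n ^ d" T' "Some True"] by (simp add: g_def)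
    then have sampler: "sampler (n ^ d) (T + T') ?D"
      by (rule sampler_bind[OF V(2)])
    have D: "pmf (?D x) a = pmf (V x) True * of_bool (a = Some True) + pmf (V x) False * pmf (map_pmf h (W (\<lambda>j. \<not> x j))) a" for x a
      by (simp add: pmf_bind integral_measure_pmf[of UNIV] UNIV_bool g_def indicator_def)
    have h: "pmf (map_pmf h p) (Some False) = pmf p True" "pmf (map_pmf h p) None = pmf p False"
      "pmf (map_pmf h p) (Some True) = 0" for p
    proof -
      have "h -` {Some False} = {True}" "h -` {None} = {False}" "h -` {Some True} = {}"
        by (auto simp: h_def split: if_splits)
      then show "pmf (map_pmf h p) (Some False) = pmf p True" "pmf (map_pmf h p) None = pmf p False"
        "pmf (map_pmf h p) (Some True) = 0"
        by (simp_all add: pmf_map measure_pmf_single)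
    qed
    have wrong: "pmf (?D x) (Some (\<not> ?f x)) = 0" for x
      using V(3)[of x] W(3)[of "\<lambda>j. \<not> x j"] by (cases "?f x") (simp_all add: D h and_tree_negate)
    have none: "pmf (?D x) None \<le> 1 / 2" for x
    proof -
      \<comment> \<open>No answer means that both certificates failed, and the one for the actual
        value fails with probability at most \<open>1 / n\<close>.\<close>
      have le: "p * q \<le> 1 / 2" if "p \<le> 1 / real n \<or> q \<le> 1 / real n" "0 \<le> p" "p \<le> 1" "0 \<le> q" "q \<le> 1" for p q
      proof -
        have "1 / real n \<le> 1 / 2" using n by (simp add: field_simps)
        then show ?thesis
          using that mult_left_le[of q p] mult_left_le[of p q] by (auto simp: mult.commute)
      qed
      have "pmf (V x) False * pmf (W (\<lambda>j. \<not> x j)) False \<le> 1 / 2"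
        by (rule le) (use V(4)[of x] W(4)[of "\<lambda>j. \<not> x j"] in \<open>auto simp: and_tree_negate pmf_le_1\<close>)
      then show ?thesis by (simp add: D h)
    qed
    obtain m U out where *: "m > 0" "\<And>t. t \<le> T + T' \<Longrightarrow> unitary (2 * n ^ d * m) (U t)"
      "\<And>x a. output_prob out (final_state (n ^ d) m U x (T + T')) a = pmf (?D x) a"
      using sampler_realize[OF sampler] n by auto
    have "zero_error_quantum_computes (n ^ d) ?f (T + T')"
      unfolding zero_error_quantum_computes_def
      by (intro exI[of _ m] exI[of _ U] exI[of _ out] conjI allI ballI impI)
        (use *(1,2) wrong none in \<open>simp_all only: *(3)\<close>)
    then have "Q0 (n ^ d) ?f \<le> T + T'" unfolding Q0_def by (rule Least_le)
    then have "real (Q0 (n ^ d) ?f) \<le> real T + real T'" by linarith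
    also have "real T \<le> (Cv * real (lg n) ^ d * sqrt (real n) ^ d) * sqrt (real n)"
    proof -
      have "(Cv * real (lg n) ^ d * sqrt (real n) ^ d) * 1 \<le> (Cv * real (lg n) ^ d * sqrt (real n) ^ d) * sqrt (real n)"
        using n Cv(1) by (intro mult_left_mono) auto
      then show ?thesis using V(1) by simp
    qed
    finally show ?thesis using W(1) by (simp add: algebra_simps)
  qed
  then show ?thesis using Cv(1) Cw(1) by (intro exI[of _ "Cv + Cw"]) auto
qed

section \<open>Absorbing the logarithms\<close>

lemma lg_power_le:
  assumes d: "d \<ge> 1"
  shows "\<exists>C\<ge>0. \<forall>n\<ge>2. real (lg n) ^ d \<le> C * sqrt (real n)"
proof -
  \<comment> \<open>With this exponent the \<open>d\<close>-th power of \<open>n powr e\<close> is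
    \<open>sqrt n\<close>.\<close>
  define e where "e = 1 / (2 * real d)"
  have e: "e > 0" using d by (simp add: e_def)
  \<comment> \<open>The first summand comes from \<open>ln y \<le> y powr e / e\<close>; the
    \<open>1\<close> pays for rounding up in \<open>lg\<close>, as
    \<open>n powr e \<ge> 1\<close>.\<close>
  define B where "B = 1 / (e * ln 2) + 1"
  have B: "B \<ge> 0" using e by (simp add: B_def)
  have "real (lg n) ^ d \<le> B ^ d * sqrt (real n)" if n: "n \<ge> 2" for n
  proof -
    have n1: "1 \<le> real n" using n by simp
    have "real (lg n) \<le> log 2 (real n) + 1"
      using n unfolding lg_def by (simp add: of_nat_nat)
    also have "\<dots> \<le> (real n powr e / e) / ln 2 + real n powr e"
      unfolding log_def
      by (intro add_mono divide_right_mono ln_powr_bound[OF n1 e] ge_one_powr_ge_zero[OF n1]) (use e in auto)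
    also have "\<dots> = B * real n powr e" by (simp add: B_def algebra_simps)
    finally have "real (lg n) ^ d \<le> (B * real n powr e) ^ d" by (intro power_mono) auto
    also have "\<dots> = B ^ d * real n powr (e * real d)"
      using n by (simp add: power_mult_distrib powr_realpow[symmetric] powr_powr)
    also have "e * real d = 1 / 2" using d by (simp add: e_def)
    finally show ?thesis by (simp add: powr_half_sqrt)
  qed
  then show ?thesis using B by (intro exI[of _ "B ^ d"]) auto
qed

theorem theorem9:
  fixes d :: nat
  assumes "d \<ge> 1"
  shows "(\<lambda>n. real (Q0 (n ^ d) (or_tree d n))) \<in> O(\<lambda>n. real (n ^ d) powr (1 / 2 + 1 / real d)) \<and>
         (\<lambda>n. real (R2 (n ^ d) (or_tree d n))) \<in> \<Omega>(\<lambda>n. real (n ^ d))"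
proof
  obtain C where C: "C \<ge> 0" "\<And>n. n \<ge> 2 \<Longrightarrow> real (Q0 (n ^ d) (or_tree d n)) \<le> C * real (lg n) ^ d * sqrt (real n) ^ Suc d"
    using Q0_or_tree_le[of d] by blast
  obtain B where B: "B \<ge> 0" "\<And>n. n \<ge> 2 \<Longrightarrow> real (lg n) ^ d \<le> B * sqrt (real n)"
    using lg_power_le[OF assms] by blast
  have "real (Q0 (n ^ d) (or_tree d n)) \<le> C * B * real (n ^ d) powr (1 / 2 + 1 / real d)" if n: "n \<ge> 2" for n
  proof -
    \<comment> \<open>The logarithms are traded for one more factor \<open>sqrt n\<close>. The
      exponent of \<open>n\<close> becomes \<open>(d + 2) / 2\<close>, which is
      \<open>1 / 2 + 1 / d\<close> as an exponent of \<open>n ^ d\<close>.\<close>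
    have "real (Q0 (n ^ d) (or_tree d n)) \<le> C * (B * sqrt (real n)) * sqrt (real n) ^ Suc d"
      using C(2)[OF n] mult_right_mono[OF mult_left_mono[OF B(2)[OF n] C(1)], of "sqrt (real n) ^ Suc d"] by simp
    also have "\<dots> = C * B * sqrt (real n) ^ (d + 2)" by simp
    also have "sqrt (real n) ^ (d + 2) = (real n powr (1 / 2)) ^ (d + 2)"
      by (simp only: powr_half_sqrt of_nat_0_le_iff)
    also have "\<dots> = real n powr (real (d + 2) * (1 / 2))"
      by (rule powr_power) (use n in simp)
    also have "real (d + 2) * (1 / 2) = real d * (1 / 2 + 1 / real d)" using assms by (simp add: field_simps)
    also have "real n powr \<dots> = real (n ^ d) powr (1 / 2 + 1 / real d)"
      using n by (simp add: powr_powr[symmetric] powr_realpow)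
    finally show ?thesis .
  qed
  then show "(\<lambda>n. real (Q0 (n ^ d) (or_tree d n))) \<in> O(\<lambda>n. real (n ^ d) powr (1 / 2 + 1 / real d))"
    by (intro bigoI[of _ "C * B"] eventually_sequentiallyI[of 2]) simp
  have "real (n ^ d) \<le> 3 * 4 ^ d * real (R2 (n ^ d) (or_tree d n))" if "n \<ge> 1" for n
    using R2_or_tree_ge[of n d] that by simp
  then have "(\<lambda>n. real (n ^ d)) \<in> O(\<lambda>n. real (R2 (n ^ d) (or_tree d n)))"
    by (intro bigoI[of _ "3 * 4 ^ d"] eventually_sequentiallyI[of 1]) simp
  then show "(\<lambda>n. real (R2 (n ^ d) (or_tree d n))) \<in> \<Omega>(\<lambda>n. real (n ^ d))"
    by (simp add: bigomega_iff_bigo)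
qed

end
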